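(* Let $1<p<\infty$, let $\Omega\subseteq\mathbb{R}^n$, $n\ge 2$, be a bounded open set having $C^1$ boundary, and let $\gamma_1,\gamma_2$ be positive continuous functions on $\overline{\Omega}$. If $\Lambda_{\gamma_1}^{\mathbb{C}}=\Lambda_{\gamma_2}^{\mathbb{C}}$, then $\gamma_1|_{\partial\Omega}=\gamma_2|_{\partial\Omega}$.
   Context: For $z,w\in\mathbb{C}^n$ write $z\cdot w=\sum_j z_jw_j$ and $|z|=(z\cdot\bar z)^{1/2}$. For a positive (real valued) $\gamma\in C(\overline{\Omega})$ and a complex valued $f\in W^{1,p}(\Omega;\mathbb{C})$, let $u_f\in W^{1,p}(\Omega;\mathbb{C})$ be the unique weak solution of $\mathrm{div}(\gamma|\nabla u|^{p-2}\nabla u)=0$ in $\Omega$ with $u=f$ on $\partial\Omega$, meaning that $u_f-f\in W^{1,p}_0(\Omega;\mathbb{C})$ and $\int_\Omega\gamma|\nabla u_f|^{p-2}\nabla u_f\cdot\nabla\varphi\,dx=0$ for all $\varphi\in W^{1,p}_0(\Omega;\mathbb{C})$. Let $X=W^{1,p}(\Omega;\mathbb{C})/W^{1,p}_0(\Omega;\mathbb{C})$ be the abstract trace space. The nonlinear Dirichlet-to-Neumann map $\Lambda_\gamma^{\mathbb{C}}$, acting on complex boundary values, is defined weakly by $$\int_{\partial\Omega}\Lambda_\gamma^{\mathbb{C}}(f)\,\bar g\,dS=\int_\Omega\gamma|\nabla u_f|^{p-2}\nabla u_f\cdot\nabla\bar v\,dx,\qquad f,g\in X,$$ where the left side is notation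 for the (conjugate-linear in $g$) duality pairing and $v$ is any function in $W^{1,p}(\Omega;\mathbb{C})$ representing $g$, i.e. $v-g\in W^{1,p}_0(\Omega;\mathbb{C})$. The expression $|z|^{p-2}z$ is understood as $0$ when $z=0$. *)

theory Defs
  imports "HOL-Analysis.Analysis"
begin

section \<open>Domains with \<open>C\<^sup>1\<close> boundary\<close>

definition C1_function :: "(real ^ 'n \<Rightarrow> real) \<Rightarrow> bool" where
  "C1_function h \<longleftrightarrow>
     (\<exists>g. continuous_on UNIV g \<and> (\<forall>x. (h has_derivative (\<lambda>v. g x \<bullet> v)) (at x)))"

(* The usual local graph condition: near each boundary point, in some orthonormal coordinate
   system whose last axis is nu, Omega is the region above the graph of a C^1 function of the
   remaining n - 1 coordinates.  Those coordinates are encoded by the orthogonal projection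
   x - (nu . x) nu onto the hyperplane nu^perp, so only the values of h on nu^perp matter. *)
definition C1_boundary :: "(real ^ 'n) set \<Rightarrow> bool" where
  "C1_boundary \<Omega> \<longleftrightarrow>
     (\<forall>x0 \<in> frontier \<Omega>. \<exists>r > 0. \<exists>\<nu> h. norm \<nu> = 1 \<and> C1_function h \<and>
        \<Omega> \<inter> ball x0 r = {x \<in> ball x0 r. \<nu> \<bullet> x > h (x - (\<nu> \<bullet> x) *\<^sub>R \<nu>)})"

section \<open>Test functions\<close>

definition partial_deriv :: "'n \<Rightarrow> (real ^ 'n \<Rightarrow> complex) \<Rightarrow> real ^ 'n \<Rightarrow> complex" where
  "partial_deriv i f x = frechet_derivative f (at x) (axis i 1)"

(* Differentiability of all iterated partial derivatives gives their continuity as well. *)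
definition smooth :: "(real ^ 'n \<Rightarrow> complex) \<Rightarrow> bool" where
  "smooth f \<longleftrightarrow> (\<forall>is :: 'n list. \<forall>x. foldr partial_deriv is f differentiable (at x))"

definition test_functions :: "(real ^ 'n) set \<Rightarrow> (real ^ 'n \<Rightarrow> complex) set" where
  "test_functions \<Omega> =
     {\<phi>. smooth \<phi> \<and> compact (closure {x. \<phi> x \<noteq> 0}) \<and> closure {x. \<phi> x \<noteq> 0} \<subseteq> \<Omega>}"

section \<open>Sobolev spaces of complex valued functions\<close>

(* Functions on Omega are represented by total functions whose values off Omega are irrelevant,
   and the spaces below consist of functions rather than of classes modulo null sets. *)

definition locally_integrable ::
    "(real ^ 'n) set \<Rightarrow> (real ^ 'n \<Rightarrow> 'b::euclidean_space) \<Rightarrow> bool" where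
  "locally_integrable \<Omega> f \<longleftrightarrow> (\<forall>K. compact K \<and> K \<subseteq> \<Omega> \<longrightarrow> integrable (lebesgue_on K) f)"

definition Lp_space ::
    "(real ^ 'n) set \<Rightarrow> real \<Rightarrow> (real ^ 'n \<Rightarrow> 'b::euclidean_space) set" where
  "Lp_space \<Omega> p = {f. f \<in> borel_measurable (lebesgue_on \<Omega>) \<and>
                      integrable (lebesgue_on \<Omega>) (\<lambda>x. norm (f x) powr p)}"

definition has_weak_gradient ::
    "(real ^ 'n) set \<Rightarrow> (real ^ 'n \<Rightarrow> complex) \<Rightarrow> (real ^ 'n \<Rightarrow> complex ^ 'n) \<Rightarrow> bool" where
  "has_weak_gradient \<Omega> u G \<longleftrightarrow>
     locally_integrable \<Omega> u \<and> locally_integrable \<Omega> G \<and>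
     (\<forall>\<phi> \<in> test_functions \<Omega>. \<forall>i.
        (LINT x | lebesgue_on \<Omega>. u x * partial_deriv i \<phi> x) =
        - (LINT x | lebesgue_on \<Omega>. G x $ i * \<phi> x))"

(* Determined only up to a null set of Omega. *)
definition weak_grad ::
    "(real ^ 'n) set \<Rightarrow> (real ^ 'n \<Rightarrow> complex) \<Rightarrow> real ^ 'n \<Rightarrow> complex ^ 'n" where
  "weak_grad \<Omega> u = (SOME G. has_weak_gradient \<Omega> u G)"

definition W1p :: "(real ^ 'n) set \<Rightarrow> real \<Rightarrow> (real ^ 'n \<Rightarrow> complex) set" where
  "W1p \<Omega> p = {u. u \<in> Lp_space \<Omega> p \<and> (\<exists>G. has_weak_gradient \<Omega> u G \<and> G \<in> Lp_space \<Omega> p)}"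

definition W1p_norm :: "(real ^ 'n) set \<Rightarrow> real \<Rightarrow> (real ^ 'n \<Rightarrow> complex) \<Rightarrow> real" where
  "W1p_norm \<Omega> p u =
     ((LINT x | lebesgue_on \<Omega>. norm (u x) powr p) +
      (LINT x | lebesgue_on \<Omega>. norm (weak_grad \<Omega> u x) powr p)) powr (1 / p)"

definition W1p_0 :: "(real ^ 'n) set \<Rightarrow> real \<Rightarrow> (real ^ 'n \<Rightarrow> complex) set" where
  "W1p_0 \<Omega> p = {u \<in> W1p \<Omega> p.
     \<forall>\<epsilon> > 0. \<exists>\<phi> \<in> test_functions \<Omega>. W1p_norm \<Omega> p (\<lambda>x. u x - \<phi> x) < \<epsilon>}"

definition trace_space :: "(real ^ 'n) set \<Rightarrow> real \<Rightarrow> (real ^ 'n \<Rightarrow> complex) set set" where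
  "trace_space \<Omega> p =
     W1p \<Omega> p // {(u, v). u \<in> W1p \<Omega> p \<and> v \<in> W1p \<Omega> p \<and> (\<lambda>x. u x - v x) \<in> W1p_0 \<Omega> p}"

section \<open>The weighted \<open>p\<close>-Laplace equation and the Dirichlet-to-Neumann map\<close>

(* The complex bilinear product; there is no conjugation. *)
definition cdot :: "complex ^ 'n \<Rightarrow> complex ^ 'n \<Rightarrow> complex" where
  "cdot z w = (\<Sum>j\<in>UNIV. z $ j * w $ j)"

(* Scaling the zero vector gives zero, so the value at z = 0 is 0 for every p. *)
definition flux :: "real \<Rightarrow> complex ^ 'n \<Rightarrow> complex ^ 'n" where
  "flux p z = (norm z powr (p - 2)) *\<^sub>R z"

definition energy_form ::
    "(real ^ 'n) set \<Rightarrow> real \<Rightarrow> (real ^ 'n \<Rightarrow> real) \<Rightarrow>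
     (real ^ 'n \<Rightarrow> complex) \<Rightarrow> (real ^ 'n \<Rightarrow> complex) \<Rightarrow> complex" where
  "energy_form \<Omega> p \<gamma> u \<phi> =
     (LINT x | lebesgue_on \<Omega>.
        complex_of_real (\<gamma> x) * cdot (flux p (weak_grad \<Omega> u x)) (weak_grad \<Omega> \<phi> x))"

definition is_weak_solution ::
    "(real ^ 'n) set \<Rightarrow> real \<Rightarrow> (real ^ 'n \<Rightarrow> real) \<Rightarrow>
     (real ^ 'n \<Rightarrow> complex) \<Rightarrow> (real ^ 'n \<Rightarrow> complex) \<Rightarrow> bool" where
  "is_weak_solution \<Omega> p \<gamma> f u \<longleftrightarrow>
     u \<in> W1p \<Omega> p \<and> (\<lambda>x. u x - f x) \<in> W1p_0 \<Omega> p \<and>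
     (\<forall>\<phi> \<in> W1p_0 \<Omega> p. energy_form \<Omega> p \<gamma> u \<phi> = 0)"

(* The weak solution is unique only up to a null set of Omega, hence SOME rather than THE. *)
definition dirichlet_solution ::
    "(real ^ 'n) set \<Rightarrow> real \<Rightarrow> (real ^ 'n \<Rightarrow> real) \<Rightarrow>
     (real ^ 'n \<Rightarrow> complex) \<Rightarrow> real ^ 'n \<Rightarrow> complex" where
  "dirichlet_solution \<Omega> p \<gamma> f = (SOME u. is_weak_solution \<Omega> p \<gamma> f u)"

(* The pairing of Lambda_gamma(F) with G, which is conjugate-linear in G.  Its value does not
   depend on the representatives f of F and v of G. *)
definition DN_map ::
    "(real ^ 'n) set \<Rightarrow> real \<Rightarrow> (real ^ 'n \<Rightarrow> real) \<Rightarrow>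
     (real ^ 'n \<Rightarrow> complex) set \<Rightarrow> (real ^ 'n \<Rightarrow> complex) set \<Rightarrow> complex" where
  "DN_map \<Omega> p \<gamma> =
     (\<lambda>F \<in> trace_space \<Omega> p. \<lambda>G \<in> trace_space \<Omega> p.
        let f = (SOME f. f \<in> F); v = (SOME v. v \<in> G)
        in energy_form \<Omega> p \<gamma> (dirichlet_solution \<Omega> p \<gamma> f) (\<lambda>x. cnj (v x)))"

end

theory Submission
  imports Defs
begin

text \<open>
  Tested against \<open>f\<close> itself, the Dirichlet-to-Neumann map is the minimal energy \<open>Q(f)\<close> among all
  functions with boundary values \<open>f\<close>.  Suppose \<open>\<gamma>\<^sub>1 < \<gamma>\<^sub>2\<close> at a boundary point.  A minimiser for
  \<open>\<gamma>\<^sub>2\<close> competes for \<open>\<gamma>\<^sub>1\<close>, and its \<open>\<gamma>\<^sub>1\<close>-energy is smaller by a fixed factor as soon as most of its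
  energy lies close to that point, which contradicts the equality of the two minima.  Oscillating
  solutions are not needed for the concentration: it suffices that the boundary values are
  supported in a tiny neighbourhood of the point.  Comparison with truncations and Poincare's inequality on
  shells around the point then make the energy outside decay by a fixed factor from one scale to
  the next.  That inequality is scale invariant, because the functions vanish below a cone with vertex at
  the point.  Near-minimisers \<open>f + \<phi>\<close> with a test function \<open>\<phi>\<close> suffice for all of this, so weak gradients
  matter only for the existence of minimisers.
\<close>

section \<open>Smooth functions\<close>

text \<open>A factor below 1 contradicts nothing if the minimum is 0, so the data also need an
  energy bound \<open>\<delta>\<close> from below, uniform over all competitors: vertical segments
  start outside the domain where the data equal 1 and end where they vanish. The decay need not be
  fast. It only has to beat the global ratio \<open>C1 / c2\<close> of the two weights, so a fixed
  number n of scales suffices and the support of the data is shrunk by \<open>4 ^ n\<close>.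
  Competitors differ from smooth data by test functions, hence multiplying by a cutoff that is 1 on
  the support of the data yields a competitor again. Each scale costs the defect \<epsilon> of the
  near-minimiser; since n is fixed before \<epsilon>, the total n \<epsilon> is harmless. Only a
  two-sided cone of slope \<open>K\<close> is kept from the boundary. Cylinders whose half-height is
  \<open>K\<close> times the radius are fitted to it: near the point, their part below the lower
  cone misses the domain and the interior of their top lies in it. All shells therefore look alike,
  and pushing points along straight lines out of the domain gives one Poincare constant up to
  scaling.\<close>

lemma partial_deriv_eqI:
  assumes "(f has_derivative D) (at x)"
  shows "partial_deriv i f x = D (axis i 1)"
  using frechet_derivative_at[OF assms] by (simp add: partial_deriv_def)

text \<open>The flat function exp(-1/t) with a polynomial in 1/t in front, which makes the family
  closed under differentiation: the derivative replaces P by x^2 (P - P').\<close>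

definition flat_exp :: "real poly \<Rightarrow> real \<Rightarrow> real" where
  "flat_exp P t = (if t > 0 then poly P (1 / t) * exp (- (1 / t)) else 0)"

lemma tendsto_poly_div_exp_0:
  fixes P :: "real poly"
  shows "((\<lambda>x. poly P x / exp x) \<longlongrightarrow> 0) at_top"
proof -
  have "((\<lambda>x::real. \<Sum>i\<le>degree P. coeff P i * (x ^ i / exp x)) \<longlongrightarrow> (\<Sum>i\<le>degree P. coeff P i * 0)) at_top"
    by (intro tendsto_sum tendsto_mult tendsto_const tendsto_power_div_exp_0)
  then show ?thesis
    by (simp add: poly_altdef sum_divide_distrib)
qed

lemma DERIV_flat_exp:
  "(flat_exp P has_real_derivative flat_exp (pCons 0 (pCons 0 (P - pderiv P))) t) (at t)"
proof (cases t "0::real" rule: linorder_cases)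
  case less
  have "((\<lambda>_. 0) has_real_derivative 0) (at t)" by simp
  moreover have "\<forall>\<^sub>F s in nhds t. flat_exp P s = 0"
    using eventually_nhds_in_open[of "{..<0}" t] less
    by (auto elim!: eventually_mono simp: flat_exp_def)
  ultimately have "(flat_exp P has_real_derivative 0) (at t)"
    by (rule DERIV_cong_ev[THEN iffD2, OF refl _ refl, rotated])
  then show ?thesis using less by (simp add: flat_exp_def)
next
  case greater
  have "((\<lambda>t. poly P (1 / t) * exp (- (1 / t))) has_real_derivative
      flat_exp (pCons 0 (pCons 0 (P - pderiv P))) t) (at t)"
  proof -
    have inv: "((\<lambda>t. 1 / t) has_real_derivative - (1 / t\<^sup>2)) (at t)"
      using greater by (auto intro!: derivative_eq_intros simp: power2_eq_square)
    have "((\<lambda>t. poly P (1 / t) * exp (- (1 / t))) has_real_derivative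
        poly P (1 / t) * (exp (- (1 / t)) * - (- (1 / t\<^sup>2))) +
        (poly (pderiv P) (1 / t) * - (1 / t\<^sup>2)) * exp (- (1 / t))) (at t)"
      by (intro DERIV_mult' DERIV_chain2[OF poly_DERIV inv] DERIV_chain2[OF DERIV_exp DERIV_minus[OF inv]])
    then show ?thesis
      by (rule DERIV_cong) (use greater in \<open>simp add: flat_exp_def power2_eq_square algebra_simps\<close>)
  qed
  moreover have "\<forall>\<^sub>F s in nhds t. flat_exp P s = poly P (1 / s) * exp (- (1 / s))"
    using eventually_nhds_in_open[of "{0<..}" t] greater
    by (auto elim!: eventually_mono simp: flat_exp_def)
  ultimately show ?thesis
    by (rule DERIV_cong_ev[THEN iffD2, OF refl _ refl, rotated])
next
  case equal
  have "((\<lambda>h. flat_exp P h / h) \<longlongrightarrow> 0) (at 0)"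
  proof (rule filterlim_split_at)
    have "\<forall>\<^sub>F h in at_left 0. flat_exp P h / h = 0"
      by (auto simp: flat_exp_def eventually_at_filter)
    then show "((\<lambda>h. flat_exp P h / h) \<longlongrightarrow> 0) (at_left 0)"
      by (simp add: tendsto_eventually)
    \<comment> \<open>At 0 from the right, x = 1/h turns the difference quotient into x P(x) / exp
      x; the extra factor x is the outer \<open>pCons 0\<close>.\<close>
    have "((\<lambda>h. poly (pCons 0 P) (inverse h) / exp (inverse h)) \<longlongrightarrow> 0) (at_right (0::real))"
      by (rule filterlim_compose[OF tendsto_poly_div_exp_0 filterlim_inverse_at_top_right])
    moreover have "\<forall>\<^sub>F h in at_right (0::real).
        poly (pCons 0 P) (inverse h) / exp (inverse h) = flat_exp P h / h"
      by (auto simp: flat_exp_def eventually_at_filter exp_minus field_simps)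
    ultimately show "((\<lambda>h. flat_exp P h / h) \<longlongrightarrow> 0) (at_right 0)"
      by (rule Lim_transform_eventually)
  qed
  then show ?thesis using equal by (simp add: DERIV_def flat_exp_def)
qed

text \<open>\<open>smooth\<close> quantifies over all iterated partial derivatives, which makes a
  direct induction for products and quotients awkward. This set contains the partial derivatives of
  its members, so one structural induction and one over the list of indices give smoothness. Outer
  functions enter only through \<open>inverse\<close> and \<open>flat_exp\<close>, the latter on
  real values.\<close>

inductive_set smooth_algebra :: "(real ^ 'n \<Rightarrow> complex) set" where
  base: "smooth f \<Longrightarrow> f \<in> smooth_algebra"
| const: "(\<lambda>x. c) \<in> smooth_algebra"
| coord: "(\<lambda>x. of_real (x $ i)) \<in> smooth_algebra"
| add: "f \<in> smooth_algebra \<Longrightarrow> g \<in> smooth_algebra \<Longrightarrow> (\<lambda>x. f x + g x) \<in> smooth_algebra"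
| mult: "f \<in> smooth_algebra \<Longrightarrow> g \<in> smooth_algebra \<Longrightarrow> (\<lambda>x. f x * g x) \<in> smooth_algebra"
| cnj: "f \<in> smooth_algebra \<Longrightarrow> (\<lambda>x. cnj (f x)) \<in> smooth_algebra"
| inverse: "f \<in> smooth_algebra \<Longrightarrow> (\<And>x. f x \<noteq> 0) \<Longrightarrow> (\<lambda>x. inverse (f x)) \<in> smooth_algebra"
| flat_exp: "f \<in> smooth_algebra \<Longrightarrow> (\<And>x. Im (f x) = 0) \<Longrightarrow>
    (\<lambda>x. of_real (flat_exp P (Re (f x)))) \<in> smooth_algebra"

lemma smooth_imp_differentiable: "smooth f \<Longrightarrow> f differentiable (at x)"
  unfolding smooth_def by (metis foldr_Nil id_apply)

lemma smooth_imp_smooth_partial_deriv: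
  assumes "smooth f" shows "smooth (partial_deriv i f)"
  unfolding smooth_def
proof (intro allI)
  fix "is" x
  have "foldr partial_deriv (is @ [i]) f differentiable at x"
    using assms unfolding smooth_def by blast
  then show "foldr partial_deriv is (partial_deriv i f) differentiable at x" by simp
qed

lemma smooth_algebra_has_derivative:
  fixes f :: "real ^ 'n \<Rightarrow> complex"
  assumes "f \<in> smooth_algebra"
  shows "\<exists>D. (\<forall>x. (f has_derivative D x) (at x)) \<and> (\<forall>i. (\<lambda>x. D x (axis i 1)) \<in> smooth_algebra)"
  using assms
proof induction
  case (base f)
  have 1: "(f has_derivative frechet_derivative f (at x)) (at x)" for x
    using smooth_imp_differentiable[OF base] frechet_derivative_works by blast
  have 2: "(\<lambda>x. frechet_derivative f (at x) (axis i 1)) \<in> smooth_algebra" for i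
    using smooth_algebra.base[OF smooth_imp_smooth_partial_deriv[OF base], of i]
    by (simp add: partial_deriv_def[abs_def])
  from 1 2 show ?case by (intro exI[of _ "\<lambda>x. frechet_derivative f (at x)"]) auto
next
  case (const c)
  show ?case by (intro exI[of _ "\<lambda>x h. 0"]) (auto intro: smooth_algebra.const)
next
  case (coord i)
  have "((\<lambda>x::real^'n. complex_of_real (x $ i)) has_derivative (\<lambda>h. of_real (h $ i))) (at x)" for x
    by (intro has_derivative_of_real bounded_linear.has_derivative[OF bounded_linear_vec_nth has_derivative_ident])
  then show ?case
    by (intro exI[of _ "\<lambda>x h. of_real (h $ i)"]) (auto intro: smooth_algebra.const)
next
  case (add f g)
  then obtain D E where "\<forall>x. (f has_derivative D x) (at x)" "\<forall>i. (\<lambda>x. D x (axis i 1)) \<in> smooth_algebra"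
    "\<forall>x. (g has_derivative E x) (at x)" "\<forall>i. (\<lambda>x. E x (axis i 1)) \<in> smooth_algebra" by blast
  then show ?case
    by (intro exI[of _ "\<lambda>x h. D x h + E x h"])
       (auto intro!: smooth_algebra.add has_derivative_add)
next
  case (mult f g)
  then obtain D E where *: "\<forall>x. (f has_derivative D x) (at x)" "\<forall>i. (\<lambda>x. D x (axis i 1)) \<in> smooth_algebra"
    "\<forall>x. (g has_derivative E x) (at x)" "\<forall>i. (\<lambda>x. E x (axis i 1)) \<in> smooth_algebra" by blast
  then have "((\<lambda>x. f x * g x) has_derivative (\<lambda>h. f x * E x h + D x h * g x)) (at x)" for x
    by (intro has_derivative_mult) auto
  then show ?case using * mult(1,2)
    by (intro exI[of _ "\<lambda>x h. f x * E x h + D x h * g x"])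
       (auto intro!: smooth_algebra.add smooth_algebra.mult)
next
  case (cnj f)
  then obtain D where "\<forall>x. (f has_derivative D x) (at x)" "\<forall>i. (\<lambda>x. D x (axis i 1)) \<in> smooth_algebra"
    by blast
  then show ?case
    by (intro exI[of _ "\<lambda>x h. cnj (D x h)"])
       (auto intro!: smooth_algebra.cnj has_derivative_cnj)
next
  case (inverse f)
  then obtain D where *: "\<forall>x. (f has_derivative D x) (at x)" "\<forall>i. (\<lambda>x. D x (axis i 1)) \<in> smooth_algebra"
    by blast
  have "((\<lambda>x. inverse (f x)) has_derivative (\<lambda>h. (-1) * (inverse (f x) * D x h * inverse (f x)))) (at x)" for x
    using Deriv.has_derivative_inverse[OF inverse(2) *(1)[rule_format, of x]] by simp
  moreover have "(\<lambda>x. (-1) * (inverse (f x) * D x (axis i 1) * inverse (f x))) \<in> smooth_algebra" for i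
    by (rule smooth_algebra.mult[OF smooth_algebra.const smooth_algebra.mult[OF smooth_algebra.mult]])
       (use * inverse in \<open>auto intro: smooth_algebra.inverse\<close>)
  ultimately show ?case
    by (intro exI[of _ "\<lambda>x h. (-1) * (inverse (f x) * D x h * inverse (f x))"] conjI allI)
next
  case (flat_exp f P)
  then obtain D where *: "\<forall>x. (f has_derivative D x) (at x)" "\<forall>i. (\<lambda>x. D x (axis i 1)) \<in> smooth_algebra"
    by blast
  let ?Q = "pCons 0 (pCons 0 (P - pderiv P))"
  have D: "((\<lambda>x. Re (f x)) has_derivative (\<lambda>h. Re (D x h))) (at x)" for x
    using *(1) by (auto intro: has_derivative_Re)
  \<comment> \<open>The derivative of a real valued function is real, so the factor
    \<open>Re (D x h)\<close> of the real chain rule may be replaced by \<open>D x h\<close>, which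
    the induction hypothesis covers.\<close>
  have "((\<lambda>x. Im (f x)) has_derivative (\<lambda>h. Im (D x h))) (at x)" for x
    using *(1) by (auto intro: has_derivative_Im)
  then have "((\<lambda>x. 0) has_derivative (\<lambda>h. Im (D x h))) (at x)" for x
    using flat_exp(2) by simp
  then have "(\<lambda>h. Im (D x h)) = (\<lambda>h. 0)" for x
    by (rule has_derivative_unique) simp
  then have Im: "Im (D x h) = 0" for x h by metis
  have "((\<lambda>x. complex_of_real (flat_exp P (Re (f x)))) has_derivative
     (\<lambda>h. of_real (Re (D x h) * flat_exp ?Q (Re (f x))))) (at x)" for x
    using DERIV_compose_FDERIV[OF DERIV_flat_exp D] by (intro has_derivative_of_real) auto
  moreover have "complex_of_real (Re (D x h) * flat_exp ?Q (Re (f x))) =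
      D x h * of_real (flat_exp ?Q (Re (f x)))" for x h
    using Im[of x h] by (simp add: complex_eq_iff)
  ultimately have "((\<lambda>x. complex_of_real (flat_exp P (Re (f x)))) has_derivative
     (\<lambda>h. D x h * of_real (flat_exp ?Q (Re (f x))))) (at x)" for x
    by (simp only:)
  then show ?case using * flat_exp(1,2)
    by (intro exI[of _ "\<lambda>x h. D x h * of_real (flat_exp ?Q (Re (f x)))"])
       (auto intro!: smooth_algebra.mult smooth_algebra.flat_exp)
qed

lemma smooth_algebra_imp_smooth:
  fixes f :: "real ^ 'n \<Rightarrow> complex"
  assumes "f \<in> smooth_algebra" shows "smooth f"
proof -
  have partial: "partial_deriv i g \<in> smooth_algebra" if g: "g \<in> smooth_algebra"
    for g :: "real^'n \<Rightarrow> complex" and i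
  proof -
    obtain D where D: "\<forall>x. (g has_derivative D x) (at x)" "\<forall>i. (\<lambda>x. D x (axis i 1)) \<in> smooth_algebra"
      using smooth_algebra_has_derivative[OF g] by blast
    then have "partial_deriv i g = (\<lambda>x. D x (axis i 1))"
      by (auto intro: partial_deriv_eqI)
    then show ?thesis using D by simp
  qed
  have "foldr partial_deriv is f \<in> smooth_algebra" for "is"
    by (induction "is") (use assms partial in auto)
  then show ?thesis
    unfolding smooth_def differentiable_def using smooth_algebra_has_derivative by blast
qed

lemma smooth_const: "smooth (\<lambda>x. c)"
  by (rule smooth_algebra_imp_smooth[OF smooth_algebra.const])

lemma smooth_coord: "smooth (\<lambda>x. of_real (x $ i))"
  by (rule smooth_algebra_imp_smooth[OF smooth_algebra.coord])

lemma smooth_add: "smooth f \<Longrightarrow> smooth g \<Longrightarrow> smooth (\<lambda>x. f x + g x)"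
  by (rule smooth_algebra_imp_smooth[OF smooth_algebra.add[OF smooth_algebra.base smooth_algebra.base]])

lemma smooth_mult: "smooth f \<Longrightarrow> smooth g \<Longrightarrow> smooth (\<lambda>x. f x * g x)"
  by (rule smooth_algebra_imp_smooth[OF smooth_algebra.mult[OF smooth_algebra.base smooth_algebra.base]])

lemma smooth_cnj: "smooth f \<Longrightarrow> smooth (\<lambda>x. cnj (f x))"
  by (rule smooth_algebra_imp_smooth[OF smooth_algebra.cnj[OF smooth_algebra.base]])

lemma smooth_diff: "smooth f \<Longrightarrow> smooth g \<Longrightarrow> smooth (\<lambda>x. f x - g x)"
  using smooth_add[of f "\<lambda>x. (-1) * g x"] smooth_mult[OF smooth_const, of g "-1"] by simp

lemma smooth_inverse: "smooth f \<Longrightarrow> (\<And>x. f x \<noteq> 0) \<Longrightarrow> smooth (\<lambda>x. inverse (f x))"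
  using smooth_algebra.inverse[OF smooth_algebra.base, of f] smooth_algebra_imp_smooth by blast

lemma smooth_power: "smooth f \<Longrightarrow> smooth (\<lambda>x. f x ^ k)"
  by (induction k) (auto intro: smooth_const smooth_mult)

lemma smooth_sum: "(\<And>i. i \<in> I \<Longrightarrow> smooth (f i)) \<Longrightarrow> smooth (\<lambda>x. \<Sum>i\<in>I. f i x)"
proof (induction I rule: infinite_finite_induct)
  case (insert i I)
  then show ?case using smooth_add[of "f i" "\<lambda>x. \<Sum>i\<in>I. f i x"] by simp
qed (simp_all add: smooth_const)

lemma smooth_prod: "(\<And>i. i \<in> I \<Longrightarrow> smooth (f i)) \<Longrightarrow> smooth (\<lambda>x. \<Prod>i\<in>I. f i x)"
proof (induction I rule: infinite_finite_induct)
  case (insert i I)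
  then show ?case using smooth_mult[of "f i" "\<lambda>x. \<Prod>i\<in>I. f i x"] by simp
qed (simp_all add: smooth_const)

lemma smooth_flat_exp:
  assumes "smooth (\<lambda>x. complex_of_real (f x))"
  shows "smooth (\<lambda>x. complex_of_real (flat_exp P (f x)))"
  using smooth_algebra.flat_exp[OF smooth_algebra.base[OF assms], of P]
  by (auto intro: smooth_algebra_imp_smooth)

subsection \<open>Gradients\<close>

text \<open>The classical gradient. Computations use it because \<open>weak_grad\<close> is a choice
  fixed only up to a null set; for smooth functions the two agree almost everywhere on the
  domain.\<close>

definition cgrad :: "(real ^ 'n \<Rightarrow> complex) \<Rightarrow> real ^ 'n \<Rightarrow> complex ^ 'n" where
  "cgrad f x = (\<chi> i. partial_deriv i f x)"

lemma cgrad_nth [simp]: "cgrad f x $ i = partial_deriv i f x"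
  by (simp add: cgrad_def)

lemma smooth_has_derivative:
  assumes "smooth f"
  shows "(f has_derivative (\<lambda>h. \<Sum>i\<in>UNIV. h $ i *\<^sub>R (cgrad f x $ i))) (at x)"
proof -
  let ?D = "frechet_derivative f (at x)"
  have D: "(f has_derivative ?D) (at x)"
    using smooth_imp_differentiable[OF assms] frechet_derivative_works by blast
  then have lin: "linear ?D" using has_derivative_linear by blast
  have "?D h = (\<Sum>i\<in>UNIV. h $ i *\<^sub>R (cgrad f x $ i))" for h
  proof -
    have "?D h = ?D (\<Sum>i\<in>UNIV. h $ i *\<^sub>R axis i 1)"
      using basis_expansion[of h] by (simp add: scalar_mult_eq_scaleR)
    also have "\<dots> = (\<Sum>i\<in>UNIV. h $ i *\<^sub>R (cgrad f x $ i))"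
      by (simp add: linear_sum[OF lin] linear_cmul[OF lin] partial_deriv_def)
    finally show ?thesis .
  qed
  then have "?D = (\<lambda>h. \<Sum>i\<in>UNIV. h $ i *\<^sub>R (cgrad f x $ i))" by blast
  with D show ?thesis by simp
qed

lemma smooth_imp_continuous_on: "smooth f \<Longrightarrow> continuous_on S f"
  by (meson continuous_at_imp_continuous_on differentiable_imp_continuous_within
      smooth_imp_differentiable)

lemma continuous_on_cgrad: "smooth f \<Longrightarrow> continuous_on S (cgrad f)"
  unfolding cgrad_def
  by (intro continuous_on_vec_lambda smooth_imp_continuous_on smooth_imp_smooth_partial_deriv)

lemma norm_directional_le:
  "norm (\<Sum>i\<in>UNIV. h $ i *\<^sub>R ((z :: complex ^ 'n) $ i)) \<le> norm h * norm z"
proof -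
  have "norm (\<Sum>i\<in>UNIV. h $ i *\<^sub>R (z $ i)) \<le> (\<Sum>i\<in>UNIV. \<bar>h $ i\<bar> * \<bar>norm (z $ i)\<bar>)"
    by (intro sum_norm_le) simp
  also have "\<dots> \<le> L2_set (\<lambda>i. h $ i) UNIV * L2_set (\<lambda>i. norm (z $ i)) UNIV"
    by (rule L2_set_mult_ineq)
  finally show ?thesis unfolding norm_vec_def L2_set_def by (simp only: real_norm_def abs_power2 power2_abs)
qed

lemma cgrad_eqI:
  assumes "(f has_derivative (\<lambda>h. \<Sum>i\<in>UNIV. h $ i *\<^sub>R (z $ i))) (at x)"
  shows "cgrad f x = z"
  using partial_deriv_eqI[OF assms]
  by (simp add: vec_eq_iff axis_def if_distrib[of "\<lambda>c. c *\<^sub>R _"] cong: if_cong)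

lemma cgrad_add:
  assumes "smooth f" "smooth g"
  shows "cgrad (\<lambda>x. f x + g x) x = cgrad f x + cgrad g x"
  by (rule cgrad_eqI, rule has_derivative_eq_rhs[OF has_derivative_add[OF assms[THEN smooth_has_derivative]]])
     (auto simp: sum.distrib scaleR_add_right)

lemma cgrad_mult:
  assumes "smooth f" "smooth g"
  shows "cgrad (\<lambda>x. f x * g x) x = f x *s cgrad g x + g x *s cgrad f x"
  by (rule cgrad_eqI, rule has_derivative_eq_rhs[OF has_derivative_mult[OF assms[THEN smooth_has_derivative]]])
     (auto simp: sum.distrib scaleR_add_right sum_distrib_left mult.commute)

lemma cgrad_cnj:
  assumes "smooth f"
  shows "cgrad (\<lambda>x. cnj (f x)) x = (\<chi> i. cnj (cgrad f x $ i))"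
  by (rule cgrad_eqI, rule has_derivative_eq_rhs[OF has_derivative_cnj[OF smooth_has_derivative[OF assms]]])
     (auto simp: cnj_sum)

lemma cgrad_const: "cgrad (\<lambda>x. c) x = 0"
  by (rule cgrad_eqI) simp

lemma cgrad_cmult:
  assumes "smooth f"
  shows "cgrad (\<lambda>x. c * f x) x = c *s cgrad f x"
  using cgrad_mult[OF smooth_const assms, of c] by (simp add: cgrad_const)

lemma cgrad_diff:
  assumes "smooth f" "smooth g"
  shows "cgrad (\<lambda>x. f x - g x) x = cgrad f x - cgrad g x"
  by (rule cgrad_eqI, rule has_derivative_eq_rhs[OF has_derivative_diff[OF assms[THEN smooth_has_derivative]]])
     (auto simp: sum_subtractf scaleR_diff_right)

lemma cgrad_eq_0_of_eventually_const:
  fixes f :: "real ^ 'n \<Rightarrow> complex"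
  assumes "\<forall>\<^sub>F y in nhds x. f y = c"
  shows "cgrad f x = 0"
proof (rule cgrad_eqI)
  have "((\<lambda>y. c) has_derivative (\<lambda>h. 0)) (at x)" by simp
  then have "(f has_derivative (\<lambda>h. 0)) (at x)"
    by (rule has_derivative_transform_eventually)
       (use assms eventually_nhds_x_imp_x in \<open>auto simp: eventually_at_filter elim!: eventually_mono\<close>)
  then show "(f has_derivative (\<lambda>h. \<Sum>i\<in>UNIV. h $ i *\<^sub>R ((0::complex^'n) $ i))) (at x)" by simp
qed

lemma norm_vector_smult: "norm (c *s (z :: complex ^ 'n)) = norm c * norm z"
  by (simp add: norm_vec_def norm_mult L2_set_right_distrib)

subsection \<open>Test functions\<close>

lemma test_functions_smooth: "\<phi> \<in> test_functions \<Omega> \<Longrightarrow> smooth \<phi>"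
  by (simp add: test_functions_def)

lemma test_functionsI:
  assumes "smooth \<phi>" "compact K" "K \<subseteq> \<Omega>" "\<And>x. x \<notin> K \<Longrightarrow> \<phi> x = 0"
  shows "\<phi> \<in> test_functions \<Omega>"
proof -
  have sub: "closure {x. \<phi> x \<noteq> 0} \<subseteq> K"
    by (rule closure_minimal) (use assms compact_imp_closed in auto)
  then have "compact (closure {x. \<phi> x \<noteq> 0})"
    using assms(2) by (meson closed_closure compact_closure bounded_closure bounded_subset compact_imp_bounded
        compact_eq_bounded_closed)
  then show ?thesis using assms sub by (auto simp: test_functions_def)
qed

lemma test_functionsE:
  assumes "\<phi> \<in> test_functions \<Omega>"
  obtains K where "compact K" "K \<subseteq> \<Omega>" "\<And>x. x \<notin> K \<Longrightarrow> \<phi> x = 0" "\<And>x. x \<notin> K \<Longrightarrow> cgrad \<phi> x = 0"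
proof
  let ?K = "closure {x. \<phi> x \<noteq> 0}"
  show "compact ?K" "?K \<subseteq> \<Omega>" using assms by (auto simp: test_functions_def)
  show 0: "\<phi> x = 0" if "x \<notin> ?K" for x using that closure_subset[of "{x. \<phi> x \<noteq> 0}"] by auto
  show "cgrad \<phi> x = 0" if x: "x \<notin> ?K" for x
  proof (rule cgrad_eq_0_of_eventually_const)
    have "\<forall>\<^sub>F y in nhds x. y \<in> - ?K"
      using x by (intro eventually_nhds_in_open open_Compl closed_closure) simp
    then show "\<forall>\<^sub>F y in nhds x. \<phi> y = 0"
      by (rule eventually_mono) (rule 0, rule ComplD)
  qed
qed

lemma test_functions_add:
  assumes "\<phi> \<in> test_functions \<Omega>" "\<psi> \<in> test_functions \<Omega>"
  shows "(\<lambda>x. \<phi> x + \<psi> x) \<in> test_functions \<Omega>"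
proof -
  obtain K where K: "compact K" "K \<subseteq> \<Omega>" "\<And>x. x \<notin> K \<Longrightarrow> \<phi> x = 0" by (rule test_functionsE[OF assms(1)]) blast
  obtain L where L: "compact L" "L \<subseteq> \<Omega>" "\<And>x. x \<notin> L \<Longrightarrow> \<psi> x = 0" by (rule test_functionsE[OF assms(2)]) blast
  show ?thesis
    by (rule test_functionsI[of _ "K \<union> L"])
       (use K L assms in \<open>auto intro: smooth_add test_functions_smooth compact_Un\<close>)
qed

lemma test_functions_mult:
  assumes "smooth \<eta>" "\<phi> \<in> test_functions \<Omega>"
  shows "(\<lambda>x. \<eta> x * \<phi> x) \<in> test_functions \<Omega>"
proof -
  obtain K where K: "compact K" "K \<subseteq> \<Omega>" "\<And>x. x \<notin> K \<Longrightarrow> \<phi> x = 0" by (rule test_functionsE[OF assms(2)]) blast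
  show ?thesis
    by (rule test_functionsI[of _ K]) (use K assms in \<open>auto intro: smooth_mult test_functions_smooth\<close>)
qed

lemma test_functions_cmult: "\<phi> \<in> test_functions \<Omega> \<Longrightarrow> (\<lambda>x. c * \<phi> x) \<in> test_functions \<Omega>"
  by (rule test_functions_mult[OF smooth_const])

lemma test_functions_cnj:
  assumes "\<phi> \<in> test_functions \<Omega>"
  shows "(\<lambda>x. cnj (\<phi> x)) \<in> test_functions \<Omega>"
proof -
  obtain K where K: "compact K" "K \<subseteq> \<Omega>" "\<And>x. x \<notin> K \<Longrightarrow> \<phi> x = 0" by (rule test_functionsE[OF assms]) blast
  show ?thesis
    by (rule test_functionsI[of _ K]) (use K assms in \<open>auto intro: smooth_cnj test_functions_smooth\<close>)
qed

lemma test_functions_0: "(\<lambda>x. 0) \<in> test_functions \<Omega>"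
  by (rule test_functionsI[of _ "{}"]) (auto intro: smooth_const)

lemma test_functions_partial_deriv:
  assumes "\<phi> \<in> test_functions \<Omega>"
  shows "partial_deriv i \<phi> \<in> test_functions \<Omega>"
proof -
  obtain K where K: "compact K" "K \<subseteq> \<Omega>" "\<And>x. x \<notin> K \<Longrightarrow> cgrad \<phi> x = 0" by (rule test_functionsE[OF assms]) blast
  then have "partial_deriv i \<phi> x = 0" if "x \<notin> K" for x
    using that by (metis cgrad_nth zero_index)
  then show ?thesis
    by (intro test_functionsI[of _ K])
       (use K assms in \<open>auto intro: smooth_imp_smooth_partial_deriv test_functions_smooth\<close>)
qed

section \<open>Bump functions on boxes and smooth steps\<close>

lemma flat_exp_1_pos: "t > 0 \<Longrightarrow> flat_exp 1 t > 0"
  and flat_exp_1_nonpos: "t \<le> 0 \<Longrightarrow> flat_exp 1 t = 0"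
  and flat_exp_1_nonneg: "flat_exp 1 t \<ge> 0"
  and flat_exp_1_lt_1: "flat_exp 1 t < 1"
  by (auto simp: flat_exp_def)

text \<open>The functions \<open>1 - (1 - g)\<^sup>k\<close>, with \<open>g\<close> smooth, positive exactly on the box and below \<open>1\<close>.\<close>

lemma box_indicator_approx:
  fixes a b :: "real ^ 'n"
  assumes "cbox a b \<subseteq> \<Omega>"
  obtains \<phi> where "\<And>k::nat. \<phi> k \<in> test_functions \<Omega>" "\<And>k x. norm (\<phi> k x) \<le> 1"
    "\<And>x. (\<lambda>k. \<phi> k x) \<longlonglongrightarrow> indicator (box a b) x"
    "\<And>k x. x \<notin> cbox a b \<Longrightarrow> \<phi> k x = 0"
proof -
  define g where "g x = (\<Prod>i\<in>UNIV. flat_exp 1 (x $ i - a $ i) * flat_exp 1 (b $ i - x $ i))" for x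
  have g_eq: "g x = 0" if "x \<notin> box a b" for x
  proof -
    from that obtain i where "x $ i \<le> a $ i \<or> b $ i \<le> x $ i"
      unfolding mem_box_cart by (auto simp: not_less)
    then have "flat_exp 1 (x $ i - a $ i) * flat_exp 1 (b $ i - x $ i) = 0"
      by (auto simp: flat_exp_1_nonpos)
    then show ?thesis unfolding g_def by (intro prod_zero) auto
  qed
  have g_nn: "0 \<le> g x" for x
    unfolding g_def by (intro prod_nonneg mult_nonneg_nonneg ballI flat_exp_1_nonneg)
  have g_pos: "0 < g x" if "x \<in> box a b" for x
    unfolding g_def using that by (intro prod_pos mult_pos_pos ballI flat_exp_1_pos) (auto simp: mem_box_cart)
  have g_le: "g x \<le> 1" for x
    unfolding g_def by (intro prod_le_1 conjI mult_nonneg_nonneg mult_le_one flat_exp_1_nonneg less_imp_le[OF flat_exp_1_lt_1])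
  have "smooth (\<lambda>x. complex_of_real (g x))"
    unfolding g_def of_real_prod of_real_mult
    by (intro smooth_prod smooth_mult smooth_flat_exp)
       (auto simp: intro!: smooth_diff smooth_coord smooth_const)
  then have sm: "smooth (\<lambda>x. 1 - (1 - complex_of_real (g x)) ^ k)" for k
    by (intro smooth_diff smooth_power smooth_const)
  define \<phi> where "\<phi> k x = 1 - (1 - complex_of_real (g x)) ^ k" for k x
  have \<phi>_eq: "\<phi> k x = of_real (1 - (1 - g x) ^ k)" for k x by (simp add: \<phi>_def)
  show ?thesis
  proof (rule that[of \<phi>])
    show z: "\<phi> k x = 0" if "x \<notin> cbox a b" for k x
      using g_eq[of x] that box_subset_cbox[of a b] by (subst \<phi>_def, subst g_eq) auto
    show "\<phi> k \<in> test_functions \<Omega>" for k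
      using sm[of k] assms z by (intro test_functionsI[of _ "cbox a b"]) (auto simp: \<phi>_def[abs_def])
    show "norm (\<phi> k x) \<le> 1" for k x
    proof -
      have "0 \<le> (1 - g x) ^ k" "(1 - g x) ^ k \<le> 1"
        using g_nn[of x] g_le[of x] by (auto intro: power_le_one)
      then show ?thesis unfolding \<phi>_eq norm_of_real by (simp add: abs_if)
    qed
    show "(\<lambda>k. \<phi> k x) \<longlonglongrightarrow> indicator (box a b) x" for x
    proof (cases "x \<in> box a b")
      case True
      have "(\<lambda>k. complex_of_real (1 - (1 - g x) ^ k)) \<longlonglongrightarrow> of_real (1 - 0)"
        using g_pos[OF True] g_le[of x]
        by (intro tendsto_of_real tendsto_diff tendsto_const LIMSEQ_realpow_zero) auto
      then show ?thesis using True by (simp add: \<phi>_eq)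
    next
      case False
      then show ?thesis by (simp add: \<phi>_def g_eq)
    qed
  qed
qed

text \<open>The quotient \<open>e(9 - q) / (e(9 - q) + e(q - 1))\<close>, with \<open>e\<close> the flat exponential.\<close>

lemma smooth_step:
  fixes q :: "real ^ 'n \<Rightarrow> real"
  assumes "smooth (\<lambda>x. complex_of_real (q x))"
  obtains S where "smooth (\<lambda>x. complex_of_real (S x))" "\<And>x. 0 \<le> S x" "\<And>x. S x \<le> 1"
    "\<And>x. q x \<le> 1 \<Longrightarrow> S x = 1" "\<And>x. q x \<ge> 9 \<Longrightarrow> S x = 0"
proof -
  define A where "A x = flat_exp 1 (9 - q x)" for x
  define B where "B x = flat_exp 1 (q x - 1)" for x
  have A: "smooth (\<lambda>x. complex_of_real (A x))" and B: "smooth (\<lambda>x. complex_of_real (B x))"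
    unfolding A_def B_def by (intro smooth_flat_exp; simp; intro smooth_diff smooth_const assms)+
  have nn: "A x \<ge> 0" "B x \<ge> 0" for x by (simp_all add: A_def B_def flat_exp_1_nonneg)
  \<comment> \<open>Every value of q is below 9 or above 1, so one summand of the denominator is
    positive.\<close>
  have pos: "A x + B x > 0" for x
  proof (cases "q x < 9")
    case True then show ?thesis using nn(2)[of x] flat_exp_1_pos[of "9 - q x"] by (simp add: A_def)
  next
    case False then show ?thesis using nn(1)[of x] flat_exp_1_pos[of "q x - 1"] by (simp add: B_def)
  qed
  have "smooth (\<lambda>x. complex_of_real (A x) * inverse (of_real (A x) + of_real (B x)))"
    using pos by (intro smooth_mult smooth_inverse smooth_add A B) (metis less_irrefl of_real_add of_real_eq_0_iff)
  then have sm: "smooth (\<lambda>x. complex_of_real (A x / (A x + B x)))" by (simp add: divide_inverse)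
  show ?thesis
  proof (rule that[OF sm])
    show "0 \<le> A x / (A x + B x)" "A x / (A x + B x) \<le> 1" for x
      using nn[of x] pos[of x] by (simp_all add: field_simps)
    show "A x / (A x + B x) = 1" if "q x \<le> 1" for x
      using that pos[of x] by (simp add: B_def flat_exp_1_nonpos)
    show "A x / (A x + B x) = 0" if "q x \<ge> 9" for x
      using that by (simp add: A_def flat_exp_1_nonpos)
  qed
qed

section \<open>Integral identities and estimates\<close>

text \<open>Convexity of t^p through its tangent at a. Young's inequality for the conjugate
  exponents p/(p-1) and p yields it without differentiating \<open>powr\<close>, so a = 0 is no
  special case.\<close>

lemma powr_tangent_le:
  fixes a b p :: real
  assumes "1 < p" "0 \<le> a" "0 \<le> b"
  shows "a powr p + p * a powr (p - 1) * (b - a) \<le> b powr p"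
proof -
  have "a powr (p - 1) * b \<le> (a powr (p - 1)) powr (p / (p - 1)) / (p / (p - 1)) + b powr p / p"
    using assms by (intro Youngs_inequality) (auto simp: field_simps)
  moreover have "(a powr (p - 1)) powr (p / (p - 1)) = a powr p"
    using assms by (simp add: powr_powr)
  ultimately have "p * (a powr (p - 1) * b) \<le> p * (a powr p / (p / (p - 1)) + b powr p / p)"
    using assms by (intro mult_left_mono) auto
  also have "\<dots> = (p - 1) * a powr p + b powr p"
    using assms by (simp add: distrib_left)
  finally have "p * (a powr (p - 1) * b) \<le> (p - 1) * a powr p + b powr p" .
  moreover have "a powr (p - 1) * a = a powr p"
    using assms powr_mult_base[of a "p - 1"] by (simp add: mult.commute)
  ultimately show ?thesis by (simp add: algebra_simps)
qed

text \<open>Jensen's inequality on [0,1]: integrate the tangent inequality at the mean value, where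
  the linear term averages to zero.\<close>

lemma powr_integral_le:
  fixes g :: "real \<Rightarrow> real"
  assumes g: "continuous_on {0..1} g" and nn: "\<And>t. 0 \<le> g t" and p: "1 < p"
  shows "(integral {0..1} g) powr p \<le> integral {0..1} (\<lambda>t. g t powr p)"
proof -
  let ?m = "integral {0..1} g"
  have int: "g integrable_on {0..1}" "(\<lambda>t. g t powr p) integrable_on {0..1}"
    using g p by (auto intro!: integrable_continuous_real continuous_on_powr' continuous_on_const simp: nn)
  have m: "0 \<le> ?m" using int nn by (intro integral_nonneg) auto
  have *: "(\<lambda>t. ?m powr p + p * ?m powr (p - 1) * (g t - ?m)) integrable_on {0..1}"
    using int by (intro integrable_add integrable_diff integrable_on_mult_right integrable_const_ivl) auto
  have "integral {0..1} (\<lambda>t. ?m powr p + p * ?m powr (p - 1) * (g t - ?m)) \<le> integral {0..1} (\<lambda>t. g t powr p)"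
    using powr_tangent_le[OF p m nn] by (intro integral_le int * ) auto
  moreover have "integral {0..1} (\<lambda>t. ?m powr p + p * ?m powr (p - 1) * (g t - ?m)) = ?m powr p"
  proof -
    have 1: "(\<lambda>t. g t - ?m) integrable_on {0..1}"
      using int by (intro integrable_diff integrable_const_ivl)
    have "integral {0..1} (\<lambda>t. ?m powr p + p * ?m powr (p - 1) * (g t - ?m))
       = ?m powr p + p * ?m powr (p - 1) * integral {0..1} (\<lambda>t. g t - ?m)"
      using 1 by (subst integral_add) (auto simp: integrable_on_mult_right)
    also have "integral {0..1} (\<lambda>t. g t - ?m) = 0"
      using int by (subst integral_diff) auto
    finally show ?thesis by simp
  qed
  ultimately show ?thesis by simp
qed

text \<open>The fundamental theorem along the segment from x to x + v, then Jensen. The integral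
  over the segment is taken in \<open>ennreal\<close> so that it can be exchanged with one over x
  afterwards.\<close>

lemma smooth_difference_powr_le:
  fixes u :: "real ^ 'n \<Rightarrow> complex"
  assumes u: "smooth u" and p: "1 < p"
  shows "ennreal (norm (u (x + v) - u x) powr p) \<le>
    ennreal (norm v powr p) * (\<integral>\<^sup>+t. ennreal (norm (cgrad u (x + t *\<^sub>R v)) powr p) * indicator {0..1} t \<partial>lborel)"
proof -
  define g where "g t = norm (cgrad u (x + t *\<^sub>R v))" for t
  let ?D = "\<lambda>t. \<Sum>i\<in>UNIV. v $ i *\<^sub>R (cgrad u (x + t *\<^sub>R v) $ i)"
  have cont: "continuous_on {0..1} g"
    unfolding g_def by (intro continuous_intros continuous_on_compose2[OF continuous_on_cgrad[OF u, of UNIV]]) auto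
  have contD: "continuous_on {0..1} ?D"
    by (intro continuous_intros continuous_on_compose2[OF continuous_on_cgrad[OF u, of UNIV]]) auto
  have "((\<lambda>t. u (x + t *\<^sub>R v)) has_vector_derivative ?D t) (at t within {0..1})" for t
  proof -
    have "((\<lambda>t. x + t *\<^sub>R v) has_derivative (\<lambda>h. h *\<^sub>R v)) (at t within {0..1})"
      by (auto intro!: derivative_eq_intros)
    from has_derivative_compose[OF this smooth_has_derivative[OF u]]
    show ?thesis unfolding has_vector_derivative_def
      by (rule has_derivative_eq_rhs) (auto simp: scaleR_sum_right)
  qed
  then have "(?D has_integral (u (x + 1 *\<^sub>R v) - u (x + 0 *\<^sub>R v))) {0..1}"
    by (intro fundamental_theorem_of_calculus) auto
  then have "u (x + v) - u x = integral {0..1} ?D" by (simp add: integral_unique)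
  also have "norm \<dots> \<le> integral {0..1} (\<lambda>t. norm v * g t)"
    using cont contD by (intro integral_norm_bound_integral integrable_continuous_real)
      (auto intro!: continuous_intros norm_directional_le simp: g_def simp del: cgrad_nth)
  finally have le: "norm (u (x + v) - u x) \<le> norm v * integral {0..1} g" by simp
  have nn: "0 \<le> g t" for t by (simp add: g_def)
  have I: "0 \<le> integral {0..1} g"
    using cont nn by (intro integral_nonneg integrable_continuous_real) auto
  have "norm (u (x + v) - u x) powr p \<le> norm v powr p * (integral {0..1} g) powr p"
    using powr_mono2[OF _ _ le, of p] p I by (simp add: powr_mult)
  also have "\<dots> \<le> norm v powr p * integral {0..1} (\<lambda>t. g t powr p)"
    using powr_integral_le[OF cont nn p] by (intro mult_left_mono) auto
  finally have 1: "norm (u (x + v) - u x) powr p \<le> norm v powr p * integral {0..1} (\<lambda>t. g t powr p)" .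
  have "((\<lambda>t. g t powr p) has_integral integral {0..1} (\<lambda>t. g t powr p)) {0..1}"
    using cont p by (intro integrable_integral integrable_continuous_real continuous_on_powr' continuous_on_const)
      (auto simp: nn)
  from nn_integral_has_integral_lebesgue'[OF _ this]
  have "(\<integral>\<^sup>+t. ennreal (g t powr p) * indicator {0..1} t \<partial>lborel) = ennreal (integral {0..1} (\<lambda>t. g t powr p))"
    by simp
  then show ?thesis
    using 1 by (simp add: g_def ennreal_mult'[symmetric] ennreal_leI)
qed

lemma nn_integral_lborel_translate:
  fixes f :: "'a::euclidean_space \<Rightarrow> ennreal"
  assumes "f \<in> borel_measurable borel"
  shows "(\<integral>\<^sup>+x. f (x + c) \<partial>lborel) = (\<integral>\<^sup>+x. f x \<partial>lborel)"
proof -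
  have "(\<integral>\<^sup>+x. f x \<partial>lborel) = (\<integral>\<^sup>+x. f x \<partial>distr lborel borel ((+) c))"
    by (simp add: lborel_distr_plus)
  also have "\<dots> = (\<integral>\<^sup>+x. f (c + x) \<partial>lborel)"
    using assms by (subst nn_integral_distr) auto
  finally show ?thesis by (simp add: add.commute)
qed

text \<open>After Tonelli, each translate of the gradient integral has the same value by translation
  invariance of Lebesgue measure. Segments may leave M where the gradient vanishes, so M can be a
  shell or a non-convex domain. Both Poincare inequalities and the lower energy bound are instances,
  differing only in A, M and v.\<close>

lemma translation_estimate:
  fixes u :: "real ^ 'n \<Rightarrow> complex"
  assumes u: "smooth u" and p: "1 < p" and [measurable]: "A \<in> sets borel" "M \<in> sets borel"
    and hull: "\<And>x t. x \<in> A \<Longrightarrow> 0 \<le> t \<Longrightarrow> t \<le> 1 \<Longrightarrow> x + t *\<^sub>R v \<in> M \<or> cgrad u (x + t *\<^sub>R v) = 0"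
  shows "(\<integral>\<^sup>+x. ennreal (norm (u (x + v) - u x) powr p) * indicator A x \<partial>lborel)
    \<le> ennreal (norm v powr p) * (\<integral>\<^sup>+x. ennreal (norm (cgrad u x) powr p) * indicator M x \<partial>lborel)"
proof -
  let ?G = "\<lambda>y. ennreal (norm (cgrad u y) powr p) * indicator M y"
  have [measurable]: "cgrad u \<in> borel_measurable borel"
    by (intro borel_measurable_continuous_onI continuous_on_cgrad u)
  have "(\<integral>\<^sup>+x. ennreal (norm (u (x + v) - u x) powr p) * indicator A x \<partial>lborel)
    \<le> (\<integral>\<^sup>+x. ennreal (norm v powr p) * (\<integral>\<^sup>+t. ?G (x + t *\<^sub>R v) * indicator {0..1} t \<partial>lborel) \<partial>lborel)"
  proof (rule nn_integral_mono)
    fix x :: "real ^ 'n"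
    show "ennreal (norm (u (x + v) - u x) powr p) * indicator A x \<le>
       ennreal (norm v powr p) * (\<integral>\<^sup>+t. ?G (x + t *\<^sub>R v) * indicator {0..1} t \<partial>lborel)"
    proof (cases "x \<in> A")
      case True
      have "ennreal (norm (u (x + v) - u x) powr p) \<le> ennreal (norm v powr p) *
         (\<integral>\<^sup>+t. ennreal (norm (cgrad u (x + t *\<^sub>R v)) powr p) * indicator {0..1} t \<partial>lborel)"
        by (rule smooth_difference_powr_le[OF u p])
      also have "(\<integral>\<^sup>+t. ennreal (norm (cgrad u (x + t *\<^sub>R v)) powr p) * indicator {0..1} t \<partial>lborel)
         = (\<integral>\<^sup>+t. ?G (x + t *\<^sub>R v) * indicator {0..1} t \<partial>lborel)"
        using hull[OF True] p by (intro nn_integral_cong) (auto simp: indicator_def)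
      finally show ?thesis using True by simp
    qed simp
  qed
  also have "\<dots> = ennreal (norm v powr p) * (\<integral>\<^sup>+x. (\<integral>\<^sup>+t. ?G (x + t *\<^sub>R v) * indicator {0..1} t \<partial>lborel) \<partial>lborel)"
    by (rule nn_integral_cmult) measurable
  also have "(\<integral>\<^sup>+x. (\<integral>\<^sup>+t. ?G (x + t *\<^sub>R v) * indicator {0..1} t \<partial>lborel) \<partial>lborel)
     = (\<integral>\<^sup>+t. (\<integral>\<^sup>+x. ?G (x + t *\<^sub>R v) * indicator {0..1} t \<partial>lborel) \<partial>lborel)"
    by (rule lborel_pair.Fubini') measurable
  also have "\<dots> = (\<integral>\<^sup>+t. (\<integral>\<^sup>+x. ?G x \<partial>lborel) * indicator {0..1::real} t \<partial>lborel)"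
  proof (rule nn_integral_cong)
    fix t :: real
    have "(\<integral>\<^sup>+x. ?G (x + t *\<^sub>R v) * indicator {0..1} t \<partial>lborel) = (\<integral>\<^sup>+x. ?G (x + t *\<^sub>R v) \<partial>lborel) * indicator {0..1} t"
      by (rule nn_integral_multc) measurable
    also have "(\<integral>\<^sup>+x. ?G (x + t *\<^sub>R v) \<partial>lborel) = (\<integral>\<^sup>+x. ?G x \<partial>lborel)"
      by (rule nn_integral_lborel_translate) measurable
    finally show "(\<integral>\<^sup>+x. ?G (x + t *\<^sub>R v) * indicator {0..1} t \<partial>lborel) = (\<integral>\<^sup>+x. ?G x \<partial>lborel) * indicator {0..1} t" .
  qed
  also have "\<dots> = (\<integral>\<^sup>+x. ?G x \<partial>lborel)"
    by (subst nn_integral_cmult_indicator) auto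
  finally show ?thesis .
qed

section \<open>Integration by parts against test functions\<close>

lemma integral_lebesgue_on_eq_lborel:
  fixes f :: "'a::euclidean_space \<Rightarrow> 'b::{banach, second_countable_topology}"
  assumes "\<Omega> \<in> sets lebesgue" "f \<in> borel_measurable borel" "\<And>x. x \<notin> \<Omega> \<Longrightarrow> f x = 0"
  shows "(LINT x|lebesgue_on \<Omega>. f x) = (LINT x|lborel. f x)"
proof -
  have "(LINT x|lebesgue_on \<Omega>. f x) = (LINT x|lebesgue. indicator \<Omega> x *\<^sub>R f x)"
    using assms by (intro integral_restrict_space) auto
  also have "(\<lambda>x. indicator \<Omega> x *\<^sub>R f x) = f" using assms(3) by (auto simp: indicator_def)
  finally show ?thesis using assms by (simp add: integral_completion)
qed

lemma integral_lborel_translate: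
  fixes f :: "'a::euclidean_space \<Rightarrow> 'b::{banach, second_countable_topology}"
  assumes "f \<in> borel_measurable borel"
  shows "(LINT x|lborel. f (c + x)) = (LINT x|lborel. f x)"
proof -
  have "(LINT x|lborel. f x) = (LINT x|distr lborel borel ((+) c). f x)"
    by (simp add: lborel_distr_plus)
  also have "\<dots> = (LINT x|lborel. f (c + x))"
    using assms by (subst integral_distr) auto
  finally show ?thesis by simp
qed

lemma integrable_lborel_bounded_support:
  fixes f :: "'a::euclidean_space \<Rightarrow> 'b::{banach, second_countable_topology}"
  assumes [measurable]: "f \<in> borel_measurable borel" and "bounded S" and "\<And>x. x \<notin> S \<Longrightarrow> f x = 0"
    and B: "\<And>x. norm (f x) \<le> B"
  shows "integrable lborel f"
proof -
  obtain a where S: "S \<subseteq> cbox (- a) a" using assms(2) bounded_subset_cbox_symmetric by blast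
  have "norm (f x) \<le> norm (indicator (cbox (-a) a) x * B)" for x
    using B[of x] assms(3)[of x] S order_trans[OF norm_ge_zero B[of x]] by (auto simp: indicator_def)
  moreover have "integrable lborel (\<lambda>x. indicator (cbox (-a) a) x * B)"
    by (intro integrable_mult_left integrable_real_indicator) (use emeasure_lborel_cbox_finite[of "- a" a] in auto)
  ultimately show ?thesis
    by (intro Bochner_Integration.integrable_bound[of lborel "\<lambda>x. indicator (cbox (-a) a) x * B" f]) auto
qed

lemma test_functions_bounded:
  assumes "\<phi> \<in> test_functions \<Omega>"
  obtains B where "\<And>x. norm (\<phi> x) \<le> B" "\<And>x. norm (cgrad \<phi> x) \<le> B" "0 \<le> B"
proof -
  obtain K where K: "compact K" "\<And>x. x \<notin> K \<Longrightarrow> \<phi> x = 0" "\<And>x. x \<notin> K \<Longrightarrow> cgrad \<phi> x = 0"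
    by (rule test_functionsE[OF assms]) blast
  note sm = test_functions_smooth[OF assms]
  have "bounded (\<phi> ` K)" "bounded (cgrad \<phi> ` K)"
    using K(1) sm by (auto intro!: compact_imp_bounded compact_continuous_image smooth_imp_continuous_on continuous_on_cgrad)
  then obtain b c where "\<forall>x\<in>K. norm (\<phi> x) \<le> b" "\<forall>x\<in>K. norm (cgrad \<phi> x) \<le> c"
    unfolding bounded_iff by auto
  then have "norm (\<phi> x) \<le> max 0 (max b c)" "norm (cgrad \<phi> x) \<le> max 0 (max b c)" for x
    using K(2,3)[of x] by (cases "x \<in> K"; force)+
  then show ?thesis using that[of "max 0 (max b c)"] by simp
qed

text \<open>Difference quotients integrate to zero by translation invariance and converge pointwise
  to the derivative. The Lipschitz bound dominates them on a fixed ball: the steps are at most 1, so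
  all supports stay within radius R + 1.\<close>

lemma integral_partial_deriv_eq_0:
  fixes w :: "real ^ 'n \<Rightarrow> complex"
  assumes w: "w \<in> test_functions UNIV"
  shows "(LINT x|lborel. partial_deriv i w x) = 0"
proof -
  obtain K where K: "compact K" "\<And>x. x \<notin> K \<Longrightarrow> w x = 0" by (rule test_functionsE[OF w]) blast
  obtain B where B: "\<And>x. norm (w x) \<le> B" "\<And>x. norm (cgrad w x) \<le> B" "0 \<le> B" by (rule test_functions_bounded[OF w]) blast
  note sm = test_functions_smooth[OF w]
  have [measurable]: "w \<in> borel_measurable borel"
    by (intro borel_measurable_continuous_onI smooth_imp_continuous_on sm)
  have [measurable]: "partial_deriv i w \<in> borel_measurable borel"
    by (intro borel_measurable_continuous_onI smooth_imp_continuous_on smooth_imp_smooth_partial_deriv sm)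
  define h where "h k = inverse (real (Suc k)) *\<^sub>R (axis i 1 :: real ^ 'n)" for k
  have nh: "norm (h k) = inverse (real (Suc k))" for k by (simp add: h_def)
  define s where "s k x = real (Suc k) *\<^sub>R (w (h k + x) - w x)" for k x
  obtain R where R: "\<And>x. x \<in> K \<Longrightarrow> norm x \<le> R" using compact_imp_bounded[OF K(1)] bounded_iff by blast
  have lip: "norm (w y - w x) \<le> B * norm (y - x)" for x y
  proof (rule differentiable_bound[OF convex_UNIV])
    show "(w has_derivative (\<lambda>h. \<Sum>i\<in>UNIV. h $ i *\<^sub>R (cgrad w x $ i))) (at x within UNIV)" for x
      using smooth_has_derivative[OF sm] by simp
    show "onorm (\<lambda>h. \<Sum>i\<in>UNIV. h $ i *\<^sub>R (cgrad w x $ i)) \<le> B" for x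
      by (rule onorm_bound[OF B(3)], rule order_trans[OF norm_directional_le])
         (use mult_left_mono[OF B(2) norm_ge_zero] in \<open>simp add: mult.commute\<close>)
  qed auto
  have int_w: "integrable lborel (\<lambda>x. w (c + x))" for c
  proof (rule integrable_lborel_bounded_support)
    show "bounded ((\<lambda>x. - c + x) ` K)"
      by (rule bounded_translation[OF compact_imp_bounded[OF K(1)]])
    show "w (c + x) = 0" if "x \<notin> (\<lambda>x. - c + x) ` K" for x
      using that by (intro K(2)) (auto simp: image_iff dest: bspec[of _ _ "c + x"])
  qed (use B in auto)
  have s_int: "(LINT x|lborel. s k x) = 0" for k
  proof -
    have "integrable lborel w" using int_w[of 0] by simp
    with int_w have "(LINT x|lborel. s k x) = real (Suc k) *\<^sub>R ((LINT x|lborel. w (h k + x)) - (LINT x|lborel. w x))"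
      unfolding s_def by simp
    then show ?thesis using integral_lborel_translate[of w "h k"] by simp
  qed
  have lim: "(\<lambda>k. s k x) \<longlonglongrightarrow> partial_deriv i w x" for x
  proof -
    have "((\<lambda>t. w (x + t *\<^sub>R axis i 1)) has_vector_derivative partial_deriv i w x) (at 0)"
    proof -
      have "((\<lambda>t. x + t *\<^sub>R axis i 1) has_derivative (\<lambda>h. h *\<^sub>R axis i 1)) (at 0)"
        by (auto intro!: derivative_eq_intros)
      from has_derivative_compose[OF this, of w] smooth_has_derivative[OF sm]
      have "((\<lambda>t. w (x + t *\<^sub>R axis i 1)) has_derivative
          (\<lambda>h. \<Sum>j\<in>UNIV. (h *\<^sub>R axis i 1) $ j *\<^sub>R (cgrad w (x + 0 *\<^sub>R axis i 1) $ j))) (at 0)" by blast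
      then show ?thesis unfolding has_vector_derivative_def
        by (rule has_derivative_eq_rhs)
           (auto simp: axis_def if_distrib[of "\<lambda>c. c *\<^sub>R _"] if_distrib[of "\<lambda>c. _ * c"] cong: if_cong)
    qed
    then have "((\<lambda>t. norm (w (x + t *\<^sub>R axis i 1) - w x - t *\<^sub>R partial_deriv i w x) / norm t) \<longlongrightarrow> 0) (at 0)"
      by (simp add: has_vector_derivative_def has_derivative_at)
    moreover have "norm (w (x + t *\<^sub>R axis i 1) - w x - t *\<^sub>R partial_deriv i w x) / norm t
        = norm ((w (x + t *\<^sub>R axis i 1) - w x) /\<^sub>R t - partial_deriv i w x)" if "t \<noteq> 0" for t
    proof -
      have "w (x + t *\<^sub>R axis i 1) - w x - t *\<^sub>R partial_deriv i w x
          = t *\<^sub>R ((w (x + t *\<^sub>R axis i 1) - w x) /\<^sub>R t - partial_deriv i w x)"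
        using that by (simp add: scaleR_diff_right)
      then show ?thesis using that by simp
    qed
    then have "\<forall>\<^sub>F t in at 0. norm (w (x + t *\<^sub>R axis i 1) - w x - t *\<^sub>R partial_deriv i w x) / norm t
        = norm ((w (x + t *\<^sub>R axis i 1) - w x) /\<^sub>R t - partial_deriv i w x)"
      by (auto simp: eventually_at_filter)
    ultimately have "((\<lambda>t. norm ((w (x + t *\<^sub>R axis i 1) - w x) /\<^sub>R t - partial_deriv i w x)) \<longlongrightarrow> 0) (at 0)"
      by (rule Lim_transform_eventually)
    then have "((\<lambda>t. (w (x + t *\<^sub>R axis i 1) - w x) /\<^sub>R t) \<longlongrightarrow> partial_deriv i w x) (at 0)"
      by (rule LIM_zero_cancel[OF tendsto_norm_zero_cancel])
    moreover have "filterlim (\<lambda>k. inverse (real (Suc k))) (at 0) sequentially"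
      by (rule filterlim_atI[OF LIMSEQ_inverse_real_of_nat]) (simp del: of_nat_Suc)
    ultimately have "(\<lambda>k. (w (x + inverse (real (Suc k)) *\<^sub>R axis i 1) - w x) /\<^sub>R inverse (real (Suc k))) \<longlonglongrightarrow> partial_deriv i w x"
      by (rule filterlim_compose)
    then show ?thesis by (simp add: s_def h_def add.commute)
  qed
  have "(\<lambda>k. LINT x|lborel. s k x) \<longlonglongrightarrow> (LINT x|lborel. partial_deriv i w x)"
  proof (rule integral_dominated_convergence)
    show "integrable lborel (\<lambda>x::real^'n. indicator (cball 0 (R + 1)) x * B)"
      by (intro integrable_mult_left integrable_real_indicator)
         (use emeasure_bounded_finite[OF bounded_cball[of "0::real^'n" "R + 1"]] in auto)
    show "AE x in lborel. norm (s k x) \<le> indicator (cball 0 (R + 1)) x * B" for k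
    proof (rule AE_I2)
      fix x :: "real ^ 'n"
      show "norm (s k x) \<le> indicator (cball 0 (R + 1)) x * B"
      proof (cases "x \<in> cball 0 (R + 1)")
        case True
        have "norm (s k x) \<le> real (Suc k) * (B * norm (h k))"
          unfolding s_def using lip[of "h k + x" x] by (simp del: of_nat_Suc add: mult_left_mono)
        moreover have "real (Suc k) * (B * norm (h k)) = B" unfolding nh by (simp add: field_simps)
        ultimately have "norm (s k x) \<le> B" by linarith
        then show ?thesis using True by simp
      next
        case False
        have "norm (h k) \<le> 1" unfolding nh by (simp add: field_simps)
        then have "norm (h k + x) > R"
          using False norm_triangle_ineq4[of "h k + x" "h k"] by simp
        then have "h k + x \<notin> K" using R[of "h k + x"] by linarith
        moreover have "x \<notin> K" using R[of x] False by auto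
        ultimately have "w (h k + x) = 0" "w x = 0" using K(2) by auto
        then show ?thesis using B(3) by (simp add: s_def)
      qed
    qed
  qed (use lim in \<open>auto simp: s_def\<close>)
  then show ?thesis using s_int LIMSEQ_unique[of "\<lambda>k. 0" 0] by simp
qed

text \<open>The product of u and \<phi> is compactly supported even if u is not, so its derivative
  integrates to zero.\<close>

lemma integral_by_parts_test:
  fixes u :: "real ^ 'n \<Rightarrow> complex"
  assumes u: "smooth u" and \<phi>: "\<phi> \<in> test_functions \<Omega>" and "open \<Omega>"
  shows "(LINT x|lebesgue_on \<Omega>. u x * partial_deriv i \<phi> x) = - (LINT x|lebesgue_on \<Omega>. cgrad u x $ i * \<phi> x)"
proof -
  obtain K where K: "compact K" "K \<subseteq> \<Omega>" "\<And>x. x \<notin> K \<Longrightarrow> \<phi> x = 0" "\<And>x. x \<notin> K \<Longrightarrow> cgrad \<phi> x = 0"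
    by (rule test_functionsE[OF \<phi>]) blast
  note sm = test_functions_smooth[OF \<phi>]
  have pd: "partial_deriv i \<phi> x = 0" if "x \<notin> K" for x using K(4)[OF that] by (metis cgrad_nth zero_index)
  have w: "(\<lambda>x. u x * \<phi> x) \<in> test_functions UNIV"
    by (rule test_functionsI[of _ K]) (use K u sm in \<open>auto intro: smooth_mult\<close>)
  have t1: "(\<lambda>x. u x * partial_deriv i \<phi> x) \<in> test_functions \<Omega>"
    by (intro test_functions_mult u test_functions_partial_deriv \<phi>)
  have t2: "(\<lambda>x. cgrad u x $ i * \<phi> x) \<in> test_functions \<Omega>"
    unfolding cgrad_nth by (intro test_functions_mult \<phi> smooth_imp_smooth_partial_deriv u)
  have meas: "f \<in> borel_measurable borel" if "f \<in> test_functions \<Omega>" for f :: "real^'n \<Rightarrow> complex"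
    using that by (intro borel_measurable_continuous_onI smooth_imp_continuous_on test_functions_smooth)
  have int: "integrable lborel f" if f: "f \<in> test_functions \<Omega>" for f :: "real^'n \<Rightarrow> complex"
  proof -
    obtain L where L: "compact L" "\<And>x. x \<notin> L \<Longrightarrow> f x = 0" using test_functionsE[OF f] by metis
    obtain B where B: "\<And>x. norm (f x) \<le> B" using test_functions_bounded[OF f] by metis
    show ?thesis
      by (rule integrable_lborel_bounded_support[of _ L]) (use L B meas[OF f] in \<open>auto intro: compact_imp_bounded\<close>)
  qed
  have \<Omega>: "\<Omega> \<in> sets lebesgue" using \<open>open \<Omega>\<close> by simp
  have "partial_deriv i (\<lambda>x. u x * \<phi> x) x = u x * partial_deriv i \<phi> x + cgrad u x $ i * \<phi> x" for x
    using arg_cong[OF cgrad_mult[OF u sm, of x], of "\<lambda>z. z $ i"] by (simp add: mult.commute)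
  then have "(LINT x|lborel. u x * partial_deriv i \<phi> x + cgrad u x $ i * \<phi> x) = 0"
    using integral_partial_deriv_eq_0[OF w, of i] by simp
  then have "(LINT x|lborel. u x * partial_deriv i \<phi> x) + (LINT x|lborel. cgrad u x $ i * \<phi> x) = 0"
    using int[OF t1] int[OF t2] by (subst (asm) Bochner_Integration.integral_add) auto
  moreover have "(LINT x|lebesgue_on \<Omega>. u x * partial_deriv i \<phi> x) = (LINT x|lborel. u x * partial_deriv i \<phi> x)"
    by (intro integral_lebesgue_on_eq_lborel \<Omega> meas t1) (use pd K in auto)
  moreover have "(LINT x|lebesgue_on \<Omega>. cgrad u x $ i * \<phi> x) = (LINT x|lborel. cgrad u x $ i * \<phi> x)"
    by (intro integral_lebesgue_on_eq_lborel \<Omega> meas t2) (use K in auto)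
  ultimately show ?thesis by (simp add: add_eq_0_iff2)
qed

subsection \<open>The fundamental lemma of the calculus of variations\<close>

text \<open>Boxes form an intersection-stable generator of the Borel sets, and the sets over which f
  integrates to zero form a Dynkin system, complements included because the total integral vanishes
  as a limit over growing boxes. Lebesgue sets differ from Borel sets by null sets.\<close>

lemma AE_zero_of_box_integrals:
  fixes f :: "'a::euclidean_space \<Rightarrow> 'b::{banach, second_countable_topology}"
  assumes f: "integrable lebesgue f"
    and box: "\<And>a b. (LINT x:box a b|lebesgue. f x) = 0"
  shows "AE x in lebesgue. f x = 0"
proof (rule sigma_finite_measure.density_zero[OF _ f])
  show "sigma_finite_measure (lebesgue :: 'a measure)"
  proof
    obtain A :: "'a set set" where A: "countable A" "A \<subseteq> sets lborel" "\<Union>A = space lborel" "\<forall>a\<in>A. emeasure lborel a \<noteq> \<infinity>"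
      using lborel.sigma_finite_countable by blast
    then have "\<forall>a\<in>A. emeasure lebesgue a \<noteq> \<infinity>" "A \<subseteq> sets lebesgue" by auto
    moreover have "\<Union>A = space lebesgue" using A by simp
    ultimately show "\<exists>A :: 'a set set. countable A \<and> A \<subseteq> sets lebesgue \<and> \<Union>A = space lebesgue \<and> (\<forall>a\<in>A. emeasure lebesgue a \<noteq> \<infinity>)"
      using A(1) by blast
  qed
  let ?E = "range (\<lambda>(a, b). box a b :: 'a set)"
  have set_int: "set_integrable lebesgue A f" if "A \<in> sets lebesgue" for A
    unfolding set_integrable_def using f that by (intro integrable_mult_indicator)
  have univ: "(LINT x|lebesgue. f x) = 0"
  proof -
    let ?A = "\<lambda>n::nat. box (- (real n *\<^sub>R One)) (real n *\<^sub>R One) :: 'a set"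
    have "(\<lambda>n. LINT x|lebesgue. indicator (?A n) x *\<^sub>R f x) \<longlonglongrightarrow> (LINT x|lebesgue. f x)"
    proof (rule integral_dominated_convergence[where w = "\<lambda>x. norm (f x)"])
      show "AE x in lebesgue. (\<lambda>n. indicator (?A n) x *\<^sub>R f x) \<longlonglongrightarrow> f x"
      proof (rule AE_I2)
        fix x :: 'a
        have "x \<in> (\<Union>n. ?A n)" by (simp add: UN_box_eq_UNIV)
        then obtain N where N: "x \<in> ?A N" by blast
        have "x \<in> ?A n" if "N \<le> n" for n
          using N that by (force simp: mem_box)
        then have "\<forall>\<^sub>F n in sequentially. indicator (?A n) x *\<^sub>R f x = f x"
          unfolding eventually_sequentially by (intro exI[of _ N]) auto
        then show "(\<lambda>n. indicator (?A n) x *\<^sub>R f x) \<longlonglongrightarrow> f x" by (rule tendsto_eventually)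
      qed
      show "AE x in lebesgue. norm (indicator (?A n) x *\<^sub>R f x) \<le> norm (f x)" for n
        by (auto simp: indicator_def)
      show "(\<lambda>x. indicator (?A n) x *\<^sub>R f x) \<in> borel_measurable lebesgue" for n
        using f by (intro borel_measurable_scaleR borel_measurable_indicator) auto
    qed (use f in auto)
    then show ?thesis
      using box LIMSEQ_unique[of "\<lambda>n. 0" 0] by (simp add: set_lebesgue_integral_def)
  qed
  have borel: "(LINT x:A|lebesgue. f x) = 0" if A: "A \<in> sets borel" for A
  proof (rule sigma_sets_induct_disjoint[of ?E UNIV A "\<lambda>A. (LINT x:A|lebesgue. f x) = 0"])
    have sb: "sigma_sets UNIV ?E = sets borel" by (simp add: borel_eq_box)
    show "Int_stable ?E" by (auto simp: Int_stable_def box_Int_box)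
    show "A \<in> sigma_sets UNIV ?E" using A sb by simp
    show "(LINT x:B|lebesgue. f x) = 0" if "B \<in> ?E" for B using that box by auto
    show "(LINT x:UNIV - B|lebesgue. f x) = 0" if B: "B \<in> sigma_sets UNIV ?E" "(LINT x:B|lebesgue. f x) = 0" for B
    proof -
      have "B \<in> sets lebesgue" using B sb by (metis sets_completionI_sets sets_lborel)
      then have "(LINT x:B \<union> (UNIV - B)|lebesgue. f x) = (LINT x:B|lebesgue. f x) + (LINT x:UNIV - B|lebesgue. f x)"
        by (intro set_integral_Un set_int) auto
      then show ?thesis using B univ by (simp add: set_lebesgue_integral_def)
    qed
    show "(LINT x:(\<Union>i. B i)|lebesgue. f x) = 0"
      if B: "disjoint_family B" "range B \<subseteq> sigma_sets UNIV ?E" "\<And>i. (LINT x:B i|lebesgue. f x) = 0" for B :: "nat \<Rightarrow> 'a set"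
    proof -
      have "B i \<in> sets lebesgue" for i using B(2) sb by (metis range_subsetD sets_completionI_sets sets_lborel)
      then show ?thesis
        using B(1,3) by (subst lebesgue_integral_countable_add) (auto simp: disjoint_family_on_def intro!: set_int)
    qed
  qed (auto simp: set_lebesgue_integral_def)
  show "(LINT x:A|lebesgue. f x) = 0" if A: "A \<in> sets lebesgue" for A
  proof -
    obtain S N N' where S: "A = S \<union> N" "N \<subseteq> N'" "N' \<in> null_sets lborel" "S \<in> sets lborel"
      using A by (rule sets_completionE)
    have "N' \<in> null_sets lebesgue" using S(3) null_sets_completionI by blast
    then have "AE x in lebesgue. x \<notin> N'" by (rule AE_not_in)
    then have ae: "AE x in lebesgue. indicator A x *\<^sub>R f x = indicator S x *\<^sub>R f x"
      by eventually_elim (use S in \<open>auto simp: indicator_def\<close>)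
    have "(LINT x:A|lebesgue. f x) = (LINT x:S|lebesgue. f x)"
      unfolding set_lebesgue_integral_def
      using ae A S(4) f by (intro integral_cong_AE) (auto intro!: borel_measurable_scaleR borel_measurable_indicator)
    also have "\<dots> = 0" using S(4) by (intro borel) auto
    finally show ?thesis .
  qed
qed

text \<open>Uniformly bounded test functions converge to the indicator of a box, so H integrates to
  zero over every open box whose closed box lies in \<Omega>; countably many closed boxes cover
  \<Omega>.\<close>

lemma test_integral_eq_0_imp_AE:
  fixes H :: "real ^ 'n \<Rightarrow> complex"
  assumes "open \<Omega>" and H: "locally_integrable \<Omega> H"
    and test: "\<And>\<phi>. \<phi> \<in> test_functions \<Omega> \<Longrightarrow> (LINT x|lebesgue_on \<Omega>. H x * \<phi> x) = 0"
  shows "AE x in lebesgue_on \<Omega>. H x = 0"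
proof -
  have \<Omega>: "\<Omega> \<in> sets lebesgue" using \<open>open \<Omega>\<close> by simp
  have int: "integrable lebesgue (\<lambda>x. indicator (cbox a b) x *\<^sub>R H x)" if "cbox a b \<subseteq> \<Omega>" for a b
    using H that compact_cbox[of a b] integrable_restrict_space[of "cbox a b" lebesgue H]
    unfolding locally_integrable_def by auto
  have box0: "(LINT x|lebesgue. indicator (box a b) x *\<^sub>R H x) = 0" if ab: "cbox a b \<subseteq> \<Omega>" for a b
  proof -
    obtain \<phi> where \<phi>: "\<And>k::nat. \<phi> k \<in> test_functions \<Omega>" "\<And>k x. norm (\<phi> k x) \<le> 1"
      "\<And>x. (\<lambda>k. \<phi> k x) \<longlonglongrightarrow> indicator (box a b) x" "\<And>k x. x \<notin> cbox a b \<Longrightarrow> \<phi> k x = 0"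
      by (rule box_indicator_approx[OF ab]) blast
    have eq: "indicator \<Omega> x *\<^sub>R (H x * \<phi> k x) = (indicator (cbox a b) x *\<^sub>R H x) * \<phi> k x" for k x
      using ab \<phi>(4)[of x k] by (auto simp: indicator_def)
    have mH: "(\<lambda>x. indicator (cbox a b) x *\<^sub>R H x) \<in> borel_measurable lebesgue"
      using int[OF ab] by (rule borel_measurable_integrable)
    have m\<phi>: "\<phi> k \<in> borel_measurable lebesgue" for k
      using smooth_imp_continuous_on[OF test_functions_smooth[OF \<phi>(1)]]
      by (intro measurable_completion) (auto intro: borel_measurable_continuous_onI)
    have "(\<lambda>k. LINT x|lebesgue. (indicator (cbox a b) x *\<^sub>R H x) * \<phi> k x) \<longlonglongrightarrow>
       (LINT x|lebesgue. (indicator (cbox a b) x *\<^sub>R H x) * indicator (box a b) x)"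
    proof (rule integral_dominated_convergence[where w = "\<lambda>x. norm (indicator (cbox a b) x *\<^sub>R H x)"])
      show "AE x in lebesgue. (\<lambda>k. indicator (cbox a b) x *\<^sub>R H x * \<phi> k x) \<longlonglongrightarrow>
          indicator (cbox a b) x *\<^sub>R H x * indicator (box a b) x"
        by (intro AE_I2 tendsto_mult tendsto_const \<phi>(3))
      show "AE x in lebesgue. norm (indicator (cbox a b) x *\<^sub>R H x * \<phi> k x) \<le> norm (indicator (cbox a b) x *\<^sub>R H x)" for k
        unfolding norm_mult by (intro AE_I2 mult_left_le \<phi>(2) norm_ge_zero)
    qed (intro borel_measurable_times mH m\<phi> borel_measurable_indicator integrable_norm[OF int[OF ab]]; simp)+
    moreover have "(LINT x|lebesgue. (indicator (cbox a b) x *\<^sub>R H x) * \<phi> k x) = 0" for k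
      using test[OF \<phi>(1)[of k]] \<Omega> unfolding eq[symmetric] by (subst (asm) integral_restrict_space) auto
    moreover have "(indicator (cbox a b) x *\<^sub>R H x) * indicator (box a b) x = indicator (box a b) x *\<^sub>R H x" for x
      using box_subset_cbox[of a b] by (auto simp: indicator_def)
    ultimately show ?thesis using LIMSEQ_unique[of "\<lambda>n. 0" 0] by simp
  qed
  have cbox: "AE x in lebesgue. x \<in> cbox a b \<longrightarrow> H x = 0" if ab: "cbox a b \<subseteq> \<Omega>" for a b
  proof -
    \<comment> \<open>The faces are null, so open and closed boxes may be exchanged.\<close>
    have bd: "AE x in lebesgue. x \<notin> cbox a b - box a b"
      using negligible_frontier_interval[of a b] by (intro AE_not_in) (simp add: negligible_iff_null_sets)
    have "AE x in lebesgue. indicator (cbox a b) x *\<^sub>R H x = 0"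
    proof (rule AE_zero_of_box_integrals[OF int[OF ab]])
      fix c d :: "real ^ 'n"
      obtain c' d' where cd: "box c d \<inter> box a b = box c' d'" using box_Int_box[of c d a b] by blast
      \<comment> \<open>If the open box is empty, \<open>cbox c' d'\<close> is not known to lie in
        \<Omega>, but then the integral is trivially zero.\<close>
      have sub: "cbox c' d' \<subseteq> \<Omega>" if "box c' d' \<noteq> {}"
      proof -
        have "closure (box c' d') \<subseteq> closure (box a b)" using cd by (intro closure_mono) auto
        moreover have "closure (box a b) \<subseteq> cbox a b" by (intro closure_minimal box_subset_cbox closed_cbox)
        ultimately show ?thesis using closure_box[OF that] ab by auto
      qed
      have "(LINT x:box c d|lebesgue. indicator (cbox a b) x *\<^sub>R H x) = (LINT x|lebesgue. indicator (box c' d') x *\<^sub>R H x)"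
        unfolding set_lebesgue_integral_def
      proof (rule integral_cong_AE)
        have m: "(\<lambda>x. indicator S x *\<^sub>R (indicator (cbox a b) x *\<^sub>R H x)) \<in> borel_measurable lebesgue" if "S \<in> sets borel" for S
          using that by (intro borel_measurable_scaleR[OF _ borel_measurable_integrable[OF int[OF ab]]] borel_measurable_indicator) auto
        show "(\<lambda>x. indicat_real (box c d) x *\<^sub>R indicat_real (cbox a b) x *\<^sub>R H x) \<in> borel_measurable lebesgue"
          by (rule m) auto
        have "(\<lambda>x. indicat_real (box c' d') x *\<^sub>R H x) = (\<lambda>x. indicat_real (box c' d') x *\<^sub>R indicat_real (cbox a b) x *\<^sub>R H x)"
          using cd box_subset_cbox[of a b] by (auto simp: indicator_def fun_eq_iff)
        then show "(\<lambda>x. indicat_real (box c' d') x *\<^sub>R H x) \<in> borel_measurable lebesgue"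
          using m[of "box c' d'"] by simp
        show "AE x in lebesgue. indicat_real (box c d) x *\<^sub>R indicat_real (cbox a b) x *\<^sub>R H x = indicat_real (box c' d') x *\<^sub>R H x"
          using bd
        proof eventually_elim
          case (elim x)
          then show ?case using cd box_subset_cbox[of a b] by (auto simp: indicator_def)
        qed
      qed
      also have "\<dots> = 0" using box0[OF sub] by (cases "box c' d' = {}") auto
      finally show "(LINT x:box c d|lebesgue. indicator (cbox a b) x *\<^sub>R H x) = 0" .
    qed
    then show ?thesis by eventually_elim (auto simp: indicator_def)
  qed
  obtain \<D> where D: "countable \<D>" "\<And>X. X \<in> \<D> \<Longrightarrow> \<exists>a b. X = cbox a b" "\<D> \<subseteq> Pow \<Omega>" "\<Union>\<D> = \<Omega>"
    using open_countable_Union_open_cbox[OF \<open>open \<Omega>\<close>] by metis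
  have "AE x in lebesgue. \<forall>X\<in>\<D>. x \<in> X \<longrightarrow> H x = 0"
  proof (subst AE_ball_countable[OF D(1)], rule ballI)
    fix X assume X: "X \<in> \<D>"
    then obtain a b where "X = cbox a b" using D(2) by blast
    with X D(3) cbox[of a b] show "AE x in lebesgue. x \<in> X \<longrightarrow> H x = 0" by auto
  qed
  then have "AE x in lebesgue. x \<in> \<Omega> \<longrightarrow> H x = 0"
    by eventually_elim (use D(4) in blast)
  then show ?thesis using \<Omega> by (subst AE_restrict_space_iff) auto
qed

section \<open>Spaces of \<open>p\<close>-integrable functions\<close>

definition Lp :: "'a measure \<Rightarrow> real \<Rightarrow> ('a \<Rightarrow> 'b::euclidean_space) set" where
  "Lp M p = {f \<in> borel_measurable M. integrable M (\<lambda>x. norm (f x) powr p)}"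

lemma Lp_space_eq: "Lp_space \<Omega> p = Lp (lebesgue_on \<Omega>) p"
  by (simp add: Lp_space_def Lp_def)

lemma LpD:
  assumes "f \<in> Lp M p"
  shows "f \<in> borel_measurable M" "integrable M (\<lambda>x. norm (f x) powr p)"
  using assms by (auto simp: Lp_def)

text \<open>A quasi-triangle inequality for p-th powers. The estimates below ask for boundedness or
  convergence to zero, never for sharp constants, so the factor 2^p is harmless.\<close>

lemma norm_add_powr_le:
  assumes "0 \<le> p"
  shows "norm (a + b) powr p \<le> 2 powr p * (norm a powr p + norm b powr p)"
proof -
  have "norm (a + b) powr p \<le> (2 * max (norm a) (norm b)) powr p"
    using norm_triangle_ineq[of a b] assms by (intro powr_mono2) auto
  also have "\<dots> = 2 powr p * max (norm a) (norm b) powr p"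
    by (simp add: powr_mult)
  also have "max (norm a) (norm b) powr p \<le> norm a powr p + norm b powr p"
    by (auto simp: max_def)
  finally show ?thesis by (simp add: mult_left_mono)
qed

lemma norm_diff_powr_le:
  assumes "0 \<le> p"
  shows "norm (a - b) powr p \<le> 2 powr p * (norm a powr p + norm b powr p)"
  using norm_add_powr_le[OF assms, of a "- b"] by simp

lemma Lp_bound:
  fixes f :: "'a \<Rightarrow> 'b::euclidean_space" and g :: "'a \<Rightarrow> 'c::euclidean_space"
  assumes "f \<in> Lp M p" "g \<in> borel_measurable M" "\<And>x. x \<in> space M \<Longrightarrow> norm (g x) \<le> C * norm (f x)"
    and "0 \<le> p" "0 \<le> C"
  shows "g \<in> Lp M p"
    "(LINT x|M. norm (g x) powr p) \<le> C powr p * (LINT x|M. norm (f x) powr p)"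
proof -
  note f = LpD[OF assms(1)]
  have le: "norm (g x) powr p \<le> C powr p * norm (f x) powr p" if "x \<in> space M" for x
    using powr_mono2[OF \<open>0 \<le> p\<close> norm_ge_zero assms(3)[OF that]] assms(5) by (simp add: powr_mult)
  have meas: "(\<lambda>x. norm (g x) powr p) \<in> borel_measurable M" using assms(2) by measurable
  have int: "integrable M (\<lambda>x. norm (g x) powr p)"
    by (rule Bochner_Integration.integrable_bound[OF integrable_mult_right[OF f(2), of "C powr p"] meas])
       (use le in auto)
  then show "g \<in> Lp M p" using assms(2) by (simp add: Lp_def)
  show "(LINT x|M. norm (g x) powr p) \<le> C powr p * (LINT x|M. norm (f x) powr p)"
    using integral_mono[OF int integrable_mult_right[OF f(2), of "C powr p"] le] by simp
qed

lemma Lp_add: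
  assumes "f \<in> Lp M p" "g \<in> Lp M p" "0 \<le> p"
  shows "(\<lambda>x. f x + g x) \<in> Lp M p"
    "(LINT x|M. norm (f x + g x) powr p) \<le>
       2 powr p * ((LINT x|M. norm (f x) powr p) + (LINT x|M. norm (g x) powr p))"
proof -
  note f = LpD[OF assms(1)] and g = LpD[OF assms(2)]
  have [measurable]: "f \<in> borel_measurable M" "g \<in> borel_measurable M" by (fact f(1), fact g(1))
  have I: "integrable M (\<lambda>x. 2 powr p * (norm (f x) powr p + norm (g x) powr p))"
    using f g by (intro integrable_mult_right Bochner_Integration.integrable_add)
  have int: "integrable M (\<lambda>x. norm (f x + g x) powr p)"
    by (rule Bochner_Integration.integrable_bound[OF I])
       (use norm_add_powr_le[OF \<open>0 \<le> p\<close>] in \<open>auto\<close>)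
  then show "(\<lambda>x. f x + g x) \<in> Lp M p" by (simp add: Lp_def)
  have "(LINT x|M. norm (f x + g x) powr p) \<le> (LINT x|M. 2 powr p * (norm (f x) powr p + norm (g x) powr p))"
    using int I norm_add_powr_le[OF \<open>0 \<le> p\<close>] by (intro integral_mono) auto
  also have "\<dots> = 2 powr p * ((LINT x|M. norm (f x) powr p) + (LINT x|M. norm (g x) powr p))"
    using f g by simp
  finally show "(LINT x|M. norm (f x + g x) powr p) \<le>
       2 powr p * ((LINT x|M. norm (f x) powr p) + (LINT x|M. norm (g x) powr p))" .
qed

lemma Lp_uminus: "f \<in> Lp M p \<Longrightarrow> (\<lambda>x. - f x) \<in> Lp M p"
  by (simp add: Lp_def)

lemma Lp_diff:
  assumes "f \<in> Lp M p" "g \<in> Lp M p" "0 \<le> p"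
  shows "(\<lambda>x. f x - g x) \<in> Lp M p"
    "(LINT x|M. norm (f x - g x) powr p) \<le>
       2 powr p * ((LINT x|M. norm (f x) powr p) + (LINT x|M. norm (g x) powr p))"
  using Lp_add[OF assms(1) Lp_uminus[OF assms(2)] assms(3)] by simp_all

lemma Lp_scaleR:
  assumes "f \<in> Lp M p" "0 \<le> p"
  shows "(\<lambda>x. c *\<^sub>R f x) \<in> Lp M p"
  using assms LpD(1)[OF assms(1)] by (intro Lp_bound(1)[OF assms(1), of _ "\<bar>c\<bar>"]) auto

text \<open>Compare t with \<delta>. Integrated over a finite measure space, this plays the part of
  Hoelder's inequality: an L1 norm is at most a small constant plus a multiple of the p-th power
  integral.\<close>

lemma le_add_powr:
  assumes "0 < \<delta>" "1 \<le> p" "0 \<le> (t::real)"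
  shows "t \<le> \<delta> + \<delta> powr (1 - p) * t powr p"
proof (cases "t \<le> \<delta>")
  case False
  then have "t powr (1 - p) \<le> \<delta> powr (1 - p)" using assms by (intro powr_mono2') auto
  then have "t powr (1 - p) * t powr p \<le> \<delta> powr (1 - p) * t powr p" by (intro mult_right_mono) auto
  moreover have "t powr (1 - p) * t powr p = t" using False assms by (simp add: powr_add[symmetric])
  ultimately show ?thesis using assms by simp
qed (use assms in \<open>simp add: add_increasing2\<close>)

lemma Lp_integrable:
  assumes "f \<in> Lp M p" "finite_measure M" "1 \<le> p"
  shows "integrable M f"
    "0 < \<delta> \<Longrightarrow> (LINT x|M. norm (f x)) \<le> \<delta> * measure M (space M) + \<delta> powr (1 - p) * (LINT x|M. norm (f x) powr p)"
proof -
  interpret finite_measure M by fact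
  note f = LpD[OF assms(1)]
  have I: "integrable M (\<lambda>x. \<delta> + \<delta> powr (1 - p) * norm (f x) powr p)" for \<delta>
    using f by simp
  show int: "integrable M f"
    by (rule Bochner_Integration.integrable_bound[OF I[of 1] f(1)]) (use le_add_powr[of 1 p] assms in auto)
  show "(LINT x|M. norm (f x)) \<le> \<delta> * measure M (space M) + \<delta> powr (1 - p) * (LINT x|M. norm (f x) powr p)"
    if "0 < \<delta>"
  proof -
    have "(LINT x|M. norm (f x)) \<le> (LINT x|M. \<delta> + \<delta> powr (1 - p) * norm (f x) powr p)"
      using int I that assms(3) by (intro integral_mono le_add_powr) auto
    also have "\<dots> = \<delta> * measure M (space M) + \<delta> powr (1 - p) * (LINT x|M. norm (f x) powr p)"
      using f by simp
    finally show ?thesis .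
  qed
qed

lemma Lp_null_imp_L1_null:
  assumes f: "\<And>k. f k \<in> Lp M p" and "finite_measure M" "1 \<le> p"
    and lim: "(\<lambda>k. LINT x|M. norm (f k x) powr p) \<longlonglongrightarrow> 0"
  shows "(\<lambda>k::nat. LINT x|M. norm (f k x)) \<longlonglongrightarrow> 0"
proof (rule LIMSEQ_I)
  fix e :: real assume e: "0 < e"
  define m where "m = measure M (space M) + 1"
  have m: "m > 0" by (simp add: m_def add_nonneg_pos)
  define \<delta> where "\<delta> = e / (2 * m)"
  have \<delta>: "\<delta> > 0" using e m by (simp add: \<delta>_def)
  define c where "c = \<delta> powr (1 - p)"
  have c: "c > 0" using \<delta> by (simp add: c_def)
  obtain N where N: "\<And>k. k \<ge> N \<Longrightarrow> norm ((LINT x|M. norm (f k x) powr p) - 0) < e / (2 * c)"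
    using LIMSEQ_D[OF lim, of "e / (2 * c)"] e c by auto
  have "norm ((LINT x|M. norm (f k x)) - 0) < e" if "k \<ge> N" for k
  proof -
    have "(LINT x|M. norm (f k x)) \<le> \<delta> * measure M (space M) + c * (LINT x|M. norm (f k x) powr p)"
      unfolding c_def by (rule Lp_integrable(2)[OF f assms(2,3) \<delta>])
    also have "\<delta> * measure M (space M) \<le> \<delta> * m" using \<delta> by (intro mult_left_mono) (auto simp: m_def)
    also have "\<delta> * m = e / 2" using m by (simp add: \<delta>_def)
    also have "c * (LINT x|M. norm (f k x) powr p) < c * (e / (2 * c))"
      using N[OF that] c by (intro mult_strict_left_mono) auto
    also have "c * (e / (2 * c)) = e / 2" using c by simp
    finally show ?thesis by (simp add: integral_nonneg_AE)
  qed
  then show "\<exists>N. \<forall>k\<ge>N. norm ((LINT x|M. norm (f k x)) - 0) < e" by blast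
qed

text \<open>Riesz-Fischer, for p-th power integrals in place of norms. A fast subsequence converges
  almost everywhere, and Fatou's lemma carries the Cauchy estimate to the limit.\<close>

lemma Lp_complete:
  fixes f :: "nat \<Rightarrow> 'a \<Rightarrow> 'b::euclidean_space"
  assumes f: "\<And>k. f k \<in> Lp M p" and p: "1 \<le> p"
    and Cauchy: "\<And>e. 0 < e \<Longrightarrow> \<exists>N. \<forall>k\<ge>N. \<forall>l\<ge>N. (LINT x|M. norm (f k x - f l x) powr p) < e"
  obtains g where "g \<in> Lp M p" "(\<lambda>k. LINT x|M. norm (f k x - g x) powr p) \<longlonglongrightarrow> 0"
proof -
  have [measurable]: "f k \<in> borel_measurable M" for k using LpD(1)[OF f] .
  have diff_int: "integrable M (\<lambda>x. norm (f k x - f l x) powr p)" for k l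
    using LpD(2)[OF Lp_diff(1)[OF f f]] p by simp
  \<comment> \<open>Chosen so that the p-th power of \<open>2 ^ j * d j x\<close> has integral at
    most 2^-j: the sum over j is then finite almost everywhere, and there \<open>d j x\<close> is at
    most a constant times 2^-j.\<close>
  define e where "e j = (1/2) ^ j / (2 ^ j) powr p" for j :: nat
  have e_pos: "e j > 0" for j by (simp add: e_def)
  have "\<forall>j. \<exists>N. \<forall>k\<ge>N. \<forall>l\<ge>N. (LINT x|M. norm (f k x - f l x) powr p) < e j"
    using Cauchy e_pos by blast
  then obtain N where N: "\<And>j k l. k \<ge> N j \<Longrightarrow> l \<ge> N j \<Longrightarrow> (LINT x|M. norm (f k x - f l x) powr p) < e j"
    by metis
  \<comment> \<open>Adding up all thresholds makes both \<open>r j\<close> and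
    \<open>r (Suc j)\<close> at least \<open>N j\<close>; the summand j makes r tend to
    infinity.\<close>
  define r where "r j = j + (\<Sum>i\<le>j. N i)" for j
  have r: "r j \<ge> N j" "r (Suc j) \<ge> N j" "r j \<ge> j" for j
    using member_le_sum[of j "{..j}" N] by (auto simp: r_def)
  define d where "d j x = norm (f (r (Suc j)) x - f (r j) x)" for j x
  have [measurable]: "d j \<in> borel_measurable M" for j unfolding d_def by measurable
  have "(\<integral>\<^sup>+x. (\<Sum>j. ennreal ((2 ^ j * d j x) powr p)) \<partial>M) = (\<Sum>j. \<integral>\<^sup>+x. ennreal ((2 ^ j * d j x) powr p) \<partial>M)"
    by (rule nn_integral_suminf) measurable
  also have "\<dots> \<le> (\<Sum>j. ennreal ((1/2) ^ j))"
  proof (rule suminf_le)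
    fix j
    have "(\<integral>\<^sup>+x. ennreal ((2 ^ j * d j x) powr p) \<partial>M) = ennreal (LINT x|M. (2 ^ j) powr p * norm (f (r (Suc j)) x - f (r j) x) powr p)"
      by (subst nn_integral_eq_integral[symmetric])
         (auto simp: powr_mult d_def intro!: integrable_mult_right diff_int)
    also have "\<dots> \<le> ennreal ((1/2) ^ j)"
    proof (rule ennreal_leI)
      have "(LINT x|M. (2 ^ j) powr p * norm (f (r (Suc j)) x - f (r j) x) powr p)
         = (2 ^ j) powr p * (LINT x|M. norm (f (r (Suc j)) x - f (r j) x) powr p)" by simp
      also have "\<dots> \<le> (2 ^ j) powr p * e j"
        using N[OF r(2) r(1), of j] by (intro mult_left_mono) auto
      also have "\<dots> = (1/2) ^ j" by (simp add: e_def)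
      finally show "(LINT x|M. (2 ^ j) powr p * norm (f (r (Suc j)) x - f (r j) x) powr p) \<le> (1/2) ^ j" .
    qed
    finally show "(\<integral>\<^sup>+x. ennreal ((2 ^ j * d j x) powr p) \<partial>M) \<le> ennreal ((1/2) ^ j)" .
  qed auto
  also have "\<dots> < \<infinity>"
    by (simp add: suminf_ennreal2 summable_geometric less_top[symmetric])
  finally have "(\<integral>\<^sup>+x. (\<Sum>j. ennreal ((2 ^ j * d j x) powr p)) \<partial>M) \<noteq> \<infinity>" by simp
  then have ae: "AE x in M. (\<Sum>j. ennreal ((2 ^ j * d j x) powr p)) \<noteq> \<infinity>"
    by (intro nn_integral_PInf_AE) auto
  have conv: "convergent (\<lambda>j. f (r j) x)" if fin: "(\<Sum>j. ennreal ((2 ^ j * d j x) powr p)) \<noteq> \<infinity>" for x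
  proof -
    define C where "C = enn2real (\<Sum>j. ennreal ((2 ^ j * d j x) powr p))"
    have C: "ennreal C = (\<Sum>j. ennreal ((2 ^ j * d j x) powr p))" using fin by (simp add: C_def less_top)
    have C0: "0 \<le> C" by (simp add: C_def)
    have le: "d j x \<le> C powr (1 / p) * (1/2) ^ j" for j
    proof -
      have "ennreal ((2 ^ j * d j x) powr p) \<le> (\<Sum>j. ennreal ((2 ^ j * d j x) powr p))"
      proof -
        have "(\<Sum>j\<in>{j}. ennreal ((2 ^ j * d j x) powr p)) \<le> (\<Sum>j. ennreal ((2 ^ j * d j x) powr p))"
          by (rule sum_le_suminf) (rule summableI, simp_all)
        then show ?thesis by simp
      qed
      then have "(2 ^ j * d j x) powr p \<le> C" unfolding C[symmetric] using C0 by simp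
      then have "((2 ^ j * d j x) powr p) powr (1/p) \<le> C powr (1/p)" using p by (intro powr_mono2) auto
      then have "2 ^ j * d j x \<le> C powr (1/p)" using p by (simp add: powr_powr d_def)
      then show ?thesis by (simp add: field_simps power_one_over)
    qed
    have "summable (\<lambda>j. C powr (1 / p) * (1/2) ^ j)" by (intro summable_mult summable_geometric) auto
    then have "summable (\<lambda>j. norm (f (r (Suc j)) x - f (r j) x))"
      by (rule summable_comparison_test[rotated]) (use le in \<open>auto simp: d_def\<close>)
    then have "summable (\<lambda>j. f (r (Suc j)) x - f (r j) x)" by (rule summable_norm_cancel)
    then have "convergent (\<lambda>n. \<Sum>j<n. f (r (Suc j)) x - f (r j) x)" by (simp add: summable_iff_convergent)
    then have "convergent (\<lambda>n. f (r n) x - f (r 0) x)" by (simp add: sum_lessThan_telescope[of "\<lambda>j. f (r j) x"])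
    then show ?thesis using convergent_add[OF _ convergent_const[of "f (r 0) x"]] by fastforce
  qed
  define g where "g x = lim (\<lambda>j. f (r j) x)" for x
  have [measurable]: "g \<in> borel_measurable M" unfolding g_def by (rule borel_measurable_lim_metric) measurable
  have ae_lim: "AE x in M. (\<lambda>j. f (r j) x) \<longlonglongrightarrow> g x"
    using ae by eventually_elim (use conv in \<open>auto simp: g_def convergent_LIMSEQ_iff\<close>)
  have fatou: "(\<integral>\<^sup>+x. ennreal (norm (f k x - g x) powr p) \<partial>M) \<le> ennreal \<epsilon>"
    if K: "\<And>l. l \<ge> K \<Longrightarrow> (LINT x|M. norm (f k x - f l x) powr p) \<le> \<epsilon>" for k K \<epsilon>
  proof -
    have "AE x in M. ennreal (norm (f k x - g x) powr p) = liminf (\<lambda>j. ennreal (norm (f k x - f (r j) x) powr p))"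
      using ae_lim
    proof eventually_elim
      case (elim x)
      have "(\<lambda>j. ennreal (norm (f k x - f (r j) x) powr p)) \<longlonglongrightarrow> ennreal (norm (f k x - g x) powr p)"
        using p by (intro tendsto_ennrealI tendsto_powr' tendsto_norm tendsto_diff tendsto_const elim) auto
      then show ?case by (intro lim_imp_Liminf[symmetric]) auto
    qed
    then have "(\<integral>\<^sup>+x. ennreal (norm (f k x - g x) powr p) \<partial>M) = (\<integral>\<^sup>+x. liminf (\<lambda>j. ennreal (norm (f k x - f (r j) x) powr p)) \<partial>M)"
      by (rule nn_integral_cong_AE)
    also have "\<dots> \<le> liminf (\<lambda>j. \<integral>\<^sup>+x. ennreal (norm (f k x - f (r j) x) powr p) \<partial>M)"
      by (rule nn_integral_liminf) measurable
    also have "\<dots> \<le> limsup (\<lambda>j. \<integral>\<^sup>+x. ennreal (norm (f k x - f (r j) x) powr p) \<partial>M)"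
      by (rule Liminf_le_Limsup) simp
    also have "\<dots> \<le> ennreal \<epsilon>"
    proof (rule Limsup_bounded)
      show "\<forall>\<^sub>F j in sequentially. (\<integral>\<^sup>+x. ennreal (norm (f k x - f (r j) x) powr p) \<partial>M) \<le> ennreal \<epsilon>"
        unfolding eventually_sequentially
      proof (intro exI[of _ K] allI impI)
        fix j assume "K \<le> j"
        then have "K \<le> r j" using r(3)[of j] by linarith
        then show "(\<integral>\<^sup>+x. ennreal (norm (f k x - f (r j) x) powr p) \<partial>M) \<le> ennreal \<epsilon>"
          using K[of "r j"] diff_int by (subst nn_integral_eq_integral) (auto intro: ennreal_leI)
      qed
    qed
    finally show ?thesis .
  qed
  have small: "\<exists>K. \<forall>k\<ge>K. integrable M (\<lambda>x. norm (f k x - g x) powr p) \<and> (LINT x|M. norm (f k x - g x) powr p) \<le> \<epsilon>"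
    if \<epsilon>: "0 < \<epsilon>" for \<epsilon>
  proof -
    obtain K where K: "\<forall>k\<ge>K. \<forall>l\<ge>K. (LINT x|M. norm (f k x - f l x) powr p) < \<epsilon>" using Cauchy[OF \<epsilon>] by blast
    have "integrable M (\<lambda>x. norm (f k x - g x) powr p) \<and> (LINT x|M. norm (f k x - g x) powr p) \<le> \<epsilon>" if k: "k \<ge> K" for k
    proof -
      have le: "(\<integral>\<^sup>+x. ennreal (norm (f k x - g x) powr p) \<partial>M) \<le> ennreal \<epsilon>"
        by (rule fatou[of K]) (use K k in \<open>auto intro: less_imp_le\<close>)
      have int: "integrable M (\<lambda>x. norm (f k x - g x) powr p)"
        by (rule integrableI_bounded) (use le in \<open>auto intro: le_less_trans\<close>)
      moreover have "(LINT x|M. norm (f k x - g x) powr p) \<le> \<epsilon>"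
        using le \<epsilon> int by (subst (asm) nn_integral_eq_integral) auto
      ultimately show ?thesis by blast
    qed
    then show ?thesis by blast
  qed
  show ?thesis
  proof (rule that)
    obtain K where "integrable M (\<lambda>x. norm (f K x - g x) powr p)" using small[of 1] by auto
    then have "(\<lambda>x. f K x - g x) \<in> Lp M p" by (simp add: Lp_def)
    from Lp_diff(1)[OF f this, of K] show "g \<in> Lp M p" using p by simp
    show "(\<lambda>k. LINT x|M. norm (f k x - g x) powr p) \<longlonglongrightarrow> 0"
    proof (rule LIMSEQ_I)
      fix \<epsilon> :: real assume "0 < \<epsilon>"
      then obtain K where K: "\<forall>k\<ge>K. (LINT x|M. norm (f k x - g x) powr p) \<le> \<epsilon> / 2"
        using small[of "\<epsilon> / 2"] by auto
      have "norm ((LINT x|M. norm (f k x - g x) powr p) - 0) < \<epsilon>" if "k \<ge> K" for k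
      proof -
        have "0 \<le> (LINT x|M. norm (f k x - g x) powr p)" by (intro Bochner_Integration.integral_nonneg) auto
        then show ?thesis using K[rule_format, OF that] \<open>0 < \<epsilon>\<close> by simp
      qed
      then show "\<exists>K. \<forall>k\<ge>K. norm ((LINT x|M. norm (f k x - g x) powr p) - 0) < \<epsilon>" by blast
    qed
  qed
qed

subsection \<open>Uniform convexity\<close>

text \<open>The mean value theorem on the two halves of [s, t]: the derivative is strictly
  increasing, so the right half gains more than the left.\<close>

lemma powr_midpoint_less:
  fixes s t p :: real
  assumes "1 < p" "0 \<le> s" "s < t"
  shows "((s + t) / 2) powr p < (s powr p + t powr p) / 2"
proof -
  let ?m = "(s + t) / 2"
  have mvt: "\<exists>z. a < z \<and> z < b \<and> b powr p - a powr p = (b - a) * (p * z powr (p - 1))"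
    if "0 \<le> a" "a < b" for a b
  proof -
    have "continuous_on {a..b} (\<lambda>x. x powr p)"
      using that assms by (intro continuous_on_powr' continuous_on_id continuous_on_const) auto
    moreover have "((\<lambda>x. x powr p) has_real_derivative p * x powr (p - 1)) (at x)" if "a < x" "x < b" for x
      using \<open>0 \<le> a\<close> that by (intro has_real_derivative_powr) auto
    ultimately show ?thesis
      using MVT[OF \<open>a < b\<close>, of "\<lambda>x. x powr p"] DERIV_unique
      by (metis (no_types, lifting) real_differentiable_def)
  qed
  obtain \<eta> where \<eta>: "s < \<eta>" "\<eta> < ?m" "?m powr p - s powr p = (?m - s) * (p * \<eta> powr (p - 1))"
    using mvt[of s ?m] assms by auto
  obtain \<xi> where \<xi>: "?m < \<xi>" "\<xi> < t" "t powr p - ?m powr p = (t - ?m) * (p * \<xi> powr (p - 1))"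
    using mvt[of ?m t] assms by auto
  have "\<eta> powr (p - 1) < \<xi> powr (p - 1)" using \<eta> \<xi> assms by (intro powr_less_mono2) auto
  then have "((t - s) / 2) * (p * \<eta> powr (p - 1)) < ((t - s) / 2) * (p * \<xi> powr (p - 1))"
    using assms by (intro mult_strict_left_mono) auto
  moreover have "?m - s = (t - s) / 2" "t - ?m = (t - s) / 2" by (simp_all add: field_simps)
  ultimately have "?m powr p - s powr p < t powr p - ?m powr p" using \<eta>(3) \<xi>(3) by metis
  then show ?thesis by simp
qed

text \<open>If the norms differ, strict convexity of t^p decides; if they agree, the parallelogram
  law makes the midpoint strictly shorter.\<close>

lemma norm_midpoint_powr_less:
  fixes a b :: "'a::real_inner"
  assumes p: "1 < p" and ne: "a \<noteq> b"
  shows "norm ((a + b) /\<^sub>R 2) powr p < (norm a powr p + norm b powr p) / 2"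
proof (cases "norm a = norm b")
  case False
  have "norm ((a + b) /\<^sub>R 2) \<le> (norm a + norm b) / 2" using norm_triangle_ineq[of a b] by simp
  then have "norm ((a + b) /\<^sub>R 2) powr p \<le> ((norm a + norm b) / 2) powr p" using p by (intro powr_mono2) auto
  also have "\<dots> < (norm a powr p + norm b powr p) / 2"
    using False powr_midpoint_less[OF p, of "norm a" "norm b"] powr_midpoint_less[OF p, of "norm b" "norm a"]
    by (cases "norm a < norm b") (auto simp: add.commute)
  finally show ?thesis .
next
  case True
  have "(norm (a + b))\<^sup>2 + (norm (a - b))\<^sup>2 = 2 * (norm a)\<^sup>2 + 2 * (norm b)\<^sup>2"
    by (simp add: power2_norm_eq_inner inner_add inner_diff inner_commute)
  moreover have "(norm (a - b))\<^sup>2 > 0" using ne by simp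
  ultimately have "(norm (a + b))\<^sup>2 < (2 * norm a)\<^sup>2" using True by (simp add: power2_eq_square)
  then have "norm (a + b) < 2 * norm a" by (rule power2_less_imp_less) simp
  then have "norm ((a + b) /\<^sub>R 2) powr p < norm a powr p" using p by (intro powr_less_mono2) auto
  then show ?thesis using True by simp
qed

lemma norm_midpoint_powr_le:
  fixes a b :: "'a::real_inner"
  assumes p: "1 < p"
  shows "norm ((a + b) /\<^sub>R 2) powr p \<le> (norm a powr p + norm b powr p) / 2"
proof (cases "a = b")
  case True
  have "(b + b) /\<^sub>R 2 = b" by (simp add: scaleR_2[symmetric])
  then show ?thesis using True by simp
qed (use norm_midpoint_powr_less[OF p, of a b] in simp)

text \<open>A compactness form of Clarkson's inequalities, for all p > 1 alike. Both sides are
  homogeneous of degree p, so normalise |a|^p + |b|^p = 1; where |a - b|^p >= \<epsilon>, the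
  convexity defect has a positive minimum \<delta>, and elsewhere the first summand
  suffices.\<close>

lemma uniform_convexity_powr:
  fixes p :: real
  assumes p: "1 < p" and \<epsilon>: "0 < \<epsilon>"
  obtains K where "0 \<le> K" "\<And>a b :: 'a::euclidean_space. norm (a - b) powr p \<le>
    \<epsilon> * (norm a powr p + norm b powr p) +
    K * ((norm a powr p + norm b powr p) / 2 - norm ((a + b) /\<^sub>R 2) powr p)"
proof -
  define S where "S = {z :: 'a \<times> 'a. norm (fst z) powr p + norm (snd z) powr p = 1 \<and> norm (fst z - snd z) powr p \<ge> \<epsilon>}"
  define F where "F z = (norm (fst z) powr p + norm (snd z) powr p) / 2 - norm ((fst z + snd z) /\<^sub>R 2) powr p" for z :: "'a \<times> 'a"
  have cont: "continuous_on UNIV (\<lambda>z :: 'a \<times> 'a. norm (h z) powr p)" if "continuous_on UNIV h" for h :: "'a \<times> 'a \<Rightarrow> 'a"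
    using that p by (intro continuous_on_powr' continuous_on_norm continuous_on_const) auto
  have c1: "continuous_on UNIV (\<lambda>z :: 'a \<times> 'a. norm (fst z) powr p)" "continuous_on UNIV (\<lambda>z :: 'a \<times> 'a. norm (snd z) powr p)"
    "continuous_on UNIV (\<lambda>z :: 'a \<times> 'a. norm (fst z - snd z) powr p)"
    "continuous_on UNIV (\<lambda>z :: 'a \<times> 'a. norm ((fst z + snd z) /\<^sub>R 2) powr p)"
    by (intro cont continuous_intros)+
  have "continuous_on UNIV F" unfolding F_def
    by (intro continuous_on_diff continuous_on_divide continuous_on_add c1 continuous_on_const) auto
  then have contF: "continuous_on S F" by (rule continuous_on_subset) simp
  have "closed S" unfolding S_def
    by (intro closed_Collect_conj closed_Collect_eq closed_Collect_le continuous_intros c1)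
  moreover have "bounded S"
  proof (rule boundedI)
    fix z :: "'a \<times> 'a" assume z: "z \<in> S"
    have "x \<le> 1" if "x powr p \<le> 1" "0 \<le> x" for x :: real
    proof (rule ccontr)
      assume "\<not> x \<le> 1"
      then have "1 powr p < x powr p" using p by (intro powr_less_mono2) auto
      with that show False by simp
    qed
    then have "norm (fst z) \<le> 1" "norm (snd z) \<le> 1" using z unfolding S_def
      by (smt (verit, ccfv_SIG) mem_Collect_eq norm_ge_zero powr_ge_zero)+
    then show "norm z \<le> 2" using norm_Pair_le[of "fst z" "snd z"] by simp
  qed
  ultimately have S: "compact S" by (simp add: compact_eq_bounded_closed)
  have pos: "F z > 0" if "z \<in> S" for z
  proof -
    have "fst z \<noteq> snd z" using that \<epsilon> by (auto simp: S_def)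
    then show ?thesis unfolding F_def using norm_midpoint_powr_less[OF p, of "fst z" "snd z"] by simp
  qed
  \<comment> \<open>For large \<epsilon> the compact set is empty and any \<delta> will do.\<close>
  obtain \<delta> where \<delta>: "\<delta> > 0" "\<And>z. z \<in> S \<Longrightarrow> \<delta> \<le> F z"
  proof (cases "S = {}")
    case True then show ?thesis using that[of 1] by auto
  next
    case False
    obtain z0 where "z0 \<in> S" "\<forall>z\<in>S. F z0 \<le> F z" using continuous_attains_inf[OF S False contF] by blast
    then show ?thesis using that[of "F z0"] pos by auto
  qed
  let ?K = "2 powr p / \<delta>"
  show ?thesis
  proof (rule that)
    show "0 \<le> ?K" using \<delta> by simp
    fix a b :: 'a
    define s where "s = norm a powr p + norm b powr p"
    define B where "B = s / 2 - norm ((a + b) /\<^sub>R 2) powr p"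
    have B: "B \<ge> 0" using norm_midpoint_powr_le[OF p, of a b] by (simp add: B_def s_def)
    have s: "s \<ge> 0" by (simp add: s_def)
    show "norm (a - b) powr p \<le> \<epsilon> * (norm a powr p + norm b powr p) +
       ?K * ((norm a powr p + norm b powr p) / 2 - norm ((a + b) /\<^sub>R 2) powr p)"
      unfolding s_def[symmetric] B_def[symmetric]
    proof (cases "norm (a - b) powr p \<le> \<epsilon> * s")
      case True
      have "0 \<le> ?K * B" using \<delta> B by simp
      with True show "norm (a - b) powr p \<le> \<epsilon> * s + ?K * B" by simp
    next
      case False
      have s0: "s > 0"
      proof (rule ccontr)
        assume "\<not> 0 < s"
        then have "norm a powr p = 0" "norm b powr p = 0" using s unfolding s_def by (smt (verit) powr_ge_zero)+
        then have "a = 0" "b = 0" using p by auto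
        with False p show False by (simp add: s_def)
      qed
      \<comment> \<open>Scaling the pair by s^(-1/p) moves it into \<open>S\<close>.\<close>
      define c where "c = s powr (- 1 / p)"
      have c: "c > 0" using s0 by (simp add: c_def)
      have cp: "c powr p = 1 / s" 
      proof -
        have "c powr p = s powr (- 1)" unfolding c_def powr_powr using p by simp
        then show ?thesis using s0 by (simp add: powr_minus_divide)
      qed
      have nc: "norm (c *\<^sub>R x) powr p = norm x powr p / s" for x :: 'a
        using c by (simp add: powr_mult cp)
      have "(c *\<^sub>R a, c *\<^sub>R b) \<in> S"
      proof -
        have "norm (c *\<^sub>R a) powr p + norm (c *\<^sub>R b) powr p = 1"
          unfolding nc using s0 by (simp add: s_def add_divide_distrib[symmetric])
        moreover have "norm (c *\<^sub>R a - c *\<^sub>R b) powr p \<ge> \<epsilon>"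
          unfolding scaleR_diff_right[symmetric] nc using False s0 by (simp add: field_simps)
        ultimately show ?thesis by (simp add: S_def)
      qed
      from \<delta>(2)[OF this] have "\<delta> \<le> (norm a powr p / s + norm b powr p / s) / 2 - norm ((a + b) /\<^sub>R 2) powr p / s"
      proof -
        have "(c *\<^sub>R a + c *\<^sub>R b) /\<^sub>R 2 = c *\<^sub>R ((a + b) /\<^sub>R 2)" by (simp add: scaleR_add_right)
        with \<open>\<delta> \<le> F (c *\<^sub>R a, c *\<^sub>R b)\<close> show ?thesis unfolding F_def by (simp only: fst_conv snd_conv nc)
      qed
      also have "\<dots> = B / s" unfolding B_def add_divide_distrib[symmetric] s_def[symmetric]
        by (simp add: diff_divide_distrib)
      finally have "\<delta> * s \<le> B" using s0 by (simp add: field_simps)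
      then have "?K * (\<delta> * s) \<le> ?K * B" using \<delta> by (intro mult_left_mono) auto
      then have "2 powr p * s \<le> ?K * B" using \<delta> by simp
      moreover have "norm (a - b) powr p \<le> 2 powr p * s"
        unfolding s_def using p by (intro norm_diff_powr_le) simp
      moreover have "0 \<le> \<epsilon> * s" using \<epsilon> s by simp
      ultimately show "norm (a - b) powr p \<le> \<epsilon> * s + ?K * B" by linarith
    qed
  qed
qed

lemma integrable_weight_powr:
  assumes g: "g \<in> Lp M p" and w: "w \<in> borel_measurable M" "\<And>x. x \<in> space M \<Longrightarrow> 0 \<le> w x \<and> w x \<le> C"
  shows "integrable M (\<lambda>x. w x * norm (g x) powr p)"
proof (rule Bochner_Integration.integrable_bound)
  show "integrable M (\<lambda>x. C * norm (g x) powr p)" using LpD(2)[OF g] by simp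
  show "(\<lambda>x. w x * norm (g x) powr p) \<in> borel_measurable M"
    using LpD(1)[OF g] w(1) by measurable
  show "AE x in M. norm (w x * norm (g x) powr p) \<le> norm (C * norm (g x) powr p)"
    using w(2) by (intro AE_I2) (auto simp: abs_mult intro!: mult_right_mono intro: order_trans[OF _ abs_ge_self])
qed

text \<open>The midpoint of two members is a competitor, so its energy is at least m. The convexity
  defect of two late members is therefore small, and uniform convexity turns this into smallness of
  their distance: the sequence converges strongly.\<close>

lemma minimizing_sequence_Cauchy:
  fixes g :: "nat \<Rightarrow> 'a \<Rightarrow> 'b::euclidean_space"
  assumes p: "1 < p" and g: "\<And>k. g k \<in> Lp M p"
    and w: "w \<in> borel_measurable M" "\<And>x. x \<in> space M \<Longrightarrow> c \<le> w x \<and> w x \<le> C" "0 < c"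
    and lim: "(\<lambda>k. LINT x|M. w x * norm (g k x) powr p) \<longlonglongrightarrow> m"
    and mid: "\<And>k l. m \<le> (LINT x|M. w x * norm ((g k x + g l x) /\<^sub>R 2) powr p)"
    and e: "0 < e"
  shows "\<exists>N. \<forall>k\<ge>N. \<forall>l\<ge>N. (LINT x|M. norm (g k x - g l x) powr p) < e"
proof -
  define E where "E h = (LINT x|M. w x * norm (h x) powr p)" for h :: "'a \<Rightarrow> 'b"
  have w0: "0 \<le> w x \<and> w x \<le> C" if "x \<in> space M" for x using w(2)[OF that] w(3) by simp
  note int = integrable_weight_powr[OF _ w(1) w0]
  have m_le: "0 \<le> \<bar>m\<bar> + 1" by simp
  \<comment> \<open>Two late energies sum to at most 2 (|m| + 1), so this term takes half of c e;
    \<open>\<mu>\<close> below keeps the defect term under the other half.\<close>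
  define \<epsilon> where "\<epsilon> = c * e / (4 * (\<bar>m\<bar> + 1))"
  have \<epsilon>: "\<epsilon> > 0" using w(3) e by (simp add: \<epsilon>_def)
  obtain K where K: "0 \<le> K" "\<And>a b :: 'b. norm (a - b) powr p \<le> \<epsilon> * (norm a powr p + norm b powr p) +
    K * ((norm a powr p + norm b powr p) / 2 - norm ((a + b) /\<^sub>R 2) powr p)"
    using uniform_convexity_powr[OF p \<epsilon>] by metis
  define \<mu> where "\<mu> = min 1 (c * e / (4 * (K + 1)))"
  have \<mu>: "\<mu> > 0" using w(3) e K(1) by (simp add: \<mu>_def)
  have \<mu>1: "\<mu> \<le> 1" by (simp add: \<mu>_def)
  obtain N where N: "\<And>k. k \<ge> N \<Longrightarrow> norm (E (g k) - m) < \<mu>"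
    using LIMSEQ_D[OF lim \<mu>] unfolding E_def by blast
  have "(LINT x|M. norm (g k x - g l x) powr p) < e" if k: "k \<ge> N" and l: "l \<ge> N" for k l
  proof -
    let ?h = "\<lambda>x. (g k x + g l x) /\<^sub>R 2"
    have h: "?h \<in> Lp M p" using Lp_scaleR[OF Lp_add(1)[OF g g]] p by simp
    have d: "(\<lambda>x. g k x - g l x) \<in> Lp M p" using Lp_diff(1)[OF g g] p by simp
    have rhs: "integrable M (\<lambda>x. \<epsilon> * (w x * norm (g k x) powr p + w x * norm (g l x) powr p) +
        K * ((w x * norm (g k x) powr p + w x * norm (g l x) powr p) / 2 - w x * norm (?h x) powr p))"
      using int[OF g[of k]] int[OF g[of l]] int[OF h]
      by (intro Bochner_Integration.integrable_add integrable_mult_right Bochner_Integration.integrable_diff integrable_divide) auto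
    have "c * (LINT x|M. norm (g k x - g l x) powr p) = (LINT x|M. c * norm (g k x - g l x) powr p)" by simp
    also have "\<dots> \<le> (LINT x|M. \<epsilon> * (w x * norm (g k x) powr p + w x * norm (g l x) powr p) +
        K * ((w x * norm (g k x) powr p + w x * norm (g l x) powr p) / 2 - w x * norm (?h x) powr p))"
    proof (rule integral_mono)
      show "integrable M (\<lambda>x. c * norm (g k x - g l x) powr p)" using LpD(2)[OF d] by simp
      fix x assume x: "x \<in> space M"
      have "c * norm (g k x - g l x) powr p \<le> w x * norm (g k x - g l x) powr p"
        using w(2)[OF x] by (intro mult_right_mono) auto
      also have "\<dots> \<le> w x * (\<epsilon> * (norm (g k x) powr p + norm (g l x) powr p) +
         K * ((norm (g k x) powr p + norm (g l x) powr p) / 2 - norm (?h x) powr p))"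
        using w0[OF x] by (intro mult_left_mono K(2)) auto
      also have "\<dots> = \<epsilon> * (w x * norm (g k x) powr p + w x * norm (g l x) powr p) +
        K * ((w x * norm (g k x) powr p + w x * norm (g l x) powr p) / 2 - w x * norm (?h x) powr p)"
        by (simp add: algebra_simps)
      finally show "c * norm (g k x - g l x) powr p \<le> \<epsilon> * (w x * norm (g k x) powr p + w x * norm (g l x) powr p) +
        K * ((w x * norm (g k x) powr p + w x * norm (g l x) powr p) / 2 - w x * norm (?h x) powr p)" .
    qed (fact rhs)
    also have "\<dots> = \<epsilon> * (E (g k) + E (g l)) + K * ((E (g k) + E (g l)) / 2 - E ?h)"
      unfolding E_def using int[OF g[of k]] int[OF g[of l]] int[OF h] by simp
    also have "\<dots> \<le> \<epsilon> * (2 * (\<bar>m\<bar> + 1)) + K * \<mu>"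
    proof (intro add_mono mult_left_mono)
      show "E (g k) + E (g l) \<le> 2 * (\<bar>m\<bar> + 1)" 
      proof -
        have "E (g k) - m < 1" "E (g l) - m < 1" "m \<le> \<bar>m\<bar>"
          using N[OF k] N[OF l] \<mu>1 by (auto simp: abs_less_iff)
        then show ?thesis unfolding distrib_left by linarith
      qed
      show "(E (g k) + E (g l)) / 2 - E ?h \<le> \<mu>"
      proof -
        have "E (g k) - m < \<mu>" "E (g l) - m < \<mu>" "m \<le> E ?h"
          using N[OF k] N[OF l] mid[of k l] by (auto simp: abs_less_iff E_def)
        then show ?thesis by argo
      qed
    qed (use \<epsilon> K in auto)
    also have "\<epsilon> * (2 * (\<bar>m\<bar> + 1)) = c * e / 2" by (simp add: \<epsilon>_def field_simps)
    also have "K * \<mu> < c * e / 2"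
    proof -
      have "K * \<mu> \<le> K * (c * e / (4 * (K + 1)))" using K(1) by (intro mult_left_mono) (auto simp: \<mu>_def)
      also have "\<dots> = (c * e / 4) * (K / (K + 1))" by simp
      also have "\<dots> \<le> (c * e / 4) * 1" using K(1) w(3) e by (intro mult_left_mono) auto
      also have "\<dots> < c * e / 2" using w(3) e by simp
      finally show ?thesis .
    qed
    finally show ?thesis using w(3) by simp
  qed
  then show ?thesis by blast
qed

section \<open>Sobolev spaces on bounded open sets\<close>

text \<open>\<open>cdot\<close> is bilinear; conjugating its second argument gives the Hermitian
  product, whose real part is the inner product of the type.\<close>

definition vcnj :: "complex ^ 'n \<Rightarrow> complex ^ 'n" where
  "vcnj z = (\<chi> i. cnj (z $ i))"

lemma vcnj_nth [simp]: "vcnj z $ i = cnj (z $ i)"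
  by (simp add: vcnj_def)

lemma norm_vcnj [simp]: "norm (vcnj z) = norm z"
  by (simp add: norm_vec_def)

lemma vcnj_diff: "vcnj (z - w) = vcnj z - vcnj w"
  by (simp add: vec_eq_iff)

lemma cgrad_cnj_vcnj: "smooth f \<Longrightarrow> cgrad (\<lambda>x. cnj (f x)) x = vcnj (cgrad f x)"
  by (simp add: cgrad_cnj vcnj_def)

lemma bounded_linear_vcnj: "bounded_linear (vcnj :: complex ^ 'n \<Rightarrow> _)"
  by (intro linear_conv_bounded_linear[THEN iffD1] linearI) (simp_all add: vec_eq_iff)

lemma bounded_linear_smult: "bounded_linear (\<lambda>z :: complex ^ 'n. a *s z)"
  by (intro linear_conv_bounded_linear[THEN iffD1] linearI) (simp_all add: vec_eq_iff algebra_simps)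

lemma borel_measurable_bounded_linear:
  fixes f :: "'a \<Rightarrow> 'b::real_normed_vector" and T :: "'b \<Rightarrow> 'c::real_normed_vector"
  assumes "bounded_linear T" "f \<in> borel_measurable N"
  shows "(\<lambda>x. T (f x)) \<in> borel_measurable N"
  using measurable_compose[OF assms(2) borel_measurable_continuous_onI[OF linear_continuous_on[OF assms(1)]]]
  by simp

locale bounded_domain =
  fixes \<Omega> :: "(real ^ 'n) set" and p :: real
  assumes \<Omega>_open: "open \<Omega>" and \<Omega>_bounded: "bounded \<Omega>" and p_gt_1: "1 < p"
begin

abbreviation M where "M \<equiv> lebesgue_on \<Omega>"

lemma \<Omega>_sets [simp]: "\<Omega> \<in> sets lebesgue" "\<Omega> \<in> sets borel"
  using \<Omega>_open by simp_all

lemma p_nonneg: "0 \<le> p" "1 \<le> p" using p_gt_1 by simp_all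

lemma space_M [simp]: "space M = \<Omega>" by (simp add: space_restrict_space)

lemma finite_measure_M: "finite_measure M"
  by (intro finite_measure_lebesgue_on bounded_set_imp_lmeasurable \<Omega>_bounded \<Omega>_sets)

lemma continuous_measurable: "continuous_on UNIV f \<Longrightarrow> f \<in> borel_measurable M"
  by (rule continuous_imp_measurable_on_sets_lebesgue[OF _ \<Omega>_sets(1)]) (rule continuous_on_subset, auto)

lemma continuous_Lp:
  fixes f :: "real ^ 'n \<Rightarrow> 'b::euclidean_space"
  assumes f: "continuous_on UNIV f"
  shows "f \<in> Lp M p"
proof -
  interpret finite_measure M by (rule finite_measure_M)
  have "compact (f ` closure \<Omega>)"
    using f \<Omega>_bounded by (intro compact_continuous_image continuous_on_subset[OF f]) auto
  then obtain B where B: "\<And>x. x \<in> closure \<Omega> \<Longrightarrow> norm (f x) \<le> B"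
    using compact_imp_bounded bounded_iff by (metis imageI)
  have meas: "f \<in> borel_measurable M" by (rule continuous_measurable[OF f])
  have "norm (f x) powr p \<le> B powr p" if "x \<in> \<Omega>" for x
    using B[of x] that closure_subset[of \<Omega>] p_nonneg by (intro powr_mono2) auto
  then have "integrable M (\<lambda>x. norm (f x) powr p)"
    using meas by (intro integrable_const_bound[where B = "B powr p"]) auto
  with meas show ?thesis by (simp add: Lp_def)
qed

lemma smooth_Lp:
  assumes "smooth f" shows "f \<in> Lp M p" "cgrad f \<in> Lp M p"
  by (intro continuous_Lp smooth_imp_continuous_on continuous_on_cgrad assms)+

lemma integrable_M_iff:
  fixes f :: "real ^ 'n \<Rightarrow> 'b::euclidean_space"
  shows "integrable M f \<longleftrightarrow> integrable lebesgue (\<lambda>x. indicator \<Omega> x *\<^sub>R f x)"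
  by (rule integrable_restrict_space) simp

lemma integrable_imp_locally_integrable:
  fixes f :: "real ^ 'n \<Rightarrow> 'b::euclidean_space"
  assumes "integrable M f" shows "locally_integrable \<Omega> f"
  unfolding locally_integrable_def
proof (intro allI impI, elim conjE)
  fix K assume K: "compact K" "K \<subseteq> \<Omega>"
  have Ks: "K \<in> sets lebesgue" using K(1) by (simp add: compact_imp_closed)
  have "integrable lebesgue (\<lambda>x. indicator K x *\<^sub>R (indicator \<Omega> x *\<^sub>R f x))"
    using assms Ks unfolding integrable_M_iff by (rule integrable_mult_indicator[rotated])
  also have "(\<lambda>x. indicat_real K x *\<^sub>R (indicat_real \<Omega> x *\<^sub>R f x)) = (\<lambda>x. indicator K x *\<^sub>R f x)"
    using K by (auto simp: indicator_def fun_eq_iff)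
  finally show "integrable (lebesgue_on K) f"
    using Ks by (subst integrable_restrict_space) auto
qed

lemma Lp_locally_integrable:
  fixes f :: "real ^ 'n \<Rightarrow> 'b::euclidean_space"
  shows "f \<in> Lp M p \<Longrightarrow> locally_integrable \<Omega> f"
  by (intro integrable_imp_locally_integrable Lp_integrable(1)[OF _ finite_measure_M p_nonneg(2)])

text \<open>Weak gradients are only locally integrable by definition, so measurability on all of
  \<Omega> comes from an exhaustion by compact sets.\<close>

lemma locally_integrable_measurable:
  fixes f :: "real ^ 'n \<Rightarrow> 'b::euclidean_space"
  assumes f: "locally_integrable \<Omega> f" shows "f \<in> borel_measurable M"
proof -
  obtain C :: "nat \<Rightarrow> (real ^ 'n) set" where C: "\<And>n. compact (C n)" "\<And>n. C n \<subseteq> \<Omega>"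
    "\<And>n. C n \<subseteq> interior (C (Suc n))" "\<Union>(range C) = \<Omega>"
  proof (rule open_Union_compact_subsets[OF \<Omega>_open])
    fix C :: "nat \<Rightarrow> (real ^ 'n) set"
    assume C: "\<And>n. compact (C n)" "\<And>n. C n \<subseteq> \<Omega>" "\<And>n. C n \<subseteq> interior (C (Suc n))" "\<Union>(range C) = \<Omega>"
    show thesis by (rule that[OF C])
  qed
  have mono: "C m \<subseteq> C n" if "m \<le> n" for m n
    by (rule lift_Suc_mono_le[of C, OF subset_trans[OF C(3) interior_subset] that])
  have "(\<lambda>x. indicator \<Omega> x *\<^sub>R f x) \<in> borel_measurable lebesgue"
  proof (rule borel_measurable_LIMSEQ_metric)
    show "(\<lambda>x. indicator (C n) x *\<^sub>R f x) \<in> borel_measurable lebesgue" for n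
    proof -
      have "integrable (lebesgue_on (C n)) f" using f C by (auto simp: locally_integrable_def)
      then have "integrable lebesgue (\<lambda>x. indicator (C n) x *\<^sub>R f x)"
        using C(1)[of n] by (subst (asm) integrable_restrict_space) (auto simp: compact_imp_closed)
      then show ?thesis by (rule borel_measurable_integrable)
    qed
    show "(\<lambda>n. indicator (C n) x *\<^sub>R f x) \<longlonglongrightarrow> indicator \<Omega> x *\<^sub>R f x" for x
    proof (rule tendsto_eventually)
      show "\<forall>\<^sub>F n in sequentially. indicator (C n) x *\<^sub>R f x = indicator \<Omega> x *\<^sub>R f x"
      proof (cases "x \<in> \<Omega>")
        case True
        then obtain m where "x \<in> C m" using C(4) by blast
        then have "indicator (C n) x *\<^sub>R f x = indicator \<Omega> x *\<^sub>R f x" if "n \<ge> m" for n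
          using mono[OF that] True by (auto simp: indicator_def)
        then show ?thesis unfolding eventually_sequentially by blast
      next
        case False
        then have "x \<notin> C n" for n using C(2) by blast
        then show ?thesis using False by simp
      qed
    qed
  qed
  then show ?thesis by (subst borel_measurable_restrict_space_iff) auto
qed

lemma integrable_mult_test:
  fixes f :: "real ^ 'n \<Rightarrow> complex"
  assumes f: "locally_integrable \<Omega> f" and \<phi>: "\<phi> \<in> test_functions \<Omega>"
  shows "integrable M (\<lambda>x. f x * \<phi> x)"
proof -
  obtain K where K: "compact K" "K \<subseteq> \<Omega>" "\<And>x. x \<notin> K \<Longrightarrow> \<phi> x = 0" by (rule test_functionsE[OF \<phi>]) blast
  obtain B where B: "\<And>x. norm (\<phi> x) \<le> B" "0 \<le> B" by (rule test_functions_bounded[OF \<phi>]) blast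
  have "integrable (lebesgue_on K) f" using f K by (auto simp: locally_integrable_def)
  then have I: "integrable lebesgue (\<lambda>x. indicator K x *\<^sub>R f x)"
    using K(1) by (subst (asm) integrable_restrict_space) (auto simp: compact_imp_closed)
  have m\<phi>: "\<phi> \<in> borel_measurable lebesgue"
    using smooth_imp_continuous_on[OF test_functions_smooth[OF \<phi>]]
    by (intro measurable_completion) (auto intro: borel_measurable_continuous_onI)
  have "integrable lebesgue (\<lambda>x. (indicator K x *\<^sub>R f x) * \<phi> x)"
  proof (rule Bochner_Integration.integrable_bound)
    show "integrable lebesgue (\<lambda>x. B *\<^sub>R (indicator K x *\<^sub>R f x))" using I by (rule integrable_scaleR_right)
    show "(\<lambda>x. (indicator K x *\<^sub>R f x) * \<phi> x) \<in> borel_measurable lebesgue"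
      using borel_measurable_integrable[OF I] m\<phi> by (rule borel_measurable_times)
    show "AE x in lebesgue. norm (indicat_real K x *\<^sub>R f x * \<phi> x) \<le> norm (B *\<^sub>R (indicat_real K x *\<^sub>R f x))"
    proof (rule AE_I2)
      fix x
      show "norm (indicat_real K x *\<^sub>R f x * \<phi> x) \<le> norm (B *\<^sub>R (indicat_real K x *\<^sub>R f x))"
        using mult_left_mono[OF B(1)[of x] norm_ge_zero[of "indicat_real K x *\<^sub>R f x"]] B(2)
        by (simp only: norm_mult norm_scaleR abs_of_nonneg mult.commute[of B] )
    qed
  qed
  also have "(\<lambda>x. (indicat_real K x *\<^sub>R f x) * \<phi> x) = (\<lambda>x. indicator \<Omega> x *\<^sub>R (f x * \<phi> x))"
    using K by (auto simp: indicator_def fun_eq_iff)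
  finally show ?thesis unfolding integrable_M_iff .
qed

section \<open>Calculus of weak gradients\<close>

lemma locally_integrable_bounded_linear:
  assumes "bounded_linear T" "locally_integrable \<Omega> f"
  shows "locally_integrable \<Omega> (\<lambda>x. T (f x))"
  using assms by (auto simp: locally_integrable_def intro: integrable_bounded_linear)

lemma locally_integrable_add:
  assumes "locally_integrable \<Omega> f" "locally_integrable \<Omega> g"
  shows "locally_integrable \<Omega> (\<lambda>x. f x + g x)"
  using assms by (auto simp: locally_integrable_def)

lemma locally_integrable_diff:
  assumes "locally_integrable \<Omega> f" "locally_integrable \<Omega> g"
  shows "locally_integrable \<Omega> (\<lambda>x. f x - g x)"
  using assms by (auto simp: locally_integrable_def)

lemma locally_integrable_nth:
  fixes G :: "real ^ 'n \<Rightarrow> complex ^ 'n"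
  shows "locally_integrable \<Omega> G \<Longrightarrow> locally_integrable \<Omega> (\<lambda>x. G x $ i)"
  by (rule locally_integrable_bounded_linear[OF bounded_linear_vec_nth])

text \<open>The fundamental lemma in each component. It makes the arbitrary choice in
  \<open>weak_grad\<close> harmless, since integrals do not see null sets.\<close>

lemma weak_gradient_unique:
  assumes "has_weak_gradient \<Omega> u G" "has_weak_gradient \<Omega> u H"
  shows "AE x in M. G x = H x"
proof -
  have G: "locally_integrable \<Omega> G" and H: "locally_integrable \<Omega> H" using assms by (auto simp: has_weak_gradient_def)
  have "AE x in M. G x $ i - H x $ i = 0" for i
  proof (rule test_integral_eq_0_imp_AE[OF \<Omega>_open])
    show "locally_integrable \<Omega> (\<lambda>x. G x $ i - H x $ i)"
      by (intro locally_integrable_diff locally_integrable_nth G H)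
    fix \<phi> assume \<phi>: "\<phi> \<in> test_functions \<Omega>"
    have "(LINT x|M. G x $ i * \<phi> x) = (LINT x|M. H x $ i * \<phi> x)"
    proof -
      have "- (LINT x|M. G x $ i * \<phi> x) = (LINT x|M. u x * partial_deriv i \<phi> x)"
        using assms(1) \<phi> unfolding has_weak_gradient_def by simp
      also have "\<dots> = - (LINT x|M. H x $ i * \<phi> x)"
        using assms(2) \<phi> unfolding has_weak_gradient_def by simp
      finally show ?thesis by simp
    qed
    then show "(LINT x|M. (G x $ i - H x $ i) * \<phi> x) = 0"
      using integrable_mult_test[OF locally_integrable_nth[OF G] \<phi>, of i] integrable_mult_test[OF locally_integrable_nth[OF H] \<phi>, of i]
      by (simp add: left_diff_distrib)
  qed
  then have "AE x in M. \<forall>i. G x $ i - H x $ i = 0" by (simp add: AE_all_countable)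
  then show ?thesis by eventually_elim (simp add: vec_eq_iff)
qed

lemma weak_grad:
  assumes "has_weak_gradient \<Omega> u G"
  shows "has_weak_gradient \<Omega> u (weak_grad \<Omega> u)" "AE x in M. weak_grad \<Omega> u x = G x"
proof -
  show *: "has_weak_gradient \<Omega> u (weak_grad \<Omega> u)" unfolding weak_grad_def by (rule someI[of "\<lambda>G. has_weak_gradient \<Omega> u G", OF assms])
  show "AE x in M. weak_grad \<Omega> u x = G x" by (rule weak_gradient_unique[OF * assms])
qed

lemma weak_gradient_smooth:
  assumes "smooth f" shows "has_weak_gradient \<Omega> f (cgrad f)"
  unfolding has_weak_gradient_def
  using integral_by_parts_test[OF assms _ \<Omega>_open] smooth_Lp[OF assms, THEN Lp_locally_integrable] by blast

lemma weak_gradient_add: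
  assumes "has_weak_gradient \<Omega> u G" "has_weak_gradient \<Omega> v H"
  shows "has_weak_gradient \<Omega> (\<lambda>x. u x + v x) (\<lambda>x. G x + H x)"
proof -
  have l: "locally_integrable \<Omega> u" "locally_integrable \<Omega> v" "locally_integrable \<Omega> G" "locally_integrable \<Omega> H"
    using assms by (auto simp: has_weak_gradient_def)
  have "(LINT x|M. (u x + v x) * partial_deriv i \<phi> x) = - (LINT x|M. (G x + H x) $ i * \<phi> x)"
    if \<phi>: "\<phi> \<in> test_functions \<Omega>" for \<phi> i
  proof -
    note I = integrable_mult_test[OF l(1) test_functions_partial_deriv[OF \<phi>], of i]
      integrable_mult_test[OF l(2) test_functions_partial_deriv[OF \<phi>], of i]
      integrable_mult_test[OF locally_integrable_nth[OF l(3)] \<phi>, of i]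
      integrable_mult_test[OF locally_integrable_nth[OF l(4)] \<phi>, of i]
    show ?thesis using assms \<phi> I unfolding has_weak_gradient_def by (simp add: distrib_right)
  qed
  then show ?thesis unfolding has_weak_gradient_def using l by (auto intro!: locally_integrable_add)
qed

lemma weak_gradient_cmult:
  assumes "has_weak_gradient \<Omega> u G"
  shows "has_weak_gradient \<Omega> (\<lambda>x. a * u x) (\<lambda>x. a *s G x)"
proof -
  have l: "locally_integrable \<Omega> u" "locally_integrable \<Omega> G" using assms by (auto simp: has_weak_gradient_def)
  then show ?thesis using assms
    unfolding has_weak_gradient_def
    by (auto simp: mult.assoc intro!: locally_integrable_bounded_linear[OF bounded_linear_mult_right]
        locally_integrable_bounded_linear[OF bounded_linear_smult])
qed

lemma weak_gradient_diff:
  assumes "has_weak_gradient \<Omega> u G" "has_weak_gradient \<Omega> v H"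
  shows "has_weak_gradient \<Omega> (\<lambda>x. u x - v x) (\<lambda>x. G x - H x)"
  using weak_gradient_add[OF assms(1) weak_gradient_cmult[OF assms(2), of "-1"]]
  by (simp add: vector_sneg_minus1[symmetric])

text \<open>Conjugation commutes with real differentiation: insert the conjugate test function and
  conjugate the identity.\<close>

lemma weak_gradient_cnj:
  assumes "has_weak_gradient \<Omega> u G"
  shows "has_weak_gradient \<Omega> (\<lambda>x. cnj (u x)) (\<lambda>x. vcnj (G x))"
proof -
  have l: "locally_integrable \<Omega> u" "locally_integrable \<Omega> G" using assms by (auto simp: has_weak_gradient_def)
  have "(LINT x|M. cnj (u x) * partial_deriv i \<phi> x) = - (LINT x|M. vcnj (G x) $ i * \<phi> x)"
    if \<phi>: "\<phi> \<in> test_functions \<Omega>" for \<phi> i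
  proof -
    have "(LINT x|M. u x * partial_deriv i (\<lambda>x. cnj (\<phi> x)) x) = - (LINT x|M. G x $ i * cnj (\<phi> x))"
      using assms test_functions_cnj[OF \<phi>] unfolding has_weak_gradient_def by blast
    moreover have "partial_deriv i (\<lambda>x. cnj (\<phi> x)) x = cnj (partial_deriv i \<phi> x)" for x
      using arg_cong[OF cgrad_cnj_vcnj[OF test_functions_smooth[OF \<phi>], of x], of "\<lambda>z. z $ i"] by simp
    ultimately have "cnj (LINT x|M. u x * cnj (partial_deriv i \<phi> x)) = cnj (- (LINT x|M. G x $ i * cnj (\<phi> x)))"
      by simp
    then have "(LINT x|M. cnj (u x * cnj (partial_deriv i \<phi> x))) = - (LINT x|M. cnj (G x $ i * cnj (\<phi> x)))"
      by (simp only: complex_cnj_minus Bochner_Integration.integral_cnj)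
    then show ?thesis by simp
  qed
  moreover have "locally_integrable \<Omega> (\<lambda>x. cnj (u x))" "locally_integrable \<Omega> (\<lambda>x. vcnj (G x))"
    using l by (auto intro: locally_integrable_bounded_linear bounded_linear_cnj bounded_linear_vcnj)
  ultimately show ?thesis unfolding has_weak_gradient_def by blast
qed

text \<open>On bounded \<Omega> convergence in the p-th mean gives convergence in L1, and test
  functions are bounded.\<close>

lemma Lp_limit_test:
  fixes f :: "nat \<Rightarrow> real ^ 'n \<Rightarrow> complex"
  assumes f: "\<And>k. f k \<in> Lp M p" and g: "g \<in> Lp M p" and \<phi>: "\<phi> \<in> test_functions \<Omega>"
    and lim: "(\<lambda>k. LINT x|M. norm (g x - f k x) powr p) \<longlonglongrightarrow> 0"
  shows "(\<lambda>k. LINT x|M. f k x * \<phi> x) \<longlonglongrightarrow> (LINT x|M. g x * \<phi> x)"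
proof -
  obtain B where B: "\<And>x. norm (\<phi> x) \<le> B" "0 \<le> B" by (rule test_functions_bounded[OF \<phi>]) blast
  have d: "(\<lambda>x. g x - f k x) \<in> Lp M p" for k by (rule Lp_diff(1)[OF g f p_nonneg(1)])
  have int: "integrable M (\<lambda>x. norm (g x - f k x))" for k
    using Lp_integrable(1)[OF d finite_measure_M p_nonneg(2)] by (rule integrable_norm)
  have L1: "(\<lambda>k. LINT x|M. norm (g x - f k x)) \<longlonglongrightarrow> 0"
    by (rule Lp_null_imp_L1_null[OF d finite_measure_M p_nonneg(2) lim])
  have bound: "norm ((LINT x|M. f k x * \<phi> x) - (LINT x|M. g x * \<phi> x)) \<le> (LINT x|M. norm (g x - f k x)) * B" for k
  proof -
    note I = integrable_mult_test[OF Lp_locally_integrable[OF f] \<phi>, of k]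
      integrable_mult_test[OF Lp_locally_integrable[OF g] \<phi>]
    have "(LINT x|M. f k x * \<phi> x) - (LINT x|M. g x * \<phi> x) = (LINT x|M. f k x * \<phi> x - g x * \<phi> x)"
      using I by simp
    also have "norm \<dots> \<le> (LINT x|M. norm (f k x * \<phi> x - g x * \<phi> x))" by (rule integral_norm_bound)
    also have "\<dots> \<le> (LINT x|M. norm (g x - f k x) * B)"
    proof (rule integral_mono)
      show "integrable M (\<lambda>x. norm (f k x * \<phi> x - g x * \<phi> x))"
        using I by (intro integrable_norm Bochner_Integration.integrable_diff)
      show "integrable M (\<lambda>x. norm (g x - f k x) * B)" using int by (rule integrable_mult_left)
      fix x
      have "norm (f k x * \<phi> x - g x * \<phi> x) = norm (g x - f k x) * norm (\<phi> x)"
        by (simp add: left_diff_distrib[symmetric] norm_mult norm_minus_commute)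
      then show "norm (f k x * \<phi> x - g x * \<phi> x) \<le> norm (g x - f k x) * B"
        using B by (simp add: mult_left_mono)
    qed
    finally show ?thesis by simp
  qed
  have "(\<lambda>k. (LINT x|M. norm (g x - f k x)) * B) \<longlonglongrightarrow> 0" using tendsto_mult_right[OF L1, of B] by simp
  then have "(\<lambda>k. (LINT x|M. f k x * \<phi> x) - (LINT x|M. g x * \<phi> x)) \<longlonglongrightarrow> 0"
    by (rule Lim_null_comparison[rotated]) (use bound in auto)
  then show ?thesis by (rule LIM_zero_cancel)
qed

subsection \<open>The closure of the test functions\<close>

text \<open>Membership in \<open>W1p_0\<close> together with a named gradient, witnessed by one
  sequence of test functions. \<open>W1p_0\<close> itself measures distances through the chosen
  \<open>weak_grad\<close>, which is inconvenient for sums, multiples and conjugates;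
  \<open>W0_lim_W1p_0\<close> and \<open>W1p_0_W0_lim\<close> match the two notions.\<close>

definition W0_lim :: "(real ^ 'n \<Rightarrow> complex) \<Rightarrow> (real ^ 'n \<Rightarrow> complex ^ 'n) \<Rightarrow> bool" where
  "W0_lim u G \<longleftrightarrow> u \<in> Lp M p \<and> G \<in> Lp M p \<and>
     (\<exists>\<phi>. (\<forall>k::nat. \<phi> k \<in> test_functions \<Omega>) \<and>
        (\<lambda>k. LINT x|M. norm (u x - \<phi> k x) powr p) \<longlonglongrightarrow> 0 \<and>
        (\<lambda>k. LINT x|M. norm (G x - cgrad (\<phi> k) x) powr p) \<longlonglongrightarrow> 0)"

lemma Lp_nth:
  fixes G :: "real ^ 'n \<Rightarrow> complex ^ 'n"
  assumes "G \<in> Lp M p"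
  shows "(\<lambda>x. G x $ i) \<in> Lp M p" "(LINT x|M. norm (G x $ i) powr p) \<le> (LINT x|M. norm (G x) powr p)"
proof -
  have "(\<lambda>x. G x $ i) \<in> borel_measurable M"
    using LpD(1)[OF assms] by (rule borel_measurable_bounded_linear[OF bounded_linear_vec_nth])
  moreover have "norm (G x $ i) \<le> 1 * norm (G x)" for x
    using Finite_Cartesian_Product.norm_nth_le[of "G x" i] by simp
  ultimately have "(\<lambda>x. G x $ i) \<in> Lp M p \<and>
      (LINT x|M. norm (G x $ i) powr p) \<le> 1 powr p * (LINT x|M. norm (G x) powr p)"
    using Lp_bound[OF assms, of "\<lambda>x. G x $ i" 1] p_nonneg by auto
  then
  show "(\<lambda>x. G x $ i) \<in> Lp M p" "(LINT x|M. norm (G x $ i) powr p) \<le> (LINT x|M. norm (G x) powr p)"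
    by simp_all
qed

lemma W0_lim_weak_gradient:
  assumes "W0_lim u G" shows "has_weak_gradient \<Omega> u G"
proof -
  obtain \<phi> where u: "u \<in> Lp M p" and G: "G \<in> Lp M p" and \<phi>: "\<And>k::nat. \<phi> k \<in> test_functions \<Omega>"
    "(\<lambda>k. LINT x|M. norm (u x - \<phi> k x) powr p) \<longlonglongrightarrow> 0"
    "(\<lambda>k. LINT x|M. norm (G x - cgrad (\<phi> k) x) powr p) \<longlonglongrightarrow> 0"
    using assms unfolding W0_lim_def by blast
  note sm = test_functions_smooth[OF \<phi>(1)]
  have "(LINT x|M. u x * partial_deriv i \<psi> x) = - (LINT x|M. G x $ i * \<psi> x)"
    if \<psi>: "\<psi> \<in> test_functions \<Omega>" for \<psi> i
  proof -
    have 1: "(\<lambda>k. LINT x|M. \<phi> k x * partial_deriv i \<psi> x) \<longlonglongrightarrow> (LINT x|M. u x * partial_deriv i \<psi> x)"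
      by (rule Lp_limit_test[OF smooth_Lp(1)[OF sm] u test_functions_partial_deriv[OF \<psi>] \<phi>(2)])
    have "(\<lambda>k. LINT x|M. norm (G x $ i - cgrad (\<phi> k) x $ i) powr p) \<longlonglongrightarrow> 0"
    proof (rule Lim_null_comparison[OF _ \<phi>(3)], rule always_eventually, rule allI)
      fix k
      have d: "(\<lambda>x. G x - cgrad (\<phi> k) x) \<in> Lp M p" by (rule Lp_diff(1)[OF G smooth_Lp(2)[OF sm] p_nonneg(1)])
      show "norm (LINT x|M. norm (G x $ i - cgrad (\<phi> k) x $ i) powr p) \<le> (LINT x|M. norm (G x - cgrad (\<phi> k) x) powr p)"
        using Lp_nth(2)[OF d, of i] by (simp add: Bochner_Integration.integral_nonneg del: cgrad_nth)
    qed
    then have 2: "(\<lambda>k. LINT x|M. cgrad (\<phi> k) x $ i * \<psi> x) \<longlonglongrightarrow> (LINT x|M. G x $ i * \<psi> x)"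
      by (intro Lp_limit_test \<psi> Lp_nth G smooth_Lp sm)
    have "(LINT x|M. \<phi> k x * partial_deriv i \<psi> x) = - (LINT x|M. cgrad (\<phi> k) x $ i * \<psi> x)" for k
      by (rule integral_by_parts_test[OF sm \<psi> \<Omega>_open])
    then have "(\<lambda>k. LINT x|M. \<phi> k x * partial_deriv i \<psi> x) \<longlonglongrightarrow> - (LINT x|M. G x $ i * \<psi> x)"
      using tendsto_minus[OF 2] by simp
    then show ?thesis by (rule LIMSEQ_unique[OF 1])
  qed
  then show ?thesis unfolding has_weak_gradient_def using u G by (blast intro: Lp_locally_integrable[OF u] Lp_locally_integrable[OF G])
qed

lemma W1p_norm_eq:
  assumes "has_weak_gradient \<Omega> u G"
  shows "W1p_norm \<Omega> p u = ((LINT x|M. norm (u x) powr p) + (LINT x|M. norm (G x) powr p)) powr (1 / p)"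
proof -
  have "G \<in> borel_measurable M" "weak_grad \<Omega> u \<in> borel_measurable M"
    using assms weak_grad(1)[OF assms] by (auto simp: has_weak_gradient_def intro: locally_integrable_measurable)
  then have m: "(\<lambda>x. norm (G x) powr p) \<in> borel_measurable M" "(\<lambda>x. norm (weak_grad \<Omega> u x) powr p) \<in> borel_measurable M"
    by measurable
  have "(LINT x|M. norm (weak_grad \<Omega> u x) powr p) = (LINT x|M. norm (G x) powr p)"
    using weak_grad(2)[OF assms] by (intro integral_cong_AE m) auto
  then show ?thesis by (simp add: W1p_norm_def)
qed

lemma W1p_iff: "u \<in> W1p \<Omega> p \<longleftrightarrow> u \<in> Lp M p \<and> (\<exists>G. has_weak_gradient \<Omega> u G \<and> G \<in> Lp M p)"
  by (simp add: W1p_def Lp_space_eq)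

lemma W1p_weak_grad:
  assumes "u \<in> W1p \<Omega> p"
  shows "u \<in> Lp M p" "has_weak_gradient \<Omega> u (weak_grad \<Omega> u)" "weak_grad \<Omega> u \<in> Lp M p"
proof -
  obtain G where G: "u \<in> Lp M p" "has_weak_gradient \<Omega> u G" "G \<in> Lp M p" using assms by (auto simp: W1p_iff)
  note w = weak_grad[OF G(2)]
  have m: "weak_grad \<Omega> u \<in> borel_measurable M" using w(1) by (simp add: has_weak_gradient_def locally_integrable_measurable)
  have "integrable M (\<lambda>x. norm (weak_grad \<Omega> u x) powr p) = integrable M (\<lambda>x. norm (G x) powr p)"
    using LpD[OF G(3)] m w(2) by (intro integrable_cong_AE) (auto)
  with G m w(1) show "u \<in> Lp M p" "has_weak_gradient \<Omega> u (weak_grad \<Omega> u)" "weak_grad \<Omega> u \<in> Lp M p"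
    by (auto simp: Lp_def)
qed

lemma W0_lim_W1p_0:
  assumes "W0_lim u G" shows "u \<in> W1p_0 \<Omega> p"
proof -
  obtain \<phi> where u: "u \<in> Lp M p" and G: "G \<in> Lp M p" and \<phi>: "\<And>k::nat. \<phi> k \<in> test_functions \<Omega>"
    "(\<lambda>k. LINT x|M. norm (u x - \<phi> k x) powr p) \<longlonglongrightarrow> 0"
    "(\<lambda>k. LINT x|M. norm (G x - cgrad (\<phi> k) x) powr p) \<longlonglongrightarrow> 0"
    using assms unfolding W0_lim_def by blast
  note uG = W0_lim_weak_gradient[OF assms]
  have "\<exists>\<psi>\<in>test_functions \<Omega>. W1p_norm \<Omega> p (\<lambda>x. u x - \<psi> x) < \<epsilon>" if \<epsilon>: "0 < \<epsilon>" for \<epsilon>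
  proof -
    let ?s = "\<lambda>k. (LINT x|M. norm (u x - \<phi> k x) powr p) + (LINT x|M. norm (G x - cgrad (\<phi> k) x) powr p)"
    have "?s \<longlonglongrightarrow> 0" using tendsto_add[OF \<phi>(2,3)] by simp
    then obtain k where k: "norm (?s k - 0) < \<epsilon> powr p" using LIMSEQ_D[of ?s 0 "\<epsilon> powr p"] \<epsilon> by fastforce
    have s0: "0 \<le> ?s k" by (intro add_nonneg_nonneg Bochner_Integration.integral_nonneg) auto
    have "W1p_norm \<Omega> p (\<lambda>x. u x - \<phi> k x) = ?s k powr (1 / p)"
      by (intro W1p_norm_eq weak_gradient_diff uG weak_gradient_smooth test_functions_smooth[OF \<phi>(1)])
    also have "\<dots> < (\<epsilon> powr p) powr (1 / p)" using k s0 p_gt_1 by (intro powr_less_mono2) auto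
    also have "\<dots> = \<epsilon>" using \<epsilon> p_gt_1 by (simp add: powr_powr)
    finally show ?thesis using \<phi>(1) by blast
  qed
  then show ?thesis using u G uG by (auto simp: W1p_0_def W1p_iff)
qed

lemma W1p_0_W0_lim:
  assumes "u \<in> W1p_0 \<Omega> p" shows "W0_lim u (weak_grad \<Omega> u)"
proof -
  have u: "u \<in> W1p \<Omega> p" and ap: "\<And>\<epsilon>. 0 < \<epsilon> \<Longrightarrow> \<exists>\<phi>\<in>test_functions \<Omega>. W1p_norm \<Omega> p (\<lambda>x. u x - \<phi> x) < \<epsilon>"
    using assms by (auto simp: W1p_0_def)
  note w = W1p_weak_grad[OF u]
  \<comment> \<open>The root in the threshold undoes the one in \<open>W1p_norm\<close>, so the
    integrals themselves are bounded by a null sequence.\<close>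
  have "\<forall>k::nat. \<exists>\<phi>\<in>test_functions \<Omega>. W1p_norm \<Omega> p (\<lambda>x. u x - \<phi> x) < inverse (real (Suc k)) powr (1 / p)"
    using ap by simp
  then obtain \<phi> where \<phi>: "\<And>k. \<phi> k \<in> test_functions \<Omega>"
    "\<And>k::nat. W1p_norm \<Omega> p (\<lambda>x. u x - \<phi> k x) < inverse (real (Suc k)) powr (1 / p)" by metis
  define A where "A k = (LINT x|M. norm (u x - \<phi> k x) powr p)" for k
  define B where "B k = (LINT x|M. norm (weak_grad \<Omega> u x - cgrad (\<phi> k) x) powr p)" for k
  have AB: "0 \<le> A k" "0 \<le> B k" for k unfolding A_def B_def by (intro Bochner_Integration.integral_nonneg; simp)+
  have lt: "A k + B k \<le> inverse (real (Suc k))" for k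
  proof -
    have "(A k + B k) powr (1 / p) = W1p_norm \<Omega> p (\<lambda>x. u x - \<phi> k x)"
      unfolding A_def B_def
      by (intro W1p_norm_eq[symmetric] weak_gradient_diff w(2) weak_gradient_smooth test_functions_smooth[OF \<phi>(1)])
    then have "(A k + B k) powr (1 / p) < inverse (real (Suc k)) powr (1 / p)" using \<phi>(2)[of k] by simp
    moreover have "inverse (real (Suc k)) powr (1 / p) \<le> (A k + B k) powr (1 / p)" if "inverse (real (Suc k)) \<le> A k + B k"
      using that p_gt_1 by (intro powr_mono2) auto
    ultimately show ?thesis by linarith
  qed
  have "A \<longlonglongrightarrow> 0" "B \<longlonglongrightarrow> 0"
    by (rule Lim_null_comparison[OF _ LIMSEQ_inverse_real_of_nat], rule always_eventually, rule allI,
        use lt AB in \<open>smt (verit) real_norm_def\<close>)+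
  then show ?thesis unfolding W0_lim_def A_def B_def using w \<phi>(1) by blast
qed

lemma Lp_null_bound:
  fixes f :: "nat \<Rightarrow> real ^ 'n \<Rightarrow> 'b::euclidean_space" and g :: "nat \<Rightarrow> real ^ 'n \<Rightarrow> 'c::euclidean_space"
  assumes f: "\<And>k. f k \<in> Lp M p" and g: "\<And>k. g k \<in> borel_measurable M"
    and le: "\<And>k x. norm (g k x) \<le> C * norm (f k x)" and "0 \<le> C"
    and lim: "(\<lambda>k. LINT x|M. norm (f k x) powr p) \<longlonglongrightarrow> 0"
  shows "(\<lambda>k. LINT x|M. norm (g k x) powr p) \<longlonglongrightarrow> 0"
proof (rule Lim_null_comparison)
  show "(\<lambda>k. C powr p * (LINT x|M. norm (f k x) powr p)) \<longlonglongrightarrow> 0"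
    using tendsto_mult_left[OF lim, of "C powr p"] by simp
  show "\<forall>\<^sub>F k in sequentially. norm (LINT x|M. norm (g k x) powr p) \<le> C powr p * (LINT x|M. norm (f k x) powr p)"
    using Lp_bound(2)[OF f g le p_nonneg(1) \<open>0 \<le> C\<close>]
    by (simp add: Bochner_Integration.integral_nonneg)
qed

lemma Lp_null_add:
  fixes f g :: "nat \<Rightarrow> real ^ 'n \<Rightarrow> 'b::euclidean_space"
  assumes f: "\<And>k. f k \<in> Lp M p" and g: "\<And>k. g k \<in> Lp M p"
    and "(\<lambda>k. LINT x|M. norm (f k x) powr p) \<longlonglongrightarrow> 0" "(\<lambda>k. LINT x|M. norm (g k x) powr p) \<longlonglongrightarrow> 0"
  shows "(\<lambda>k. LINT x|M. norm (f k x + g k x) powr p) \<longlonglongrightarrow> 0"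
proof (rule Lim_null_comparison)
  show "(\<lambda>k. 2 powr p * ((LINT x|M. norm (f k x) powr p) + (LINT x|M. norm (g k x) powr p))) \<longlonglongrightarrow> 0"
    using tendsto_mult_left[OF tendsto_add[OF assms(3,4)], of "2 powr p"] by simp
  show "\<forall>\<^sub>F k in sequentially. norm (LINT x|M. norm (f k x + g k x) powr p) \<le>
     2 powr p * ((LINT x|M. norm (f k x) powr p) + (LINT x|M. norm (g k x) powr p))"
    using Lp_add(2)[OF f g p_nonneg(1)]
    by (simp add: Bochner_Integration.integral_nonneg)
qed

lemma W0_lim_test:
  assumes "\<phi> \<in> test_functions \<Omega>" shows "W0_lim \<phi> (cgrad \<phi>)"
  unfolding W0_lim_def
  using smooth_Lp[OF test_functions_smooth[OF assms]] assms p_gt_1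
  by (intro conjI exI[of _ "\<lambda>k. \<phi>"]) simp_all

lemma W0_lim_add:
  assumes "W0_lim u G" "W0_lim v H"
  shows "W0_lim (\<lambda>x. u x + v x) (\<lambda>x. G x + H x)"
proof -
  obtain \<phi> where u: "u \<in> Lp M p" "G \<in> Lp M p" and \<phi>: "\<And>k::nat. \<phi> k \<in> test_functions \<Omega>"
    "(\<lambda>k. LINT x|M. norm (u x - \<phi> k x) powr p) \<longlonglongrightarrow> 0"
    "(\<lambda>k. LINT x|M. norm (G x - cgrad (\<phi> k) x) powr p) \<longlonglongrightarrow> 0"
    using assms(1) unfolding W0_lim_def by blast
  obtain \<psi> where v: "v \<in> Lp M p" "H \<in> Lp M p" and \<psi>: "\<And>k::nat. \<psi> k \<in> test_functions \<Omega>"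
    "(\<lambda>k. LINT x|M. norm (v x - \<psi> k x) powr p) \<longlonglongrightarrow> 0"
    "(\<lambda>k. LINT x|M. norm (H x - cgrad (\<psi> k) x) powr p) \<longlonglongrightarrow> 0"
    using assms(2) unfolding W0_lim_def by blast
  note sm = test_functions_smooth[OF \<phi>(1)] test_functions_smooth[OF \<psi>(1)]
  have "(\<lambda>k. LINT x|M. norm ((u x - \<phi> k x) + (v x - \<psi> k x)) powr p) \<longlonglongrightarrow> 0"
    by (intro Lp_null_add \<phi> \<psi> Lp_diff(1)[OF _ _ p_nonneg(1)] u v smooth_Lp sm)
  moreover have "(\<lambda>k. LINT x|M. norm ((G x - cgrad (\<phi> k) x) + (H x - cgrad (\<psi> k) x)) powr p) \<longlonglongrightarrow> 0"
    by (intro Lp_null_add \<phi> \<psi> Lp_diff(1)[OF _ _ p_nonneg(1)] u v smooth_Lp sm)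
  ultimately show ?thesis unfolding W0_lim_def
    using u v p_nonneg
    by (intro conjI exI[of _ "\<lambda>k x. \<phi> k x + \<psi> k x"] allI test_functions_add \<phi>(1) \<psi>(1))
       (simp_all add: Lp_add(1) cgrad_add[OF sm] algebra_simps)
qed

lemma W0_lim_cmult:
  assumes "W0_lim u G" shows "W0_lim (\<lambda>x. a * u x) (\<lambda>x. a *s G x)"
proof -
  obtain \<phi> where u: "u \<in> Lp M p" "G \<in> Lp M p" and \<phi>: "\<And>k::nat. \<phi> k \<in> test_functions \<Omega>"
    "(\<lambda>k. LINT x|M. norm (u x - \<phi> k x) powr p) \<longlonglongrightarrow> 0"
    "(\<lambda>k. LINT x|M. norm (G x - cgrad (\<phi> k) x) powr p) \<longlonglongrightarrow> 0"
    using assms(1) unfolding W0_lim_def by blast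
  note sm = test_functions_smooth[OF \<phi>(1)]
  have ms: "(\<lambda>x. a *s F x) \<in> borel_measurable M" if "F \<in> borel_measurable M" for F :: "real ^ 'n \<Rightarrow> complex ^ 'n"
    by (rule borel_measurable_bounded_linear[OF bounded_linear_smult that])
  have L1: "(\<lambda>x. a * f x) \<in> Lp M p" if "f \<in> Lp M p" for f :: "real ^ 'n \<Rightarrow> complex"
    using LpD(1)[OF that] p_nonneg by (intro Lp_bound(1)[OF that, of _ "norm a"]) (auto simp: norm_mult)
  have L2: "(\<lambda>x. a *s f x) \<in> Lp M p" if "f \<in> Lp M p" for f :: "real ^ 'n \<Rightarrow> complex ^ 'n"
    using ms[OF LpD(1)[OF that]] p_nonneg by (intro Lp_bound(1)[OF that, of _ "norm a"]) (auto simp: norm_vector_smult)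
  have "(\<lambda>k. LINT x|M. norm (a * (u x - \<phi> k x)) powr p) \<longlonglongrightarrow> 0"
    by (rule Lp_null_bound[OF Lp_diff(1)[OF u(1) smooth_Lp(1)[OF sm] p_nonneg(1)] _ _ _ \<phi>(2), of _ "norm a"])
       (use LpD(1)[OF L1[OF Lp_diff(1)[OF u(1) smooth_Lp(1)[OF sm] p_nonneg(1)]]] in \<open>auto simp: norm_mult\<close>)
  moreover have "(\<lambda>k. LINT x|M. norm (a *s (G x - cgrad (\<phi> k) x)) powr p) \<longlonglongrightarrow> 0"
    by (rule Lp_null_bound[OF Lp_diff(1)[OF u(2) smooth_Lp(2)[OF sm] p_nonneg(1)] _ _ _ \<phi>(3), of _ "norm a"])
       (rule LpD(1)[OF L2[OF Lp_diff(1)[OF u(2) smooth_Lp(2)[OF sm] p_nonneg(1)]]], simp_all only: norm_vector_smult order_refl norm_ge_zero)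
  moreover have "a *s (z - w) = a *s z - a *s w" for z w :: "complex ^ 'n" by (simp add: vec_eq_iff right_diff_distrib)
  ultimately show ?thesis unfolding W0_lim_def
    by (intro conjI exI[of _ "\<lambda>k x. a * \<phi> k x"] allI test_functions_cmult \<phi>(1) L1 L2 u)
       (simp_all add: cgrad_cmult[OF sm] right_diff_distrib)
qed

lemma W0_lim_cnj:
  assumes "W0_lim u G" shows "W0_lim (\<lambda>x. cnj (u x)) (\<lambda>x. vcnj (G x))"
proof -
  obtain \<phi> where u: "u \<in> Lp M p" "G \<in> Lp M p" and \<phi>: "\<And>k::nat. \<phi> k \<in> test_functions \<Omega>"
    "(\<lambda>k. LINT x|M. norm (u x - \<phi> k x) powr p) \<longlonglongrightarrow> 0"
    "(\<lambda>k. LINT x|M. norm (G x - cgrad (\<phi> k) x) powr p) \<longlonglongrightarrow> 0"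
    using assms(1) unfolding W0_lim_def by blast
  note sm = test_functions_smooth[OF \<phi>(1)]
  have L1: "(\<lambda>x. cnj (f x)) \<in> Lp M p" if "f \<in> Lp M p" for f :: "real ^ 'n \<Rightarrow> complex"
    using borel_measurable_bounded_linear[OF bounded_linear_cnj LpD(1)[OF that]] p_nonneg
    by (intro Lp_bound(1)[OF that, of _ 1]) auto
  have L2: "(\<lambda>x. vcnj (f x)) \<in> Lp M p" if "f \<in> Lp M p" for f :: "real ^ 'n \<Rightarrow> complex ^ 'n"
    using borel_measurable_bounded_linear[OF bounded_linear_vcnj LpD(1)[OF that]] p_nonneg
    by (intro Lp_bound(1)[OF that, of _ 1]) auto
  have "norm (cnj (u x) - cnj (\<phi> k x)) = norm (u x - \<phi> k x)" for k x
    by (metis complex_cnj_diff complex_mod_cnj)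
  moreover have "norm (vcnj (G x) - vcnj (cgrad (\<phi> k) x)) = norm (G x - cgrad (\<phi> k) x)" for k x
    by (metis vcnj_diff norm_vcnj)
  ultimately show ?thesis unfolding W0_lim_def using \<phi>
    by (intro conjI exI[of _ "\<lambda>k x. cnj (\<phi> k x)"] allI test_functions_cnj \<phi>(1) L1 L2 u)
       (simp_all add: cgrad_cnj_vcnj[OF sm])
qed

lemma W1p_0_add: "u \<in> W1p_0 \<Omega> p \<Longrightarrow> v \<in> W1p_0 \<Omega> p \<Longrightarrow> (\<lambda>x. u x + v x) \<in> W1p_0 \<Omega> p"
  by (blast intro: W0_lim_W1p_0 W0_lim_add W1p_0_W0_lim)

lemma W1p_0_cmult: "u \<in> W1p_0 \<Omega> p \<Longrightarrow> (\<lambda>x. a * u x) \<in> W1p_0 \<Omega> p"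
  by (blast intro: W0_lim_W1p_0 W0_lim_cmult W1p_0_W0_lim)

lemma W1p_0_cnj: "u \<in> W1p_0 \<Omega> p \<Longrightarrow> (\<lambda>x. cnj (u x)) \<in> W1p_0 \<Omega> p"
  by (blast intro: W0_lim_W1p_0 W0_lim_cnj W1p_0_W0_lim)

lemma W1p_0_diff: "u \<in> W1p_0 \<Omega> p \<Longrightarrow> v \<in> W1p_0 \<Omega> p \<Longrightarrow> (\<lambda>x. u x - v x) \<in> W1p_0 \<Omega> p"
  using W1p_0_add[OF _ W1p_0_cmult[of v "-1"]] by simp

lemma test_functions_W1p_0: "\<phi> \<in> test_functions \<Omega> \<Longrightarrow> \<phi> \<in> W1p_0 \<Omega> p"
  by (rule W0_lim_W1p_0[OF W0_lim_test])

lemma smooth_W1p: "smooth f \<Longrightarrow> f \<in> W1p \<Omega> p"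
  using smooth_Lp weak_gradient_smooth by (auto simp: W1p_iff)

end

section \<open>Weak solutions as energy minimisers\<close>

text \<open>Young's inequality with a parameter, by cases on b <= \<delta> a; the split gives
  unsharp but explicit constants.\<close>

lemma powr_mult_le_add:
  fixes a b \<delta> p :: real
  assumes "1 < p" "0 \<le> a" "0 \<le> b" "0 < \<delta>"
  shows "a powr (p - 1) * b \<le> \<delta> * a powr p + \<delta> powr (1 - p) * b powr p"
proof (cases "b \<le> \<delta> * a")
  case True
  have "a powr (p - 1) * b \<le> a powr (p - 1) * (\<delta> * a)" using True by (intro mult_left_mono) auto
  also have "\<dots> = \<delta> * a powr p" using assms powr_mult_base[of a "p - 1"] by (simp add: mult_ac)
  finally show ?thesis by (simp add: add_increasing2)
next
  case False
  have "a \<le> b / \<delta>" using False assms by (simp add: field_simps)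
  then have "a powr (p - 1) \<le> (b / \<delta>) powr (p - 1)" using assms by (intro powr_mono2) auto
  then have "a powr (p - 1) * b \<le> (b / \<delta>) powr (p - 1) * b" using assms by (intro mult_right_mono) auto
  also have "\<dots> = \<delta> powr (1 - p) * (b * b powr (p - 1))"
    using assms by (simp add: powr_divide powr_diff)
  also have "b * b powr (p - 1) = b powr p" using assms powr_mult_base[of b "p - 1"] by simp
  finally show ?thesis using assms by (simp add: add_increasing)
qed

text \<open>The flux is, up to the factor p, the gradient of |z|^p, so this is convexity of that
  function. Cauchy-Schwarz reduces it to the scalar tangent; at z = 0 the flux is 0 and nothing
  remains to show.\<close>

lemma norm_powr_tangent_le:
  fixes z w :: "'a::real_inner"
  assumes p: "1 < p"
  shows "norm z powr p + p * ((norm z powr (p - 2) *\<^sub>R z) \<bullet> (w - z)) \<le> norm w powr p"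
proof (cases "z = 0")
  case False
  have pw: "norm z powr (p - 2) * norm z = norm z powr (p - 1)"
    using powr_mult_base[of "norm z" "p - 2"] by (simp add: mult.commute)
  have "z \<bullet> (w - z) \<le> norm z * (norm w - norm z)"
    using norm_cauchy_schwarz[of z w] by (simp add: inner_diff_right right_diff_distrib dot_square_norm power2_eq_square)
  then have "norm z powr (p - 2) * (z \<bullet> (w - z)) \<le> norm z powr (p - 2) * (norm z * (norm w - norm z))"
    by (rule mult_left_mono) simp
  also have "\<dots> = norm z powr (p - 1) * (norm w - norm z)" by (simp add: pw[symmetric])
  finally have "p * ((norm z powr (p - 2) *\<^sub>R z) \<bullet> (w - z)) \<le> p * (norm z powr (p - 1) * (norm w - norm z))"
    using p by (intro mult_left_mono) auto
  then show ?thesis using powr_tangent_le[OF p norm_ge_zero norm_ge_zero, of z w] by (simp add: mult.assoc)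
qed simp

lemma norm_powr_diff_le:
  fixes a b :: "'a::real_inner"
  assumes p: "1 < p"
  shows "norm a powr p - norm b powr p \<le> p * (norm a powr (p - 1) * norm (a - b))"
proof -
  have "norm a powr p + p * norm a powr (p - 1) * (norm b - norm a) \<le> norm b powr p"
    by (rule powr_tangent_le[OF p]) auto
  then have "norm a powr p - norm b powr p \<le> p * norm a powr (p - 1) * (norm a - norm b)"
    by (simp add: algebra_simps)
  also have "\<dots> \<le> p * norm a powr (p - 1) * norm (a - b)"
    using p by (intro mult_left_mono norm_triangle_ineq2) auto
  finally show ?thesis by (simp add: mult.assoc)
qed

text \<open>For continuity of the energy: the first term is a small fraction of a fixed energy, the
  second tends to zero along a convergent sequence.\<close>

lemma norm_powr_abs_diff_le:
  fixes p \<delta> :: real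
  assumes p: "1 < p" and \<delta>: "0 < \<delta>"
  obtains K where "0 \<le> K" "\<And>a b :: 'a::real_inner. \<bar>norm a powr p - norm b powr p\<bar> \<le> \<delta> * norm b powr p + K * norm (a - b) powr p"
proof -
  \<comment> \<open>Young's inequality produces \<eta> |a|^p, and |a|^p is at most 2^p (|b|^p + |a -
    b|^p); with this choice p \<eta> 2^p is exactly \<delta>.\<close>
  define \<eta> where "\<eta> = \<delta> / (p * 2 powr p)"
  define q where "q = (2::real) powr p"
  have q: "q \<ge> 1" using p by (simp add: q_def ge_one_powr_ge_zero)
  have \<eta>: "\<eta> > 0" using p \<delta> by (simp add: \<eta>_def)
  have \<eta>q: "p * (\<eta> * q) = \<delta>" using p q by (simp add: \<eta>_def q_def[symmetric])
  define L where "L = \<eta> powr (1 - p)"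
  have L: "L \<ge> 0" by (simp add: L_def)
  show ?thesis
  proof (rule that[of "\<delta> + p * L"])
    show "0 \<le> \<delta> + p * L" using p \<delta> L by simp
    fix a b :: 'a
    let ?A = "norm a powr p" and ?B = "norm b powr p" and ?D = "norm (a - b) powr p"
    have A: "?A \<le> q * (?B + ?D)"
      using norm_add_powr_le[of p b "a - b"] p by (simp add: q_def)
    have "?A - ?B \<le> p * (\<eta> * ?A + L * ?D)"
      unfolding L_def
      by (rule order_trans[OF norm_powr_diff_le[OF p] mult_left_mono[OF powr_mult_le_add[OF p norm_ge_zero norm_ge_zero \<eta>]]]) (use p in simp)
    also have "\<dots> \<le> p * (\<eta> * (q * (?B + ?D)) + L * ?D)"
      using A p \<eta> by (intro mult_left_mono add_right_mono) auto
    also have "\<dots> = p * (\<eta> * q) * ?B + (p * (\<eta> * q) + p * L) * ?D" by (simp add: algebra_simps)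
    finally have 1: "?A - ?B \<le> \<delta> * ?B + (\<delta> + p * L) * ?D" unfolding \<eta>q .
    have "?B - ?A \<le> p * (\<eta> * ?B + L * ?D)"
      unfolding L_def norm_minus_commute[of a b]
      by (rule order_trans[OF norm_powr_diff_le[OF p] mult_left_mono[OF powr_mult_le_add[OF p norm_ge_zero norm_ge_zero \<eta>]]]) (use p in simp)
    also have "\<dots> \<le> p * (\<eta> * (q * ?B) + L * ?D)"
      using q p \<eta> mult_right_mono[OF q, of ?B] by (intro mult_left_mono add_right_mono) auto
    also have "\<dots> = p * (\<eta> * q) * ?B + p * L * ?D" by (simp add: algebra_simps)
    also have "\<dots> \<le> \<delta> * ?B + (\<delta> + p * L) * ?D"
      unfolding \<eta>q using \<delta> by (intro add_left_mono mult_right_mono) auto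
    finally show "\<bar>?A - ?B\<bar> \<le> \<delta> * ?B + (\<delta> + p * L) * ?D" using 1 by linarith
  qed
qed

subsection \<open>The flux\<close>

lemma norm_cdot_le: "norm (cdot z w) \<le> norm z * norm w"
proof -
  have "norm (cdot z w) \<le> (\<Sum>j\<in>UNIV. \<bar>norm (z $ j)\<bar> * \<bar>norm (w $ j)\<bar>)"
    unfolding cdot_def by (intro sum_norm_le) (simp add: norm_mult)
  also have "\<dots> \<le> L2_set (\<lambda>j. norm (z $ j)) UNIV * L2_set (\<lambda>j. norm (w $ j)) UNIV"
    by (rule L2_set_mult_ineq)
  finally show ?thesis by (simp add: norm_vec_def)
qed

lemma Re_cdot_vcnj: "Re (cdot z (vcnj w)) = z \<bullet> w"
  by (simp add: cdot_def inner_vec_def Re_sum inner_complex_def)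

lemma cdot_smult: "cdot z (a *s w) = a * cdot z w"
  by (simp add: cdot_def sum_distrib_left mult_ac)

lemma cdot_diff: "cdot z (v - w) = cdot z v - cdot z w"
  by (simp add: cdot_def sum_subtractf right_diff_distrib)

lemma norm_flux:
  assumes "1 < p" shows "norm (flux p z) = norm z powr (p - 1)"
  using powr_mult_base[of "norm z" "p - 2"] by (simp add: flux_def mult.commute)

lemma cdot_flux_vcnj:
  assumes "1 < p" shows "cdot (flux p z) (vcnj z) = of_real (norm z powr p)"
proof -
  have "cdot z (vcnj z) = of_real ((norm z)\<^sup>2)"
    unfolding cdot_def norm_vec_def L2_set_def
    by (subst real_sqrt_pow2) (simp_all only: sum_nonneg zero_le_power2 of_real_sum vcnj_nth complex_norm_square)
  moreover have "cdot (flux p z) (vcnj z) = of_real (norm z powr (p - 2)) * cdot z (vcnj z)"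
    by (simp add: cdot_def flux_def sum_distrib_left scaleR_conv_of_real[where 'a = complex] mult_ac)
  moreover have "norm z powr (p - 2) * (norm z)\<^sup>2 = norm z powr p"
    using powr_mult_base[of "norm z" "p - 2"] powr_mult_base[of "norm z" "p - 1"]
    by (simp add: power2_eq_square mult_ac)
  ultimately show ?thesis by (metis of_real_mult)
qed

text \<open>For p < 2 the factor |z|^(p-2) blows up at 0, but the norm of the flux is |z|^(p-1),
  which tends to 0.\<close>

lemma continuous_on_flux:
  assumes p: "1 < p" shows "continuous_on UNIV (flux p :: complex ^ 'n \<Rightarrow> _)"
  unfolding continuous_on_eq_continuous_at[OF open_UNIV]
proof
  fix z :: "complex ^ 'n"
  show "isCont (flux p) z"
  proof (cases "z = 0")
    case True
    have "((\<lambda>w. norm (w :: complex ^ 'n) powr (p - 1)) \<longlongrightarrow> norm (0 :: complex ^ 'n) powr (p - 1)) (at 0)"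
      using p by (intro tendsto_powr' tendsto_norm tendsto_ident_at tendsto_const) auto
    then have "((\<lambda>w :: complex ^ 'n. norm (flux p w)) \<longlongrightarrow> 0) (at 0)" using p by (simp add: norm_flux)
    then have "(flux p \<longlongrightarrow> (0 :: complex ^ 'n)) (at 0)" by (rule tendsto_norm_zero_cancel)
    then show ?thesis using True by (simp add: isCont_def flux_def)
  next
    case False
    then show ?thesis unfolding flux_def
      by (intro continuous_intros) auto
  qed
qed

lemma borel_measurable_cdot_flux:
  assumes p: "1 < p" and G: "G \<in> borel_measurable N" and H: "H \<in> borel_measurable N"
  shows "(\<lambda>x. cdot (flux p (G x)) (H x)) \<in> borel_measurable N"
proof -
  have F: "(\<lambda>x. flux p (G x)) \<in> borel_measurable N"
    using measurable_compose[OF G borel_measurable_continuous_onI[OF continuous_on_flux[OF p]]] .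
  show ?thesis unfolding cdot_def
    by (intro borel_measurable_sum borel_measurable_times borel_measurable_bounded_linear[OF bounded_linear_vec_nth] F H)
qed

section \<open>The weighted energy and its first variation\<close>

locale weighted_domain = bounded_domain \<Omega> p for \<Omega> :: "(real ^ 'n) set" and p +
  fixes \<gamma> :: "real ^ 'n \<Rightarrow> real"
  assumes \<gamma>_cont: "continuous_on (closure \<Omega>) \<gamma>" and \<gamma>_pos: "\<And>x. x \<in> closure \<Omega> \<Longrightarrow> 0 < \<gamma> x"
begin

lemma \<gamma>_bounds:
  obtains c C where "0 < c" "0 < C" "\<And>x. x \<in> closure \<Omega> \<Longrightarrow> c \<le> \<gamma> x \<and> \<gamma> x \<le> C"
proof (cases "\<Omega> = {}")
  case True
  then show ?thesis using that[of 1 1] by simp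
next
  case False
  have cl: "compact (closure \<Omega>)" "closure \<Omega> \<noteq> {}" using \<Omega>_bounded False by auto
  obtain a where a: "a \<in> closure \<Omega>" "\<And>x. x \<in> closure \<Omega> \<Longrightarrow> \<gamma> a \<le> \<gamma> x"
    using continuous_attains_inf[OF cl \<gamma>_cont] by blast
  obtain b where b: "b \<in> closure \<Omega>" "\<And>x. x \<in> closure \<Omega> \<Longrightarrow> \<gamma> x \<le> \<gamma> b"
    using continuous_attains_sup[OF cl \<gamma>_cont] by blast
  show ?thesis using that[of "\<gamma> a" "\<gamma> b"] a b \<gamma>_pos by blast
qed

lemma \<gamma>_measurable: "\<gamma> \<in> borel_measurable M"
  by (rule continuous_imp_measurable_on_sets_lebesgue[OF continuous_on_subset[OF \<gamma>_cont closure_subset] \<Omega>_sets(1)])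

lemma \<gamma>_nonneg: "x \<in> \<Omega> \<Longrightarrow> 0 \<le> \<gamma> x"
  using \<gamma>_pos[of x] closure_subset[of \<Omega>] by (auto intro: less_imp_le)

definition energy :: "(real ^ 'n \<Rightarrow> complex ^ 'n) \<Rightarrow> real" where
  "energy G = (LINT x|M. \<gamma> x * norm (G x) powr p)"

lemma energy_integrable:
  assumes "G \<in> Lp M p" shows "integrable M (\<lambda>x. \<gamma> x * norm (G x) powr p)"
proof -
  obtain c C where "0 < c" "0 < C" "\<And>x. x \<in> closure \<Omega> \<Longrightarrow> c \<le> \<gamma> x \<and> \<gamma> x \<le> C" by (rule \<gamma>_bounds) blast
  then show ?thesis
    using closure_subset[of \<Omega>] \<gamma>_nonneg
    by (intro integrable_weight_powr[OF assms \<gamma>_measurable, of C]) auto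
qed

lemma energy_nonneg: "0 \<le> energy G"
  unfolding energy_def using \<gamma>_nonneg by (intro Bochner_Integration.integral_nonneg) auto

lemma energy_cong_AE:
  assumes "G \<in> borel_measurable M" "H \<in> borel_measurable M" "AE x in M. G x = H x"
  shows "energy G = energy H"
proof -
  have m: "(\<lambda>x. \<gamma> x * norm (F x) powr p) \<in> borel_measurable M" if "F \<in> borel_measurable M" for F :: "real ^ 'n \<Rightarrow> complex ^ 'n"
    using that \<gamma>_measurable by measurable
  show ?thesis unfolding energy_def
    using assms(3) by (intro integral_cong_AE m assms) auto
qed

lemma energy_tendsto:
  assumes G: "\<And>k. G k \<in> Lp M p" and H: "H \<in> Lp M p"
    and lim: "(\<lambda>k. LINT x|M. norm (G k x - H x) powr p) \<longlonglongrightarrow> 0"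
  shows "(\<lambda>k::nat. energy (G k)) \<longlonglongrightarrow> energy H"
proof (rule LIMSEQ_I)
  fix e :: real assume e: "0 < e"
  obtain c C where C: "0 < c" "0 < C" "\<And>x. x \<in> closure \<Omega> \<Longrightarrow> c \<le> \<gamma> x \<and> \<gamma> x \<le> C" by (rule \<gamma>_bounds) blast
  define \<delta> where "\<delta> = e / 2 / (energy H + 1)"
  have E1: "energy H + 1 > 0" using energy_nonneg[of H] by simp
  have \<delta>: "\<delta> > 0" using e E1 by (simp add: \<delta>_def)
  obtain K where K: "0 \<le> K" "\<And>a b :: complex ^ 'n. \<bar>norm a powr p - norm b powr p\<bar> \<le> \<delta> * norm b powr p + K * norm (a - b) powr p"
    using norm_powr_abs_diff_le[OF p_gt_1 \<delta>] by metis
  obtain N where N: "\<And>k. k \<ge> N \<Longrightarrow> norm ((LINT x|M. norm (G k x - H x) powr p) - 0) < e / (2 * (C * K + 1))"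
    using LIMSEQ_D[OF lim, of "e / (2 * (C * K + 1))"] e C K by (auto simp: add_nonneg_pos)
  have "norm (energy (G k) - energy H) < e" if k: "k \<ge> N" for k
  proof -
    note I = energy_integrable[OF G, of k] energy_integrable[OF H]
    note D = LpD(2)[OF Lp_diff(1)[OF G H p_nonneg(1)], of k]
    let ?d = "LINT x|M. norm (G k x - H x) powr p"
    have d0: "0 \<le> ?d" by (intro Bochner_Integration.integral_nonneg) auto
    have "norm (energy (G k) - energy H) = norm (LINT x|M. \<gamma> x * norm (G k x) powr p - \<gamma> x * norm (H x) powr p)"
      unfolding energy_def using I by simp
    also have "\<dots> \<le> (LINT x|M. norm (\<gamma> x * norm (G k x) powr p - \<gamma> x * norm (H x) powr p))"
      by (rule integral_norm_bound)
    also have "\<dots> \<le> (LINT x|M. \<delta> * (\<gamma> x * norm (H x) powr p) + C * K * norm (G k x - H x) powr p)"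
    proof (rule integral_mono)
      show "integrable M (\<lambda>x. norm (\<gamma> x * norm (G k x) powr p - \<gamma> x * norm (H x) powr p))"
        using I by (intro integrable_norm Bochner_Integration.integrable_diff)
      show "integrable M (\<lambda>x. \<delta> * (\<gamma> x * norm (H x) powr p) + C * K * norm (G k x - H x) powr p)"
        using I D by (intro Bochner_Integration.integrable_add integrable_mult_right)
      fix x assume "x \<in> space M"
      then have x: "0 \<le> \<gamma> x" "\<gamma> x \<le> C" using C(3)[of x] \<gamma>_nonneg closure_subset[of \<Omega>] by auto
      have "norm (\<gamma> x * norm (G k x) powr p - \<gamma> x * norm (H x) powr p) = \<gamma> x * \<bar>norm (G k x) powr p - norm (H x) powr p\<bar>"
        using x by (simp add: right_diff_distrib[symmetric] abs_mult)
      also have "\<dots> \<le> \<gamma> x * (\<delta> * norm (H x) powr p + K * norm (G k x - H x) powr p)"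
        using x by (intro mult_left_mono K(2))
      also have "\<dots> = \<delta> * (\<gamma> x * norm (H x) powr p) + \<gamma> x * (K * norm (G k x - H x) powr p)"
        by (simp add: algebra_simps)
      also have "\<gamma> x * (K * norm (G k x - H x) powr p) \<le> C * (K * norm (G k x - H x) powr p)"
        using x K(1) by (intro mult_right_mono) auto
      finally show "norm (\<gamma> x * norm (G k x) powr p - \<gamma> x * norm (H x) powr p)
          \<le> \<delta> * (\<gamma> x * norm (H x) powr p) + C * K * norm (G k x - H x) powr p" by (simp add: mult.assoc)
    qed
    also have "\<dots> = \<delta> * energy H + C * K * ?d" unfolding energy_def using I D by simp
    also have "\<dots> < e"
    proof -
      have "\<delta> * energy H \<le> \<delta> * (energy H + 1)" using \<delta> by (intro mult_left_mono) auto
      also have "\<dots> = e / 2"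
      proof -
        have "e / 2 / s * s = e / 2" if "0 < s" for s :: real using that by simp
        from this[OF E1] show ?thesis unfolding \<delta>_def .
      qed
      finally have 1: "\<delta> * energy H \<le> e / 2" .
      have pos: "C * K + 1 > 0" using C K by (simp add: add_nonneg_pos)
      have "C * K * ?d \<le> (C * K + 1) * ?d" using d0 by (intro mult_right_mono) auto
      also have "\<dots> < (C * K + 1) * (e / (2 * (C * K + 1)))" using N[OF k] pos by (intro mult_strict_left_mono) auto
      also have "\<dots> = e / 2"
      proof -
        have "s * (e / (2 * s)) = e / 2" if "0 < s" for s :: real using that by simp
        from this[OF pos] show ?thesis .
      qed
      finally show ?thesis using 1 by simp
    qed
    finally show ?thesis .
  qed
  then show "\<exists>N. \<forall>k\<ge>N. norm (energy (G k) - energy H) < e" by blast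
qed

lemma integrable_flux:
  assumes G: "G \<in> Lp M p" and H: "H \<in> Lp M p"
  shows "integrable M (\<lambda>x. complex_of_real (\<gamma> x) * cdot (flux p (G x)) (H x))"
proof (rule Bochner_Integration.integrable_bound)
  show "integrable M (\<lambda>x. \<gamma> x * norm (G x) powr p + \<gamma> x * norm (H x) powr p)"
    by (intro Bochner_Integration.integrable_add energy_integrable G H)
  show "(\<lambda>x. complex_of_real (\<gamma> x) * cdot (flux p (G x)) (H x)) \<in> borel_measurable M"
    by (intro borel_measurable_times borel_measurable_cdot_flux p_gt_1 LpD(1)[OF G] LpD(1)[OF H]
        borel_measurable_bounded_linear[OF bounded_linear_of_real \<gamma>_measurable])
  show "AE x in M. norm (complex_of_real (\<gamma> x) * cdot (flux p (G x)) (H x)) \<le>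
      norm (\<gamma> x * norm (G x) powr p + \<gamma> x * norm (H x) powr p)"
  proof (rule AE_I2)
    fix x assume "x \<in> space M"
    then have x: "0 \<le> \<gamma> x" using \<gamma>_nonneg by simp
    have "norm (cdot (flux p (G x)) (H x)) \<le> norm (G x) powr (p - 1) * norm (H x)"
      using norm_cdot_le[of "flux p (G x)" "H x"] by (simp add: norm_flux[OF p_gt_1])
    also have "\<dots> \<le> 1 * norm (G x) powr p + 1 powr (1 - p) * norm (H x) powr p"
      by (rule powr_mult_le_add[OF p_gt_1]) auto
    finally have "\<gamma> x * norm (cdot (flux p (G x)) (H x)) \<le> \<gamma> x * (norm (G x) powr p + norm (H x) powr p)"
      using x by (intro mult_left_mono) auto
    then show "norm (complex_of_real (\<gamma> x) * cdot (flux p (G x)) (H x)) \<le>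
      norm (\<gamma> x * norm (G x) powr p + \<gamma> x * norm (H x) powr p)"
      using x by (simp add: norm_mult distrib_left)
  qed
qed

text \<open>The energy form as a function of two gradients; \<open>energy_form_eq\<close> admits any
  weak gradients in place of the chosen ones.\<close>

definition flux_pairing :: "(real ^ 'n \<Rightarrow> complex ^ 'n) \<Rightarrow> (real ^ 'n \<Rightarrow> complex ^ 'n) \<Rightarrow> complex" where
  "flux_pairing G H = (LINT x|M. complex_of_real (\<gamma> x) * cdot (flux p (G x)) (H x))"

lemma energy_form_eq:
  assumes "has_weak_gradient \<Omega> u G" "has_weak_gradient \<Omega> \<phi> H"
  shows "energy_form \<Omega> p \<gamma> u \<phi> = flux_pairing G H"
proof -
  have meas: "F \<in> borel_measurable M" if "has_weak_gradient \<Omega> v F" for v F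
    using that by (auto simp: has_weak_gradient_def intro: locally_integrable_measurable)
  have m: "(\<lambda>x. complex_of_real (\<gamma> x) * cdot (flux p (F x)) (F' x)) \<in> borel_measurable M"
    if "F \<in> borel_measurable M" "F' \<in> borel_measurable M" for F F'
    by (intro borel_measurable_times borel_measurable_cdot_flux p_gt_1 that
        borel_measurable_bounded_linear[OF bounded_linear_of_real \<gamma>_measurable])
  show ?thesis unfolding energy_form_def flux_pairing_def
  proof (rule integral_cong_AE)
    show "AE x in M. complex_of_real (\<gamma> x) * cdot (flux p (weak_grad \<Omega> u x)) (weak_grad \<Omega> \<phi> x) =
        complex_of_real (\<gamma> x) * cdot (flux p (G x)) (H x)"
      using weak_grad(2)[OF assms(1)] weak_grad(2)[OF assms(2)] by eventually_elim simp
  qed (intro m meas[OF weak_grad(1)[OF assms(1)]] meas[OF weak_grad(1)[OF assms(2)]] meas[OF assms(1)] meas[OF assms(2)])+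
qed

lemma Re_flux_pairing_vcnj:
  assumes G: "G \<in> Lp M p" and H: "H \<in> Lp M p"
  shows "integrable M (\<lambda>x. \<gamma> x * (flux p (G x) \<bullet> H x))"
    "Re (flux_pairing G (\<lambda>x. vcnj (H x))) = (LINT x|M. \<gamma> x * (flux p (G x) \<bullet> H x))"
proof -
  have "(\<lambda>x. vcnj (H x)) \<in> Lp M p"
    using borel_measurable_bounded_linear[OF bounded_linear_vcnj LpD(1)[OF H]] LpD(2)[OF H] by (simp add: Lp_def)
  note I = integrable_flux[OF G this]
  have eq: "Re (complex_of_real (\<gamma> x) * cdot (flux p (G x)) (vcnj (H x))) = \<gamma> x * (flux p (G x) \<bullet> H x)" for x
    by (simp add: Re_cdot_vcnj)
  show "integrable M (\<lambda>x. \<gamma> x * (flux p (G x) \<bullet> H x))"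
    using integrable_Re[OF I] by (simp only: eq)
  show "Re (flux_pairing G (\<lambda>x. vcnj (H x))) = (LINT x|M. \<gamma> x * (flux p (G x) \<bullet> H x))"
    unfolding flux_pairing_def using integral_Re[OF I] by (simp only: eq)
qed

lemma energy_tangent_le:
  assumes G: "G \<in> Lp M p" and H: "H \<in> Lp M p"
  shows "energy G + p * (LINT x|M. \<gamma> x * (flux p (G x) \<bullet> (H x - G x))) \<le> energy H"
proof -
  have D: "(\<lambda>x. H x - G x) \<in> Lp M p" by (rule Lp_diff(1)[OF H G p_nonneg(1)])
  note I = energy_integrable[OF G] Re_flux_pairing_vcnj(1)[OF G D]
  have "energy G + p * (LINT x|M. \<gamma> x * (flux p (G x) \<bullet> (H x - G x)))
      = (LINT x|M. \<gamma> x * norm (G x) powr p + p * (\<gamma> x * (flux p (G x) \<bullet> (H x - G x))))"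
    unfolding energy_def using I by simp
  also have "\<dots> \<le> energy H" unfolding energy_def
  proof (rule integral_mono)
    fix x assume "x \<in> space M"
    then have x: "0 \<le> \<gamma> x" using \<gamma>_nonneg by simp
    show "\<gamma> x * norm (G x) powr p + p * (\<gamma> x * (flux p (G x) \<bullet> (H x - G x))) \<le> \<gamma> x * norm (H x) powr p"
      using mult_left_mono[OF norm_powr_tangent_le[OF p_gt_1, of "G x" "H x"] x]
      by (simp add: flux_def algebra_simps)
  qed (use I energy_integrable[OF H] in auto)
  finally show ?thesis .
qed

text \<open>Testing the equation with the conjugate of w - u turns the bilinear form into the
  Hermitian one; its real part is the linear term of the convexity inequality, which therefore
  vanishes.\<close>

lemma weak_solution_minimal:
  assumes u: "is_weak_solution \<Omega> p \<gamma> f u" and w: "w \<in> W1p \<Omega> p" "(\<lambda>x. w x - f x) \<in> W1p_0 \<Omega> p"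
  shows "energy (weak_grad \<Omega> u) \<le> energy (weak_grad \<Omega> w)"
proof -
  have uW: "u \<in> W1p \<Omega> p" "(\<lambda>x. u x - f x) \<in> W1p_0 \<Omega> p" and el: "\<And>\<phi>. \<phi> \<in> W1p_0 \<Omega> p \<Longrightarrow> energy_form \<Omega> p \<gamma> u \<phi> = 0"
    using u by (auto simp: is_weak_solution_def)
  note gu = W1p_weak_grad[OF uW(1)] and gw = W1p_weak_grad[OF w(1)]
  have "(\<lambda>x. w x - u x) \<in> W1p_0 \<Omega> p" using W1p_0_diff[OF w(2) uW(2)] by simp
  then have "energy_form \<Omega> p \<gamma> u (\<lambda>x. cnj (w x - u x)) = 0" by (intro el W1p_0_cnj)
  moreover have "energy_form \<Omega> p \<gamma> u (\<lambda>x. cnj (w x - u x)) =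
      flux_pairing (weak_grad \<Omega> u) (\<lambda>x. vcnj (weak_grad \<Omega> w x - weak_grad \<Omega> u x))"
    by (intro energy_form_eq weak_gradient_cnj weak_gradient_diff gu gw)
  ultimately have "(LINT x|M. \<gamma> x * (flux p (weak_grad \<Omega> u x) \<bullet> (weak_grad \<Omega> w x - weak_grad \<Omega> u x))) = 0"
    using Re_flux_pairing_vcnj(2)[OF gu(3) Lp_diff(1)[OF gw(3) gu(3) p_nonneg(1)]] by simp
  then show ?thesis using energy_tangent_le[OF gu(3) gw(3)] by simp
qed

text \<open>The tangent inequality at G + t H, looking back to G, gives the sign of the integral for
  every t > 0; dominated convergence then lets t tend to 0. Differentiating the energy under the
  integral is thereby reduced to continuity of the flux.\<close>

lemma Euler_Lagrange:
  assumes G: "G \<in> Lp M p" and H: "H \<in> Lp M p"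
    and min: "\<And>t. 0 < t \<Longrightarrow> energy G \<le> energy (\<lambda>x. G x + t *\<^sub>R H x)"
  shows "0 \<le> (LINT x|M. \<gamma> x * (flux p (G x) \<bullet> H x))"
proof -
  define t where "t k = inverse (real (Suc k))" for k
  have t: "0 < t k" "t k \<le> 1" for k by (auto simp: t_def field_simps)
  have Gt: "(\<lambda>x. G x + t k *\<^sub>R H x) \<in> Lp M p" for k
    by (intro Lp_add(1) G Lp_scaleR H p_nonneg)
  have nn: "0 \<le> (LINT x|M. \<gamma> x * (flux p (G x + t k *\<^sub>R H x) \<bullet> H x))" for k
  proof -
    have "energy (\<lambda>x. G x + t k *\<^sub>R H x) + p * (LINT x|M. \<gamma> x * (flux p (G x + t k *\<^sub>R H x) \<bullet> (G x - (G x + t k *\<^sub>R H x)))) \<le> energy G"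
      by (rule energy_tangent_le[OF Gt G])
    moreover have "(LINT x|M. \<gamma> x * (flux p (G x + t k *\<^sub>R H x) \<bullet> (G x - (G x + t k *\<^sub>R H x))))
        = (LINT x|M. - t k * (\<gamma> x * (flux p (G x + t k *\<^sub>R H x) \<bullet> H x)))"
      by (intro Bochner_Integration.integral_cong) auto
    moreover have "\<dots> = - t k * (LINT x|M. \<gamma> x * (flux p (G x + t k *\<^sub>R H x) \<bullet> H x))"
      by (rule integral_mult_right_zero)
    ultimately have "0 \<le> p * (t k * (LINT x|M. \<gamma> x * (flux p (G x + t k *\<^sub>R H x) \<bullet> H x)))"
      using min[OF t(1)[of k]] by simp
    then show ?thesis using t(1)[of k] p_gt_1 by (simp add: zero_le_mult_iff)
  qed
  have "(\<lambda>k. LINT x|M. \<gamma> x * (flux p (G x + t k *\<^sub>R H x) \<bullet> H x)) \<longlonglongrightarrow> (LINT x|M. \<gamma> x * (flux p (G x) \<bullet> H x))"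
  proof (rule integral_dominated_convergence)
    show "(\<lambda>x. \<gamma> x * (flux p (G x) \<bullet> H x)) \<in> borel_measurable M"
      by (intro borel_measurable_integrable Re_flux_pairing_vcnj(1) G H)
    show "(\<lambda>x. \<gamma> x * (flux p (G x + t k *\<^sub>R H x) \<bullet> H x)) \<in> borel_measurable M" for k
      by (intro borel_measurable_integrable Re_flux_pairing_vcnj(1) Gt H)
    show "integrable M (\<lambda>x. (2 powr p + 1) * (\<gamma> x * norm (G x) powr p + \<gamma> x * norm (H x) powr p))"
      by (intro integrable_mult_right Bochner_Integration.integrable_add energy_integrable G H)
    have "t \<longlonglongrightarrow> 0" unfolding t_def by (rule LIMSEQ_inverse_real_of_nat)
    then have "(\<lambda>k. G x + t k *\<^sub>R H x) \<longlonglongrightarrow> G x + 0 *\<^sub>R H x" for x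
      by (intro tendsto_add tendsto_const tendsto_scaleR)
    then have "(\<lambda>k. flux p (G x + t k *\<^sub>R H x)) \<longlonglongrightarrow> flux p (G x)" for x
      using continuous_on_tendsto_compose[OF continuous_on_flux[OF p_gt_1], of "\<lambda>k. G x + t k *\<^sub>R H x" "G x" sequentially] by simp
    then show "AE x in M. (\<lambda>k. \<gamma> x * (flux p (G x + t k *\<^sub>R H x) \<bullet> H x)) \<longlonglongrightarrow> \<gamma> x * (flux p (G x) \<bullet> H x)"
      by (intro AE_I2 tendsto_mult tendsto_const tendsto_inner)
    show "AE x in M. norm (\<gamma> x * (flux p (G x + t k *\<^sub>R H x) \<bullet> H x)) \<le>
        (2 powr p + 1) * (\<gamma> x * norm (G x) powr p + \<gamma> x * norm (H x) powr p)" for k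
    proof (rule AE_I2)
      fix x assume "x \<in> space M"
      then have x: "0 \<le> \<gamma> x" using \<gamma>_nonneg by simp
      have "\<bar>flux p (G x + t k *\<^sub>R H x) \<bullet> H x\<bar> \<le> norm (G x + t k *\<^sub>R H x) powr (p - 1) * norm (H x)"
        using Cauchy_Schwarz_ineq2[of "flux p (G x + t k *\<^sub>R H x)" "H x"] by (simp add: norm_flux[OF p_gt_1])
      also have "\<dots> \<le> 1 * norm (G x + t k *\<^sub>R H x) powr p + 1 powr (1 - p) * norm (H x) powr p"
        by (rule powr_mult_le_add[OF p_gt_1]) auto
      also have "norm (G x + t k *\<^sub>R H x) powr p \<le> 2 powr p * (norm (G x) powr p + norm (t k *\<^sub>R H x) powr p)"
        by (rule norm_add_powr_le[OF p_nonneg(1)])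
      also have "norm (t k *\<^sub>R H x) powr p \<le> norm (H x) powr p"
        using t[of k] p_nonneg by (intro powr_mono2) (auto intro: mult_left_le_one_le)
      finally have "\<bar>flux p (G x + t k *\<^sub>R H x) \<bullet> H x\<bar> \<le> 2 powr p * (norm (G x) powr p + norm (H x) powr p) + norm (H x) powr p"
        by simp
      also have "\<dots> \<le> (2 powr p + 1) * (norm (G x) powr p + norm (H x) powr p)" by (simp add: distrib_right)
      finally have "\<gamma> x * \<bar>flux p (G x + t k *\<^sub>R H x) \<bullet> H x\<bar> \<le> \<gamma> x * ((2 powr p + 1) * (norm (G x) powr p + norm (H x) powr p))"
        using x by (intro mult_left_mono)
      then show "norm (\<gamma> x * (flux p (G x + t k *\<^sub>R H x) \<bullet> H x)) \<le>
        (2 powr p + 1) * (\<gamma> x * norm (G x) powr p + \<gamma> x * norm (H x) powr p)"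
        using x by (simp add: abs_mult algebra_simps)
    qed
  qed
  then show ?thesis by (rule LIMSEQ_le_const) (use nn in auto)
qed

end

subsection \<open>Existence by the direct method\<close>

context bounded_domain
begin

lemma nn_integral_eq_M:
  assumes g: "g \<in> borel_measurable borel" "\<And>x. 0 \<le> g x" and S: "S \<in> sets borel" "S \<subseteq> \<Omega>" and int: "integrable M g"
  shows "(\<integral>\<^sup>+x. ennreal (g x) * indicator S x \<partial>lborel) = ennreal (LINT x|M. indicator S x * g x)"
proof -
  have "integrable M (\<lambda>x. indicator S x *\<^sub>R g x)"
    using S by (intro integrable_mult_indicator int) (auto simp: sets_restrict_space intro!: image_eqI[of _ _ S])
  then have I: "integrable M (\<lambda>x. indicator S x * g x)" by simp
  have "(\<integral>\<^sup>+x. ennreal (g x) * indicator S x \<partial>lborel) = (\<integral>\<^sup>+x. ennreal (g x) * indicator S x \<partial>lebesgue)"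
    by (simp add: nn_integral_completion)
  also have "\<dots> = (\<integral>\<^sup>+x. ennreal (indicator S x * g x) * indicator \<Omega> x \<partial>lebesgue)"
    using S g(2) by (intro nn_integral_cong) (auto simp: indicator_def)
  also have "\<dots> = (\<integral>\<^sup>+x. ennreal (indicator S x * g x) \<partial>M)"
    by (rule nn_integral_restrict_space[symmetric]) simp
  also have "\<dots> = ennreal (LINT x|M. indicator S x * g x)"
    by (rule nn_integral_eq_integral[OF I]) (use g(2) in auto)
  finally show ?thesis .
qed

lemma smooth_norm_powr_measurable:
  assumes "smooth u"
  shows "(\<lambda>x. norm (u x) powr p) \<in> borel_measurable borel" "(\<lambda>x. norm (cgrad u x) powr p) \<in> borel_measurable borel"
proof -
  have [measurable]: "u \<in> borel_measurable borel" "cgrad u \<in> borel_measurable borel"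
    by (intro borel_measurable_continuous_onI smooth_imp_continuous_on continuous_on_cgrad assms)+
  show "(\<lambda>x. norm (u x) powr p) \<in> borel_measurable borel" "(\<lambda>x. norm (cgrad u x) powr p) \<in> borel_measurable borel"
    by measurable
qed

lemma Poincare_test:
  obtains C where "0 \<le> C" "\<And>\<phi>. \<phi> \<in> test_functions \<Omega> \<Longrightarrow>
    (LINT x|M. norm (\<phi> x) powr p) \<le> C * (LINT x|M. norm (cgrad \<phi> x) powr p)"
proof -
  obtain R where R: "\<And>x. x \<in> \<Omega> \<Longrightarrow> norm x \<le> R" "0 < R"
    using \<Omega>_bounded bounded_pos by metis
  \<comment> \<open>Longer than 2 R, hence translation by v carries every point of \<Omega> out of
    it; \<open>undefined\<close> is merely some coordinate.\<close>
  define v :: "real ^ 'n" where "v = (2 * R + 1) *\<^sub>R axis undefined 1"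
  have nv: "norm v = 2 * R + 1" using R(2) by (simp add: v_def)
  show ?thesis
  proof (rule that)
    show "0 \<le> norm v powr p" by simp
    fix \<phi> assume \<phi>: "\<phi> \<in> test_functions \<Omega>"
    obtain K where K: "K \<subseteq> \<Omega>" "\<And>x. x \<notin> K \<Longrightarrow> \<phi> x = 0" "\<And>x. x \<notin> K \<Longrightarrow> cgrad \<phi> x = 0"
      by (rule test_functionsE[OF \<phi>]) blast
    note sm = test_functions_smooth[OF \<phi>]
    have "(\<integral>\<^sup>+x. ennreal (norm (\<phi> (x + v) - \<phi> x) powr p) * indicator \<Omega> x \<partial>lborel)
      \<le> ennreal (norm v powr p) * (\<integral>\<^sup>+x. ennreal (norm (cgrad \<phi> x) powr p) * indicator \<Omega> x \<partial>lborel)"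
      using K by (intro translation_estimate sm p_gt_1) auto
    also have "(\<integral>\<^sup>+x. ennreal (norm (\<phi> (x + v) - \<phi> x) powr p) * indicator \<Omega> x \<partial>lborel)
        = (\<integral>\<^sup>+x. ennreal (norm (\<phi> x) powr p) * indicator \<Omega> x \<partial>lborel)"
    proof (rule nn_integral_cong)
      fix x
      have "\<phi> (x + v) = 0" if "x \<in> \<Omega>"
      proof -
        have "norm (x + v) \<ge> norm v - norm x" by (metis add.commute norm_diff_ineq)
        then have "norm (x + v) > R" using R that nv by (smt (verit))
        then have "x + v \<notin> \<Omega>" using R(1) by force
        then show ?thesis using K by auto
      qed
      then show "ennreal (norm (\<phi> (x + v) - \<phi> x) powr p) * indicator \<Omega> x = ennreal (norm (\<phi> x) powr p) * indicator \<Omega> x"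
        by (simp add: indicator_def)
    qed
    also have "(\<integral>\<^sup>+x. ennreal (norm (\<phi> x) powr p) * indicator \<Omega> x \<partial>lborel) = ennreal (LINT x|M. indicator \<Omega> x * norm (\<phi> x) powr p)"
      by (intro nn_integral_eq_M smooth_norm_powr_measurable sm LpD(2)[OF smooth_Lp(1)[OF sm]]) auto
    also have "(\<integral>\<^sup>+x. ennreal (norm (cgrad \<phi> x) powr p) * indicator \<Omega> x \<partial>lborel) = ennreal (LINT x|M. indicator \<Omega> x * norm (cgrad \<phi> x) powr p)"
      by (intro nn_integral_eq_M smooth_norm_powr_measurable sm LpD(2)[OF smooth_Lp(2)[OF sm]]) auto
    finally have "ennreal (LINT x|M. indicator \<Omega> x * norm (\<phi> x) powr p) \<le>
        ennreal (norm v powr p * (LINT x|M. indicator \<Omega> x * norm (cgrad \<phi> x) powr p))"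
      by (simp add: ennreal_mult')
    moreover have "(LINT x|M. indicator \<Omega> x * g x) = (LINT x|M. g x)" for g :: "real ^ 'n \<Rightarrow> real"
      by (intro Bochner_Integration.integral_cong) auto
    ultimately show "(LINT x|M. norm (\<phi> x) powr p) \<le> norm v powr p * (LINT x|M. norm (cgrad \<phi> x) powr p)"
      by (simp add: Bochner_Integration.integral_nonneg)
  qed
qed

end

context bounded_domain
begin

text \<open>The element of the trace space represented by f. It depends on \<Omega> and p only, so
  both weights are tested on the same class.\<close>

definition trace_class :: "(real ^ 'n \<Rightarrow> complex) \<Rightarrow> (real ^ 'n \<Rightarrow> complex) set" where
  "trace_class f = {(u, v). u \<in> W1p \<Omega> p \<and> v \<in> W1p \<Omega> p \<and> (\<lambda>x. u x - v x) \<in> W1p_0 \<Omega> p} `` {f}"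

end

context weighted_domain
begin

text \<open>The direct method, with a minimising sequence of smooth data plus test functions. Its
  gradients converge strongly by uniform convexity, the functions by Poincare's inequality.
  Existence matters because \<open>dirichlet_solution\<close> is a choice that says nothing without
  it.\<close>

lemma weak_solution_exists:
  assumes f: "smooth f"
  shows "\<exists>u. is_weak_solution \<Omega> p \<gamma> f u"
proof -
  obtain c C where C: "0 < c" "0 < C" "\<And>x. x \<in> closure \<Omega> \<Longrightarrow> c \<le> \<gamma> x \<and> \<gamma> x \<le> C" by (rule \<gamma>_bounds) blast
  define J where "J \<phi> = energy (\<lambda>x. cgrad f x + cgrad \<phi> x)" for \<phi>
  define m where "m = Inf (J ` test_functions \<Omega>)"
  have bdd: "bdd_below (J ` test_functions \<Omega>)" by (intro bdd_belowI[of _ 0]) (auto simp: J_def energy_nonneg)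
  have m_le: "m \<le> J \<phi>" if "\<phi> \<in> test_functions \<Omega>" for \<phi> unfolding m_def using that bdd by (intro cInf_lower) auto
  have "\<forall>k::nat. \<exists>\<phi>\<in>test_functions \<Omega>. J \<phi> < m + inverse (real (Suc k))"
  proof
    fix k :: nat
    have "Inf (J ` test_functions \<Omega>) < m + inverse (real (Suc k))" unfolding m_def[symmetric] by simp
    then show "\<exists>\<phi>\<in>test_functions \<Omega>. J \<phi> < m + inverse (real (Suc k))"
      using cInf_lessD[of "J ` test_functions \<Omega>"] test_functions_0 by blast
  qed
  then obtain \<phi> where \<phi>: "\<And>k. \<phi> k \<in> test_functions \<Omega>" "\<And>k::nat. J (\<phi> k) < m + inverse (real (Suc k))" by metis
  note sm = test_functions_smooth[OF \<phi>(1)]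
  have Jlim: "(\<lambda>k. J (\<phi> k)) \<longlonglongrightarrow> m"
  proof (rule tendsto_sandwich[OF _ _ tendsto_const])
    show "(\<lambda>k. m + inverse (real (Suc k))) \<longlonglongrightarrow> m"
      using tendsto_add[OF tendsto_const LIMSEQ_inverse_real_of_nat, of m] by simp
    show "\<forall>\<^sub>F k in sequentially. J (\<phi> k) \<le> m + inverse (real (Suc k))"
      by (intro always_eventually allI less_imp_le \<phi>(2))
    show "\<forall>\<^sub>F k in sequentially. m \<le> J (\<phi> k)"
      by (intro always_eventually allI m_le \<phi>(1))
  qed
  define g where "g k x = cgrad f x + cgrad (\<phi> k) x" for k x
  have gLp: "g k \<in> Lp M p" for k unfolding g_def by (intro Lp_add(1) smooth_Lp f sm p_nonneg)
  have mid: "m \<le> energy (\<lambda>x. (g k x + g l x) /\<^sub>R 2)" for k l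
  proof -
    have t: "(\<lambda>x. (1/2) * (\<phi> k x + \<phi> l x)) \<in> test_functions \<Omega>"
      by (intro test_functions_cmult test_functions_add \<phi>)
    have "cgrad (\<lambda>x. (1/2) * (\<phi> k x + \<phi> l x)) x = (1/2) *s (cgrad (\<phi> k) x + cgrad (\<phi> l) x)" for x
      by (subst cgrad_cmult[OF smooth_add[OF sm sm]], subst cgrad_add[OF sm sm]) simp
    moreover have "z + (1/2) *s (a + b) = ((z + a) + (z + b)) /\<^sub>R 2" for z a b :: "complex ^ 'n"
      by (simp add: vec_eq_iff scaleR_conv_of_real[where 'a = complex] field_simps)
    ultimately have "J (\<lambda>x. (1/2) * (\<phi> k x + \<phi> l x)) = energy (\<lambda>x. (g k x + g l x) /\<^sub>R 2)"
      unfolding J_def g_def by presburger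
    then show ?thesis using m_le[OF t] by simp
  qed
  have gC: "\<exists>N. \<forall>k\<ge>N. \<forall>l\<ge>N. (LINT x|M. norm (cgrad (\<phi> k) x - cgrad (\<phi> l) x) powr p) < e" if e: "0 < e" for e
  proof -
    have "\<exists>N. \<forall>k\<ge>N. \<forall>l\<ge>N. (LINT x|M. norm (g k x - g l x) powr p) < e"
    proof (rule minimizing_sequence_Cauchy[OF p_gt_1 gLp \<gamma>_measurable _ C(1) _ _ e])
      show "c \<le> \<gamma> x \<and> \<gamma> x \<le> C" if "x \<in> space M" for x using that C(3)[of x] closure_subset[of \<Omega>] by auto
      show "(\<lambda>k. LINT x|M. \<gamma> x * norm (g k x) powr p) \<longlonglongrightarrow> m"
        using Jlim by (simp add: J_def energy_def g_def)
      show "m \<le> (LINT x|M. \<gamma> x * norm ((g k x + g l x) /\<^sub>R 2) powr p)" for k l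
        using mid[of k l] by (simp only: energy_def)
    qed
    then show ?thesis by (simp add: g_def)
  qed
  obtain G where G: "G \<in> Lp M p" "(\<lambda>k. LINT x|M. norm (cgrad (\<phi> k) x - G x) powr p) \<longlonglongrightarrow> 0"
    using Lp_complete[of "\<lambda>k. cgrad (\<phi> k)", OF smooth_Lp(2)[OF sm] p_nonneg(2) gC] by blast
  obtain P where P: "0 \<le> P" "\<And>\<phi>. \<phi> \<in> test_functions \<Omega> \<Longrightarrow> (LINT x|M. norm (\<phi> x) powr p) \<le> P * (LINT x|M. norm (cgrad \<phi> x) powr p)"
    using Poincare_test by blast
  have wC: "\<exists>N. \<forall>k\<ge>N. \<forall>l\<ge>N. (LINT x|M. norm (\<phi> k x - \<phi> l x) powr p) < e" if e: "0 < e" for e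
  proof -
    obtain N where N: "\<forall>k\<ge>N. \<forall>l\<ge>N. (LINT x|M. norm (cgrad (\<phi> k) x - cgrad (\<phi> l) x) powr p) < e / (P + 1)"
      using gC[of "e / (P + 1)"] e P(1) by auto
    have "(LINT x|M. norm (\<phi> k x - \<phi> l x) powr p) < e" if "k \<ge> N" "l \<ge> N" for k l
    proof -
      let ?d = "LINT x|M. norm (cgrad (\<phi> k) x - cgrad (\<phi> l) x) powr p"
      have d0: "0 \<le> ?d" by (intro Bochner_Integration.integral_nonneg) auto
      have t: "(\<lambda>x. \<phi> k x - \<phi> l x) \<in> test_functions \<Omega>"
        using test_functions_add[OF \<phi>(1) test_functions_cmult[OF \<phi>(1), of "-1"], of k l] by simp
      have "(LINT x|M. norm (\<phi> k x - \<phi> l x) powr p) \<le> P * ?d"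
        using P(2)[OF t] by (simp add: cgrad_diff[OF sm sm])
      also have "\<dots> \<le> (P + 1) * ?d" using d0 by (intro mult_right_mono) auto
      also have "\<dots> < (P + 1) * (e / (P + 1))" using N that P(1) by (intro mult_strict_left_mono) auto
      also have "\<dots> = e" using P(1) by simp
      finally show ?thesis .
    qed
    then show ?thesis by blast
  qed
  obtain w where w: "w \<in> Lp M p" "(\<lambda>k. LINT x|M. norm (\<phi> k x - w x) powr p) \<longlonglongrightarrow> 0"
    using Lp_complete[of \<phi>, OF smooth_Lp(1)[OF sm] p_nonneg(2) wC] by blast
  have wG: "W0_lim w G" unfolding W0_lim_def using w G \<phi>(1) by (auto simp: norm_minus_commute)
  have lim_energy: "(\<lambda>k. energy (\<lambda>x. cgrad f x + cgrad (\<psi> k) x)) \<longlonglongrightarrow> energy (\<lambda>x. cgrad f x + H x)"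
    if \<psi>: "\<And>k. \<psi> k \<in> test_functions \<Omega>" and H: "H \<in> Lp M p"
      and lim: "(\<lambda>k. LINT x|M. norm (cgrad (\<psi> k) x - H x) powr p) \<longlonglongrightarrow> 0" for \<psi> :: "nat \<Rightarrow> real ^ 'n \<Rightarrow> complex" and H
    by (rule energy_tendsto) (use lim in \<open>auto intro!: Lp_add(1) smooth_Lp f test_functions_smooth[OF \<psi>] H p_nonneg\<close>)
  \<comment> \<open>The lower bound passes to limits of test functions, so variations may run
    through all of \<open>W1p_0\<close>.\<close>
  have m_le': "m \<le> energy (\<lambda>x. cgrad f x + H x)" if vH: "W0_lim v H" for v H
  proof -
    obtain \<psi> where "H \<in> Lp M p" and \<psi>: "\<And>k::nat. \<psi> k \<in> test_functions \<Omega>"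
      "(\<lambda>k. LINT x|M. norm (H x - cgrad (\<psi> k) x) powr p) \<longlonglongrightarrow> 0"
      using vH unfolding W0_lim_def by blast
    then have "(\<lambda>k. J (\<psi> k)) \<longlonglongrightarrow> energy (\<lambda>x. cgrad f x + H x)"
      unfolding J_def by (intro lim_energy) (auto simp: norm_minus_commute)
    then show ?thesis by (rule LIMSEQ_le_const) (use m_le[OF \<psi>(1)] in auto)
  qed
  have E_eq: "energy (\<lambda>x. cgrad f x + G x) = m"
    using LIMSEQ_unique[OF lim_energy[OF \<phi>(1) G]] Jlim by (simp add: J_def)
  define Gu where "Gu x = cgrad f x + G x" for x
  have GuLp: "Gu \<in> Lp M p" unfolding Gu_def by (intro Lp_add(1) smooth_Lp f G p_nonneg)
  have nn: "0 \<le> (LINT x|M. \<gamma> x * (flux p (Gu x) \<bullet> H x))" if vH: "W0_lim v H" for v H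
  proof (rule Euler_Lagrange[OF GuLp])
    show "H \<in> Lp M p" using vH by (simp add: W0_lim_def)
    fix t :: real assume "0 < t"
    have "W0_lim (\<lambda>x. w x + of_real t * v x) (\<lambda>x. G x + of_real t *s H x)"
      by (intro W0_lim_add W0_lim_cmult wG vH)
    from m_le'[OF this] have "m \<le> energy (\<lambda>x. cgrad f x + (G x + of_real t *s H x))" .
    moreover have "cgrad f x + (G x + of_real t *s H x) = Gu x + t *\<^sub>R H x" for x
      by (simp add: Gu_def vec_eq_iff scaleR_conv_of_real[where 'a = complex])
    ultimately show "energy Gu \<le> energy (\<lambda>x. Gu x + t *\<^sub>R H x)"
      using E_eq by (simp add: Gu_def[abs_def])
  qed
  \<comment> \<open>The one-sided inequality applies to the conjugate direction and to its negative;
    together they give a zero real part.\<close>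
  have zero: "Re (flux_pairing Gu H) = 0" if vH: "W0_lim v H" for v H
  proof -
    have a: "W0_lim (\<lambda>x. cnj (v x)) (\<lambda>x. vcnj (H x))" by (rule W0_lim_cnj[OF vH])
    have b: "W0_lim (\<lambda>x. (-1) * cnj (v x)) (\<lambda>x. (-1) *s vcnj (H x))" by (rule W0_lim_cmult[OF a])
    have m1: "(-1) *s z = - z" for z :: "complex ^ 'n" by (simp add: vec_eq_iff)
    have HLp: "(\<lambda>x. vcnj (H x)) \<in> Lp M p" using a by (simp add: W0_lim_def)
    have "Re (flux_pairing Gu (\<lambda>x. vcnj (vcnj (H x)))) = (LINT x|M. \<gamma> x * (flux p (Gu x) \<bullet> vcnj (H x)))"
      by (rule Re_flux_pairing_vcnj(2)[OF GuLp HLp])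
    moreover have "0 \<le> - (LINT x|M. \<gamma> x * (flux p (Gu x) \<bullet> vcnj (H x)))"
      using nn[OF b] by (simp add: m1)
    moreover have "vcnj (vcnj z) = z" for z :: "complex ^ 'n" by (simp add: vec_eq_iff)
    ultimately show ?thesis using nn[OF a] by simp
  qed
  \<comment> \<open>The directions form a complex space: multiplying by \<open>\<i>\<close> turns
    the imaginary part into a real part.\<close>
  have zero': "flux_pairing Gu H = 0" if vH: "W0_lim v H" for v H
  proof -
    have HLp: "H \<in> Lp M p" using vH by (simp add: W0_lim_def)
    have "flux_pairing Gu (\<lambda>x. \<i> *s H x) = \<i> * flux_pairing Gu H"
      unfolding flux_pairing_def using integrable_flux[OF GuLp HLp]
      by (simp add: cdot_smult mult.left_commute[of _ \<i>])
    then have "Re (\<i> * flux_pairing Gu H) = 0" using zero[OF W0_lim_cmult[OF vH, of \<i>]] by simp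
    then show ?thesis using zero[OF vH] by (simp add: complex_eq_iff)
  qed
  define u where "u x = f x + w x" for x
  have uG: "has_weak_gradient \<Omega> u Gu"
    unfolding u_def Gu_def by (intro weak_gradient_add weak_gradient_smooth f W0_lim_weak_gradient[OF wG])
  have "u \<in> Lp M p" unfolding u_def by (intro Lp_add(1) smooth_Lp f w p_nonneg)
  then have "u \<in> W1p \<Omega> p" using uG GuLp by (auto simp: W1p_iff)
  moreover have "(\<lambda>x. u x - f x) \<in> W1p_0 \<Omega> p" using W0_lim_W1p_0[OF wG] by (simp add: u_def)
  moreover have "energy_form \<Omega> p \<gamma> u \<phi> = 0" if "\<phi> \<in> W1p_0 \<Omega> p" for \<phi>
  proof -
    have "energy_form \<Omega> p \<gamma> u \<phi> = flux_pairing Gu (weak_grad \<Omega> \<phi>)"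
      by (rule energy_form_eq[OF uG W0_lim_weak_gradient[OF W1p_0_W0_lim[OF that]]])
    then show ?thesis using zero'[OF W1p_0_W0_lim[OF that]] by simp
  qed
  ultimately show ?thesis unfolding is_weak_solution_def by blast
qed

text \<open>The solution and its boundary datum differ by an element of \<open>W1p_0\<close>, so the
  equation allows the datum in the second slot to be replaced by the solution; the pairing becomes
  the minimal energy. Approximating u - f by test functions then gives smooth
  near-minimisers.\<close>

lemma DN_map_diagonal:
  assumes f: "smooth f"
  obtains Q where "DN_map \<Omega> p \<gamma> (trace_class f) (trace_class f) = complex_of_real Q"
    "\<And>\<phi>. \<phi> \<in> test_functions \<Omega> \<Longrightarrow> Q \<le> energy (cgrad (\<lambda>x. f x + \<phi> x))"
    "\<And>\<epsilon>. 0 < \<epsilon> \<Longrightarrow> \<exists>\<phi>\<in>test_functions \<Omega>. energy (cgrad (\<lambda>x. f x + \<phi> x)) < Q + \<epsilon>"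
proof -
  let ?F = "trace_class f"
  have F: "?F \<in> trace_space \<Omega> p"
    unfolding trace_space_def trace_class_def using smooth_W1p[OF f] by (rule quotientI)
  define f' where "f' = (SOME f'. f' \<in> ?F)"
  have zero: "(\<lambda>x. 0) \<in> W1p_0 \<Omega> p" by (intro test_functions_W1p_0 test_functions_0)
  have "f \<in> ?F" using smooth_W1p[OF f] zero by (simp add: trace_class_def)
  then have "f' \<in> ?F" unfolding f'_def by (rule someI[of "\<lambda>f'. f' \<in> ?F"])
  then have f': "f' \<in> W1p \<Omega> p" "(\<lambda>x. f x - f' x) \<in> W1p_0 \<Omega> p" by (auto simp: trace_class_def)
  \<comment> \<open>\<open>DN_map\<close> solves for a chosen representative f', possibly not
    smooth. A solution for f is one for f' too, as f - f' lies in \<open>W1p_0\<close>.\<close>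
  obtain u0 where u0: "is_weak_solution \<Omega> p \<gamma> f u0" using weak_solution_exists[OF f] by blast
  have "is_weak_solution \<Omega> p \<gamma> f' u0"
    using u0 W1p_0_add[OF _ f'(2), of "\<lambda>x. u0 x - f x"] by (simp add: is_weak_solution_def)
  define u where "u = dirichlet_solution \<Omega> p \<gamma> f'"
  have u: "is_weak_solution \<Omega> p \<gamma> f' u"
    unfolding u_def dirichlet_solution_def by (rule someI[of "is_weak_solution \<Omega> p \<gamma> f'"]) fact
  then have uW: "u \<in> W1p \<Omega> p" "(\<lambda>x. u x - f' x) \<in> W1p_0 \<Omega> p" and el: "\<And>\<phi>. \<phi> \<in> W1p_0 \<Omega> p \<Longrightarrow> energy_form \<Omega> p \<gamma> u \<phi> = 0"
    by (auto simp: is_weak_solution_def)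
  have uf: "(\<lambda>x. u x - f x) \<in> W1p_0 \<Omega> p" using W1p_0_diff[OF uW(2) f'(2)] by simp
  note gu = W1p_weak_grad[OF uW(1)] and gf' = W1p_weak_grad[OF f'(1)]
  define Q where "Q = energy (weak_grad \<Omega> u)"
  have DN: "DN_map \<Omega> p \<gamma> ?F ?F = complex_of_real Q"
  proof -
    have "DN_map \<Omega> p \<gamma> ?F ?F = energy_form \<Omega> p \<gamma> u (\<lambda>x. cnj (f' x))"
      using F by (simp add: DN_map_def f'_def u_def Let_def)
    also have "\<dots> = flux_pairing (weak_grad \<Omega> u) (\<lambda>x. vcnj (weak_grad \<Omega> f' x))"
      by (intro energy_form_eq weak_gradient_cnj gu gf')
    also have "\<dots> = flux_pairing (weak_grad \<Omega> u) (\<lambda>x. vcnj (weak_grad \<Omega> u x))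
        - flux_pairing (weak_grad \<Omega> u) (\<lambda>x. vcnj (weak_grad \<Omega> u x - weak_grad \<Omega> f' x))"
    proof -
      have L: "(\<lambda>x. vcnj (H x)) \<in> Lp M p" if H: "H \<in> Lp M p" for H :: "real ^ 'n \<Rightarrow> complex ^ 'n"
        using borel_measurable_bounded_linear[OF bounded_linear_vcnj LpD(1)[OF H]] LpD(2)[OF H] by (simp add: Lp_def)
      show ?thesis
        unfolding flux_pairing_def vcnj_diff cdot_diff
        using integrable_flux[OF gu(3) L[OF gu(3)]] integrable_flux[OF gu(3) L[OF gf'(3)]]
        by (simp add: right_diff_distrib)
    qed
    also have "flux_pairing (weak_grad \<Omega> u) (\<lambda>x. vcnj (weak_grad \<Omega> u x - weak_grad \<Omega> f' x))
        = energy_form \<Omega> p \<gamma> u (\<lambda>x. cnj (u x - f' x))"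
      by (intro energy_form_eq[symmetric] weak_gradient_cnj weak_gradient_diff gu gf')
    also have "\<dots> = 0" by (intro el W1p_0_cnj uW)
    also have "flux_pairing (weak_grad \<Omega> u) (\<lambda>x. vcnj (weak_grad \<Omega> u x)) = complex_of_real Q"
      unfolding flux_pairing_def Q_def energy_def
      by (simp add: cdot_flux_vcnj[OF p_gt_1] of_real_mult[symmetric] integral_complex_of_real del: of_real_mult)
    finally show ?thesis by simp
  qed
  have W: "energy (weak_grad \<Omega> w) = energy (cgrad w)" if "smooth w" for w
    using weak_grad[OF weak_gradient_smooth[OF that]] LpD(1)[OF smooth_Lp(2)[OF that]]
    by (intro energy_cong_AE) (auto simp: has_weak_gradient_def intro: locally_integrable_measurable)
  have Q_le: "Q \<le> energy (cgrad (\<lambda>x. f x + \<phi> x))" if \<phi>: "\<phi> \<in> test_functions \<Omega>" for \<phi>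
  proof -
    have sm: "smooth (\<lambda>x. f x + \<phi> x)" by (intro smooth_add f test_functions_smooth[OF \<phi>])
    have "(\<lambda>x. (f x + \<phi> x) - f' x) \<in> W1p_0 \<Omega> p"
      using W1p_0_add[OF f'(2) test_functions_W1p_0[OF \<phi>]] by (simp add: algebra_simps)
    from weak_solution_minimal[OF u smooth_W1p[OF sm] this] show ?thesis unfolding Q_def W[OF sm] .
  qed
  have ex: "\<exists>\<phi>\<in>test_functions \<Omega>. energy (cgrad (\<lambda>x. f x + \<phi> x)) < Q + \<epsilon>" if \<epsilon>: "0 < \<epsilon>" for \<epsilon>
  proof -
    define H where "H = weak_grad \<Omega> (\<lambda>x. u x - f x)"
    have lim: "W0_lim (\<lambda>x. u x - f x) H" unfolding H_def by (rule W1p_0_W0_lim[OF uf])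
    obtain \<psi> where H: "H \<in> Lp M p" and \<psi>: "\<And>k::nat. \<psi> k \<in> test_functions \<Omega>"
      "(\<lambda>k. LINT x|M. norm (H x - cgrad (\<psi> k) x) powr p) \<longlonglongrightarrow> 0"
      using lim unfolding W0_lim_def by blast
    note sm = test_functions_smooth[OF \<psi>(1)]
    have "(\<lambda>k. energy (\<lambda>x. cgrad f x + cgrad (\<psi> k) x)) \<longlonglongrightarrow> energy (\<lambda>x. cgrad f x + H x)"
      by (rule energy_tendsto) (use \<psi>(2) in \<open>auto intro!: Lp_add(1) smooth_Lp f sm H p_nonneg simp: norm_minus_commute\<close>)
    moreover have "energy (\<lambda>x. cgrad f x + H x) = Q"
      unfolding Q_def
    proof (rule energy_cong_AE)
      have "has_weak_gradient \<Omega> (\<lambda>x. f x + (u x - f x)) (\<lambda>x. cgrad f x + H x)"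
        by (intro weak_gradient_add weak_gradient_smooth f W0_lim_weak_gradient[OF lim])
      then have *: "has_weak_gradient \<Omega> u (\<lambda>x. cgrad f x + H x)" by simp
      show "AE x in M. cgrad f x + H x = weak_grad \<Omega> u x" by (rule weak_gradient_unique[OF * gu(2)])
      show "(\<lambda>x. cgrad f x + H x) \<in> borel_measurable M"
        using * by (auto simp: has_weak_gradient_def intro: locally_integrable_measurable)
    qed (rule LpD(1)[OF gu(3)])
    ultimately obtain k where "norm (energy (\<lambda>x. cgrad f x + cgrad (\<psi> k) x) - Q) < \<epsilon>"
      using LIMSEQ_D[of _ Q \<epsilon>] \<epsilon> by (metis order_refl)
    then have "energy (\<lambda>x. cgrad f x + cgrad (\<psi> k) x) < Q + \<epsilon>" by (auto simp: abs_less_iff)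
    moreover have "cgrad (\<lambda>x. f x + \<psi> k x) = (\<lambda>x. cgrad f x + cgrad (\<psi> k) x)"
      by (rule ext) (rule cgrad_add[OF f sm])
    ultimately show ?thesis using \<psi>(1) by (intro bexI[of _ "\<psi> k"]) simp_all
  qed
  show ?thesis by (rule that[OF DN Q_le ex])
qed

end

section \<open>Cutoff functions\<close>

lemma partial_deriv_rescale:
  assumes g: "\<And>y. g differentiable (at y)"
  shows "partial_deriv i (\<lambda>x. of_real k * g (c *\<^sub>R (x - x0))) x = of_real (c * k) * partial_deriv i g (c *\<^sub>R (x - x0))"
proof -
  let ?y = "c *\<^sub>R (x - x0)"
  have D: "(g has_derivative frechet_derivative g (at ?y)) (at ?y)"
    using g frechet_derivative_works by blast
  have "((\<lambda>x. c *\<^sub>R (x - x0)) has_derivative (\<lambda>h. c *\<^sub>R h)) (at x)"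
    by (auto intro!: derivative_eq_intros)
  from has_derivative_compose[OF this D]
  have "((\<lambda>x. of_real k * g (c *\<^sub>R (x - x0))) has_derivative (\<lambda>h. of_real k * frechet_derivative g (at ?y) (c *\<^sub>R h))) (at x)"
    by (rule has_derivative_mult_right)
  from partial_deriv_eqI[OF this]
  show ?thesis
    using linear_cmul[OF has_derivative_linear[OF D], of c "axis i 1"]
    by (simp add: partial_deriv_def scaleR_conv_of_real mult_ac)
qed

text \<open>\<open>smooth_algebra\<close> has no clause for inner functions, so an affine
  substitution is treated on the iterated derivatives themselves, each of which contributes a factor
  c.\<close>

lemma foldr_partial_deriv_rescale:
  assumes f: "smooth f"
  shows "foldr partial_deriv is (\<lambda>x. f (c *\<^sub>R (x - x0))) =
    (\<lambda>x. of_real (c ^ length is) * foldr partial_deriv is f (c *\<^sub>R (x - x0)))"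
proof (induction "is")
  case (Cons i "is")
  have "foldr partial_deriv (i # is) (\<lambda>x. f (c *\<^sub>R (x - x0))) =
      partial_deriv i (\<lambda>x. of_real (c ^ length is) * foldr partial_deriv is f (c *\<^sub>R (x - x0)))"
    by (simp add: Cons)
  also have "\<dots> = (\<lambda>x. of_real (c * c ^ length is) * partial_deriv i (foldr partial_deriv is f) (c *\<^sub>R (x - x0)))"
    by (rule ext, rule partial_deriv_rescale) (use f in \<open>simp add: smooth_def\<close>)
  finally show ?case by simp
qed simp

lemma smooth_rescale:
  assumes f: "smooth f" shows "smooth (\<lambda>x. f (c *\<^sub>R (x - x0)))"
  unfolding smooth_def foldr_partial_deriv_rescale[OF f]
proof (intro allI)
  fix "is" x
  have "(\<lambda>x. c *\<^sub>R (x - x0)) differentiable (at x)"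
    by (auto intro!: derivative_intros)
  moreover have "foldr partial_deriv is f differentiable (at (c *\<^sub>R (x - x0)))" using f by (simp add: smooth_def)
  ultimately have "(\<lambda>x. foldr partial_deriv is f (c *\<^sub>R (x - x0))) differentiable (at x)"
    using differentiable_chain_at[of "\<lambda>x. c *\<^sub>R (x - x0)" x "foldr partial_deriv is f"] by (simp add: o_def)
  then show "(\<lambda>x. of_real (c ^ length is) * foldr partial_deriv is f (c *\<^sub>R (x - x0))) differentiable (at x)"
    by (intro differentiable_mult) auto
qed

lemma cgrad_rescale:
  assumes f: "smooth f" shows "cgrad (\<lambda>x. f (c *\<^sub>R (x - x0))) x = c *\<^sub>R cgrad f (c *\<^sub>R (x - x0))"
  using partial_deriv_rescale[of f _ 1 c x0 x] smooth_imp_differentiable[OF f]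
  by (simp add: vec_eq_iff scaleR_conv_of_real[where 'a = complex])

section \<open>Cylinders about an axis and their cutoffs\<close>

lemma smooth_inner: "smooth (\<lambda>x. complex_of_real (\<nu> \<bullet> x))"
proof -
  have "(\<lambda>x. complex_of_real (\<nu> \<bullet> x)) = (\<lambda>x. \<Sum>i\<in>UNIV. of_real (\<nu> $ i) * of_real (x $ i))"
    by (simp add: inner_vec_def)
  then show ?thesis by (simp add: smooth_sum smooth_mult smooth_const smooth_coord del: of_real_mult)
qed

lemma smooth_norm_power2: "smooth (\<lambda>x :: real ^ 'n. complex_of_real ((norm x)\<^sup>2))"
proof -
  have "(\<lambda>x :: real ^ 'n. complex_of_real ((norm x)\<^sup>2)) = (\<lambda>x. \<Sum>i\<in>UNIV. of_real (x $ i) * of_real (x $ i))"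
    unfolding power2_norm_eq_inner by (simp add: inner_vec_def)
  then show ?thesis by (simp add: smooth_sum smooth_mult smooth_coord del: of_real_mult)
qed

definition radial_part :: "real ^ 'n \<Rightarrow> real ^ 'n \<Rightarrow> real ^ 'n" where
  "radial_part \<nu> z = z - (\<nu> \<bullet> z) *\<^sub>R \<nu>"

text \<open>For positive \<open>K\<close>, the gauge of the cylinder of radius 1 and half-height
  \<open>K\<close> about the axis \<nu>. The cones of slope \<open>K\<close> pass through its rims,
  so a boundary between them meets it only in the lateral surface.\<close>

definition cyl_norm :: "real ^ 'n \<Rightarrow> real \<Rightarrow> real ^ 'n \<Rightarrow> real" where
  "cyl_norm \<nu> K z = max (norm (radial_part \<nu> z)) (\<bar>\<nu> \<bullet> z\<bar> / K)"

lemma radial_part_add: "radial_part \<nu> (z + w) = radial_part \<nu> z + radial_part \<nu> w"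
  by (simp add: radial_part_def inner_add_right algebra_simps)

lemma radial_part_scaleR: "radial_part \<nu> (c *\<^sub>R z) = c *\<^sub>R radial_part \<nu> z"
  by (simp add: radial_part_def algebra_simps)

lemma radial_part_self: "norm \<nu> = 1 \<Longrightarrow> radial_part \<nu> (c *\<^sub>R \<nu>) = 0"
  by (simp add: radial_part_def dot_square_norm)

lemma radial_part_orthogonal: "\<nu> \<bullet> e = 0 \<Longrightarrow> radial_part \<nu> (c *\<^sub>R e) = c *\<^sub>R e"
  by (simp add: radial_part_def)

lemma norm_radial_part_power2:
  assumes "norm \<nu> = 1" shows "(norm (radial_part \<nu> z))\<^sup>2 = (norm z)\<^sup>2 - (\<nu> \<bullet> z)\<^sup>2"
proof -
  have "\<nu> \<bullet> \<nu> = 1" using assms by (simp add: dot_square_norm)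
  then show ?thesis
    unfolding power2_norm_eq_inner radial_part_def
    by (simp add: inner_diff_left inner_diff_right inner_commute power2_eq_square)
qed

lemma continuous_on_radial_part: "continuous_on S (radial_part \<nu>)"
  unfolding radial_part_def by (intro continuous_intros)

lemma cyl_norm_scaleR: "0 \<le> c \<Longrightarrow> cyl_norm \<nu> K (c *\<^sub>R z) = c * cyl_norm \<nu> K z"
  by (simp add: cyl_norm_def radial_part_scaleR abs_mult max_mult_distrib_left)

lemma norm_le_cyl_norm:
  assumes "norm \<nu> = 1" "0 < K" shows "norm z \<le> (1 + K) * cyl_norm \<nu> K z"
proof -
  have "z = radial_part \<nu> z + (\<nu> \<bullet> z) *\<^sub>R \<nu>" by (simp add: radial_part_def)
  then have "norm z \<le> norm (radial_part \<nu> z) + \<bar>\<nu> \<bullet> z\<bar>"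
    using norm_triangle_ineq[of "radial_part \<nu> z" "(\<nu> \<bullet> z) *\<^sub>R \<nu>"] assms by simp
  moreover have "norm (radial_part \<nu> z) \<le> cyl_norm \<nu> K z" by (simp add: cyl_norm_def)
  moreover have "\<bar>\<nu> \<bullet> z\<bar> \<le> K * cyl_norm \<nu> K z"
    using assms by (simp add: cyl_norm_def max_mult_distrib_left)
  ultimately show ?thesis by (simp add: distrib_right)
qed

lemma continuous_on_cyl_norm: "0 < K \<Longrightarrow> continuous_on S (cyl_norm \<nu> K)"
  unfolding cyl_norm_def by (intro continuous_intros continuous_on_radial_part) auto

text \<open>A radial step times an axial one. The steps are applied to squares, which are smooth
  everywhere; the thresholds 1 and 9 of \<open>smooth_step\<close> thus become 1 and 3 for the
  gauge.\<close>

lemma unit_cutoff: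
  fixes \<nu> :: "real ^ 'n"
  assumes \<nu>: "norm \<nu> = 1" and K: "0 < K"
  obtains \<zeta> where "smooth (\<lambda>z. complex_of_real (\<zeta> z))" "\<And>z. 0 \<le> \<zeta> z" "\<And>z. \<zeta> z \<le> 1"
    "\<And>z. cyl_norm \<nu> K z \<le> 1 \<Longrightarrow> \<zeta> z = 1" "\<And>z. 3 \<le> cyl_norm \<nu> K z \<Longrightarrow> \<zeta> z = 0"
proof -
  have "smooth (\<lambda>z. complex_of_real ((norm z)\<^sup>2) - of_real (\<nu> \<bullet> z) * of_real (\<nu> \<bullet> z))"
    by (intro smooth_diff smooth_norm_power2 smooth_mult smooth_inner)
  then have sm1: "smooth (\<lambda>z. complex_of_real ((norm (radial_part \<nu> z))\<^sup>2))"
    unfolding norm_radial_part_power2[OF \<nu>] by (simp add: power2_eq_square)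
  have "smooth (\<lambda>z. of_real (1 / K\<^sup>2) * (complex_of_real (\<nu> \<bullet> z) * of_real (\<nu> \<bullet> z)))"
    by (intro smooth_mult smooth_inner smooth_const)
  then have sm2: "smooth (\<lambda>z. complex_of_real ((\<bar>\<nu> \<bullet> z\<bar> / K)\<^sup>2))"
    by (simp add: power_divide power2_eq_square)
  obtain S1 where S1: "smooth (\<lambda>z. complex_of_real (S1 z))" "\<And>z. 0 \<le> S1 z" "\<And>z. S1 z \<le> 1"
    "\<And>z. (norm (radial_part \<nu> z))\<^sup>2 \<le> 1 \<Longrightarrow> S1 z = 1" "\<And>z. (norm (radial_part \<nu> z))\<^sup>2 \<ge> 9 \<Longrightarrow> S1 z = 0"
    using smooth_step[OF sm1] by metis
  obtain S2 where S2: "smooth (\<lambda>z. complex_of_real (S2 z))" "\<And>z. 0 \<le> S2 z" "\<And>z. S2 z \<le> 1"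
    "\<And>z. (\<bar>\<nu> \<bullet> z\<bar> / K)\<^sup>2 \<le> 1 \<Longrightarrow> S2 z = 1" "\<And>z. (\<bar>\<nu> \<bullet> z\<bar> / K)\<^sup>2 \<ge> 9 \<Longrightarrow> S2 z = 0"
    using smooth_step[OF sm2] by metis
  show ?thesis
  proof (rule that[of "\<lambda>z. S1 z * S2 z"])
    show "smooth (\<lambda>z. complex_of_real (S1 z * S2 z))"
      unfolding of_real_mult by (intro smooth_mult S1 S2)
    show "0 \<le> S1 z * S2 z" "S1 z * S2 z \<le> 1" for z
      using S1(2,3)[of z] S2(2,3)[of z] by (auto intro: mult_le_one)
    show "S1 z * S2 z = 1" if "cyl_norm \<nu> K z \<le> 1" for z
    proof -
      have "norm (radial_part \<nu> z) \<le> 1" "\<bar>\<nu> \<bullet> z\<bar> / K \<le> 1" using that by (auto simp: cyl_norm_def)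
      then have "(norm (radial_part \<nu> z))\<^sup>2 \<le> 1" "(\<bar>\<nu> \<bullet> z\<bar> / K)\<^sup>2 \<le> 1" using K by (auto intro!: power_le_one)
      then show ?thesis using S1(4) S2(4) by simp
    qed
    show "S1 z * S2 z = 0" if z: "3 \<le> cyl_norm \<nu> K z" for z
    proof -
      have "3 \<le> norm (radial_part \<nu> z) \<or> 3 \<le> \<bar>\<nu> \<bullet> z\<bar> / K" using z unfolding cyl_norm_def by linarith
      then have "3\<^sup>2 \<le> (norm (radial_part \<nu> z))\<^sup>2 \<or> 3\<^sup>2 \<le> (\<bar>\<nu> \<bullet> z\<bar> / K)\<^sup>2"
        by (metis power_mono zero_le_numeral)
      then show ?thesis using S1(5)[of z] S2(5)[of z] by auto
    qed
  qed
qed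

text \<open>Rescalings of one profile, so \<open>B\<close> does not depend on s. The gradient bound
  of order 1/s is what cancels the factor s^p in the Poincare inequality on shells.\<close>

lemma cutoff_family:
  fixes \<nu> x0 :: "real ^ 'n"
  assumes \<nu>: "norm \<nu> = 1" and K: "0 < K"
  obtains \<zeta> B where "0 \<le> B" "\<And>s. 0 < s \<Longrightarrow> smooth (\<lambda>x. complex_of_real (\<zeta> s x))"
    "\<And>s x. 0 < s \<Longrightarrow> \<bar>\<zeta> s x\<bar> \<le> 1"
    "\<And>s x. 0 < s \<Longrightarrow> cyl_norm \<nu> K (x - x0) \<le> s \<Longrightarrow> \<zeta> s x = 1 \<and> cgrad (\<lambda>x. complex_of_real (\<zeta> s x)) x = 0"
    "\<And>s x. 0 < s \<Longrightarrow> 4 * s \<le> cyl_norm \<nu> K (x - x0) \<Longrightarrow> \<zeta> s x = 0 \<and> cgrad (\<lambda>x. complex_of_real (\<zeta> s x)) x = 0"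
    "\<And>s x. 0 < s \<Longrightarrow> norm (cgrad (\<lambda>x. complex_of_real (\<zeta> s x)) x) \<le> B / s"
proof -
  obtain \<zeta>1 where Z: "smooth (\<lambda>z. complex_of_real (\<zeta>1 z))" "\<And>z. 0 \<le> \<zeta>1 z" "\<And>z. \<zeta>1 z \<le> 1"
    "\<And>z. cyl_norm \<nu> K z \<le> 1 \<Longrightarrow> \<zeta>1 z = 1" "\<And>z. 3 \<le> cyl_norm \<nu> K z \<Longrightarrow> \<zeta>1 z = 0"
    using unit_cutoff[OF \<nu> K] by metis
  have "(\<lambda>z. complex_of_real (\<zeta>1 z)) \<in> test_functions UNIV"
  proof (rule test_functionsI[of _ "cball 0 ((1 + K) * 3)"])
    fix z :: "real ^ 'n" assume "z \<notin> cball 0 ((1 + K) * 3)"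
    then have "(1 + K) * 3 < (1 + K) * cyl_norm \<nu> K z" using norm_le_cyl_norm[OF \<nu> K, of z] by simp
    then have "3 < cyl_norm \<nu> K z" by (rule mult_left_less_imp_less) (use K in simp)
    then show "complex_of_real (\<zeta>1 z) = 0" using Z(5) by simp
  qed (use Z in auto)
  then obtain B where B: "\<And>z. norm (cgrad (\<lambda>z. complex_of_real (\<zeta>1 z)) z) \<le> B" "0 \<le> B"
    using test_functions_bounded by metis
  \<comment> \<open>the factor 4/5 makes \<open>\<zeta> s\<close> locally constant on the closed sets in question\<close>
  define \<zeta> where "\<zeta> s x = \<zeta>1 ((4 / (5 * s)) *\<^sub>R (x - x0))" for s x
  have scale: "cyl_norm \<nu> K ((4 / (5 * s)) *\<^sub>R z) = 4 / (5 * s) * cyl_norm \<nu> K z" if "0 < s" for s and z :: "real ^ 'n"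
    using that by (intro cyl_norm_scaleR) auto
  have cont: "continuous_on UNIV (\<lambda>x. cyl_norm \<nu> K (x - x0))"
    by (intro continuous_on_compose2[OF continuous_on_cyl_norm[OF K, of UNIV]] continuous_intros) auto
  show ?thesis
  proof (rule that[of B \<zeta>])
    show "0 \<le> B" by fact
    show "smooth (\<lambda>x. complex_of_real (\<zeta> s x))" if "0 < s" for s
      unfolding \<zeta>_def by (rule smooth_rescale[OF Z(1)])
    show "\<bar>\<zeta> s x\<bar> \<le> 1" for s x using Z(2,3) by (simp add: \<zeta>_def)
    show "norm (cgrad (\<lambda>x. complex_of_real (\<zeta> s x)) x) \<le> B / s" if "0 < s" for s x
    proof -
      let ?g = "norm (cgrad (\<lambda>z. complex_of_real (\<zeta>1 z)) ((4 / (5 * s)) *\<^sub>R (x - x0)))"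
      have "norm (cgrad (\<lambda>x. complex_of_real (\<zeta> s x)) x) = 4 / (5 * s) * ?g"
        unfolding \<zeta>_def cgrad_rescale[OF Z(1)] using that by simp
      also have "\<dots> \<le> 4 / (5 * s) * B" using that B by (intro mult_left_mono) auto
      also have "\<dots> \<le> B / s" using that B by (simp add: field_simps)
      finally show ?thesis .
    qed
    show "\<zeta> s x = 1 \<and> cgrad (\<lambda>x. complex_of_real (\<zeta> s x)) x = 0"
      if s: "0 < s" and x: "cyl_norm \<nu> K (x - x0) \<le> s" for s x
    proof -
      have 1: "\<zeta> s y = 1" if "cyl_norm \<nu> K (y - x0) < 5 / 4 * s" for y
        unfolding \<zeta>_def by (rule Z(4), unfold scale[OF s]) (use that s in \<open>simp add: field_simps\<close>)
      have o: "open {y. cyl_norm \<nu> K (y - x0) < 5 / 4 * s}"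
        using cont by (intro open_Collect_less continuous_on_const)
      have "\<forall>\<^sub>F y in nhds x. y \<in> {y. cyl_norm \<nu> K (y - x0) < 5 / 4 * s}"
        by (rule eventually_nhds_in_open[OF o]) (use x s in simp)
      then have "\<forall>\<^sub>F y in nhds x. complex_of_real (\<zeta> s y) = 1"
        by (rule eventually_mono) (simp add: 1)
      then have "cgrad (\<lambda>x. complex_of_real (\<zeta> s x)) x = 0" by (rule cgrad_eq_0_of_eventually_const)
      moreover have "\<zeta> s x = 1" using x s by (intro 1) simp
      ultimately show ?thesis by simp
    qed
    show "\<zeta> s x = 0 \<and> cgrad (\<lambda>x. complex_of_real (\<zeta> s x)) x = 0"
      if s: "0 < s" and x: "4 * s \<le> cyl_norm \<nu> K (x - x0)" for s x
    proof -
      have 0: "\<zeta> s y = 0" if "15 / 4 * s < cyl_norm \<nu> K (y - x0)" for y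
        unfolding \<zeta>_def by (rule Z(5), unfold scale[OF s]) (use that s in \<open>simp add: field_simps\<close>)
      have o: "open {y. 15 / 4 * s < cyl_norm \<nu> K (y - x0)}"
        using cont by (intro open_Collect_less continuous_on_const)
      have "\<forall>\<^sub>F y in nhds x. y \<in> {y. 15 / 4 * s < cyl_norm \<nu> K (y - x0)}"
        by (rule eventually_nhds_in_open[OF o]) (use x s in simp)
      then have "\<forall>\<^sub>F y in nhds x. complex_of_real (\<zeta> s y) = 0"
        by (rule eventually_mono) (simp add: 0)
      then have "cgrad (\<lambda>x. complex_of_real (\<zeta> s x)) x = 0" by (rule cgrad_eq_0_of_eventually_const)
      moreover have "\<zeta> s x = 0" using x s by (intro 0) simp
      ultimately show ?thesis by simp
    qed
  qed
qed

section \<open>Decay of energy away from a boundary point\<close>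

text \<open>What remains of the boundary near \<open>x0\<close>: one cone lies in \<Omega>, the
  opposite one outside. The horizontal unit vector \<open>e\<close>, along which points are pushed
  sideways, exists in dimension at least 2.\<close>

locale cone_point = bounded_domain \<Omega> p for \<Omega> :: "(real ^ 'n) set" and p +
  fixes x0 \<nu> e :: "real ^ 'n" and K R :: real
  assumes \<nu>: "norm \<nu> = 1" and e: "norm e = 1" "\<nu> \<bullet> e = 0" and K: "0 < K" and R: "0 < R"
    and cone_inside: "\<And>x. cyl_norm \<nu> K (x - x0) < R \<Longrightarrow> K * norm (radial_part \<nu> (x - x0)) < \<nu> \<bullet> (x - x0) \<Longrightarrow> x \<in> \<Omega>"
    and cone_outside: "\<And>x. cyl_norm \<nu> K (x - x0) < R \<Longrightarrow> \<nu> \<bullet> (x - x0) \<le> - K * norm (radial_part \<nu> (x - x0)) \<Longrightarrow> x \<notin> \<Omega>"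
begin

definition height :: "real ^ 'n \<Rightarrow> real" where "height x = \<nu> \<bullet> (x - x0)"
definition radius :: "real ^ 'n \<Rightarrow> real" where "radius x = norm (radial_part \<nu> (x - x0))"
definition N :: "real ^ 'n \<Rightarrow> real" where "N x = cyl_norm \<nu> K (x - x0)"

lemma N_eq: "N x = max (radius x) (\<bar>height x\<bar> / K)"
  by (simp add: N_def cyl_norm_def height_def radius_def)

lemma N_le_iff: "N x \<le> s \<longleftrightarrow> radius x \<le> s \<and> \<bar>height x\<bar> \<le> K * s"
  using K by (auto simp: N_eq field_simps)

lemma N_less_iff: "N x < s \<longleftrightarrow> radius x < s \<and> \<bar>height x\<bar> < K * s"
  using K by (auto simp: N_eq field_simps)

lemma inside: "N x < R \<Longrightarrow> K * radius x < height x \<Longrightarrow> x \<in> \<Omega>"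
  using cone_inside by (simp add: N_def height_def radius_def)

lemma outside: "N x < R \<Longrightarrow> height x \<le> - (K * radius x) \<Longrightarrow> x \<notin> \<Omega>"
  using cone_outside by (simp add: N_def height_def radius_def)

lemma height_add_\<nu>: "height (x + c *\<^sub>R \<nu>) = height x + c"
proof -
  have "x + c *\<^sub>R \<nu> - x0 = (x - x0) + c *\<^sub>R \<nu>" by simp
  then show ?thesis using \<nu> unfolding height_def by (simp only: inner_add_right) (simp add: dot_square_norm)
qed

lemma radius_add_\<nu>: "radius (x + c *\<^sub>R \<nu>) = radius x"
proof -
  have "x + c *\<^sub>R \<nu> - x0 = (x - x0) + c *\<^sub>R \<nu>" by simp
  then show ?thesis using radial_part_self[OF \<nu>] unfolding radius_def by (simp only: radial_part_add) simp
qed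

lemma height_add_e: "height (x + c *\<^sub>R e) = height x"
proof -
  have "x + c *\<^sub>R e - x0 = (x - x0) + c *\<^sub>R e" by simp
  then show ?thesis using e unfolding height_def by (simp only: inner_add_right) simp
qed

lemma radius_add_e: "\<bar>c\<bar> - radius x \<le> radius (x + c *\<^sub>R e)" "radius (x + c *\<^sub>R e) \<le> radius x + \<bar>c\<bar>"
proof -
  have *: "x + c *\<^sub>R e - x0 = (x - x0) + c *\<^sub>R e" by simp
  have **: "radius (x + c *\<^sub>R e) = norm (radial_part \<nu> (x - x0) + c *\<^sub>R e)"
    unfolding radius_def * radial_part_add radial_part_orthogonal[OF e(2)] ..
  show "radius (x + c *\<^sub>R e) \<le> radius x + \<bar>c\<bar>"
    unfolding ** unfolding radius_def using norm_triangle_ineq[of "radial_part \<nu> (x - x0)" "c *\<^sub>R e"] e(1) by simp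
  show "\<bar>c\<bar> - radius x \<le> radius (x + c *\<^sub>R e)"
    unfolding ** unfolding radius_def
    using norm_diff_ineq[of "c *\<^sub>R e" "radial_part \<nu> (x - x0)"] e(1) by (simp add: add.commute)
qed

lemma continuous_height: "continuous_on UNIV height"
  unfolding height_def by (intro continuous_intros)

lemma continuous_radius: "continuous_on UNIV radius"
  unfolding radius_def
  by (intro continuous_on_norm continuous_on_compose2[OF continuous_on_radial_part[of UNIV]] continuous_intros) auto

lemma measurable_coordinates [measurable]:
  "height \<in> borel_measurable borel" "radius \<in> borel_measurable borel" "N \<in> borel_measurable borel"
proof -
  show h: "height \<in> borel_measurable borel" by (rule borel_measurable_continuous_onI[OF continuous_height])
  show r: "radius \<in> borel_measurable borel" by (rule borel_measurable_continuous_onI[OF continuous_radius])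
  show "N \<in> borel_measurable borel" unfolding N_eq[abs_def] using h r by measurable
qed

text \<open>The ratio 4 matches \<open>cutoffs\<close>: inside \<Omega>, the gradient of the cutoff
  at scale s can be nonzero only here.\<close>

definition shell :: "real \<Rightarrow> (real ^ 'n) set" where "shell s = {x \<in> \<Omega>. s < N x \<and> N x \<le> 4 * s}"

lemma shell_measurable [measurable]: "shell s \<in> sets borel"
proof -
  have "{x. s < N x \<and> N x \<le> 4 * s} \<in> sets borel" by measurable
  moreover have "shell s = \<Omega> \<inter> {x. s < N x \<and> N x \<le> 4 * s}" by (auto simp: shell_def)
  ultimately show ?thesis by auto
qed

text \<open>Points of the shell beside the axis are pushed down out of the domain, those above the inner
  cylinder are first pushed sideways.  There are none below, since the domain lies above the cone.\<close>

lemma shell_Poincare: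
  fixes u :: "real ^ 'n \<Rightarrow> complex"
  assumes u: "smooth u" and s: "0 < s" "12 * s < R"
    and zero: "\<And>x. x \<notin> \<Omega> \<Longrightarrow> s < N x \<Longrightarrow> u x = 0 \<and> cgrad u x = 0"
  shows "(\<integral>\<^sup>+x. ennreal (norm (u x) powr p) * indicator (shell s) x \<partial>lborel) \<le>
    ennreal (((1 + 2 powr p) * (8 * K) powr p + 2 powr p * 3 powr p) * s powr p) *
    (\<integral>\<^sup>+x. ennreal (norm (cgrad u x) powr p) * indicator (shell s) x \<partial>lborel)"
proof -
  have [measurable]: "u \<in> borel_measurable borel"
    by (intro borel_measurable_continuous_onI smooth_imp_continuous_on u)
  define side where "side = {x. s < radius x \<and> radius x \<le> 4 * s \<and> \<bar>height x\<bar> \<le> 4 * K * s}"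
  define upper where "upper = {x. radius x \<le> s \<and> K * s < height x \<and> height x \<le> 4 * K * s}"
  have [measurable]: "side \<in> sets borel" "upper \<in> sets borel" unfolding side_def upper_def by measurable
  define I where "I A = (\<integral>\<^sup>+x. ennreal (norm (u x) powr p) * indicator A x \<partial>lborel)" for A
  define G where "G = (\<integral>\<^sup>+x. ennreal (norm (cgrad u x) powr p) * indicator (shell s) x \<partial>lborel)"
  have Ks: "0 < K * s" using K s by simp
  have shell_or: "x \<in> shell s \<or> cgrad u x = 0" if "s < N x" "N x \<le> 4 * s" for x
    using that zero by (auto simp: shell_def)
  \<comment> \<open>Heights in \<open>side\<close> lie between -4Ks and 4Ks. Moving down by 8Ks
    gives heights between -12Ks and -4Ks at radius at most 4s, hence points below the lower cone.
    This reach is the reason for 12 s < R.\<close>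
  let ?v = "- (8 * K * s) *\<^sub>R \<nu>"
  have below: "x \<notin> \<Omega> \<and> s < N x" if "s < radius x" "radius x \<le> 4 * s" "height x \<le> - 4 * K * s" "- 12 * K * s \<le> height x" for x
  proof
    have "N x \<le> 12 * s" unfolding N_le_iff using that s Ks by (auto simp: abs_le_iff mult_ac)
    then have "N x < R" using s by simp
    moreover have "K * radius x \<le> K * (4 * s)" using that K by (intro mult_left_mono) auto
    ultimately show "x \<notin> \<Omega>" using that by (intro outside) (auto simp: mult_ac)
    show "s < N x" using that by (simp add: N_eq)
  qed
  have side1: "u (x + ?v) = 0" if "x \<in> side" for x
  proof -
    have "radius (x + ?v) = radius x" "height (x + ?v) = height x - 8 * K * s"
      by (simp_all only: radius_add_\<nu> height_add_\<nu>)
    then have "x + ?v \<notin> \<Omega> \<and> s < N (x + ?v)" using that by (intro below) (auto simp: side_def)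
    then show ?thesis using zero by blast
  qed
  have "(\<integral>\<^sup>+x. ennreal (norm (u (x + ?v) - u x) powr p) * indicator side x \<partial>lborel) \<le> ennreal (norm ?v powr p) * G"
    unfolding G_def
  proof (rule translation_estimate[OF u p_gt_1])
    fix x and t :: real assume x: "x \<in> side" and t: "0 \<le> t" "t \<le> 1"
    let ?y = "x + t *\<^sub>R ?v"
    have y: "?y = x + (- (t * (8 * K * s))) *\<^sub>R \<nu>" by simp
    have r: "radius ?y = radius x" and h: "height ?y = height x - t * (8 * K * s)"
      unfolding y radius_add_\<nu> height_add_\<nu> by simp_all
    have t8: "0 \<le> t * (8 * K * s)" "t * (8 * K * s) \<le> 8 * K * s" using t Ks by (auto simp: mult_left_le_one_le)
    \<comment> \<open>On the way down a point lies in the shell, off the domain, or already below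
      the cone. Its radius exceeds s throughout, so it never enters the inner cylinder, where u need
      not vanish off \<Omega>.\<close>
    show "?y \<in> shell s \<or> cgrad u ?y = 0"
    proof (cases "height ?y \<le> - 4 * K * s")
      case True
      then have "?y \<notin> \<Omega> \<and> s < N ?y" using x t8 r h by (intro below) (auto simp: side_def)
      then show ?thesis using zero by blast
    next
      case False
      have "s < N ?y" unfolding N_eq r using x by (simp add: side_def less_max_iff_disj)
      moreover have "N ?y \<le> 4 * s"
        using x t8 r False unfolding N_le_iff h by (auto simp: side_def abs_le_iff mult_ac)
      ultimately show ?thesis by (rule shell_or)
    qed
  qed measurable
  also have "(\<integral>\<^sup>+x. ennreal (norm (u (x + ?v) - u x) powr p) * indicator side x \<partial>lborel) = I side"
    unfolding I_def using side1 by (intro nn_integral_cong) (auto simp: indicator_def)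
  also have "norm ?v powr p = (8 * K) powr p * s powr p"
    using \<nu> K s by (simp add: powr_mult)
  finally have I_side: "I side \<le> ennreal ((8 * K) powr p * s powr p) * G" .
  \<comment> \<open>A sideways shift by 3s takes radii up to s into the range from 2s to 4s, that is
    into \<open>side\<close>; heights above Ks keep the segment out of the inner cylinder.\<close>
  let ?w = "(3 * s) *\<^sub>R e"
  have upper1: "x + ?w \<in> side" if "x \<in> upper" for x
  proof -
    have "height (x + ?w) = height x" by (rule height_add_e)
    moreover have "2 * s \<le> radius (x + ?w)" "radius (x + ?w) \<le> 4 * s"
      using radius_add_e[where c = "3 * s" and x = x] that s by (auto simp: upper_def)
    ultimately show ?thesis using that s Ks by (auto simp: side_def upper_def)
  qed
  have w: "(\<integral>\<^sup>+x. ennreal (norm (u (x + ?w) - u x) powr p) * indicator upper x \<partial>lborel) \<le> ennreal (norm ?w powr p) * G"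
    unfolding G_def
  proof (rule translation_estimate[OF u p_gt_1])
    fix x and t :: real assume x: "x \<in> upper" and t: "0 \<le> t" "t \<le> 1"
    let ?y = "x + t *\<^sub>R ?w"
    have y: "?y = x + (t * (3 * s)) *\<^sub>R e" by simp
    have t3: "0 \<le> t * (3 * s)" "t * (3 * s) \<le> 3 * s" using t s by (auto simp: mult_left_le_one_le)
    have h: "height ?y = height x" unfolding y by (rule height_add_e)
    have r: "radius ?y \<le> 4 * s" using radius_add_e(2)[where c = "t * (3 * s)" and x = x] x t3 unfolding y by (auto simp: upper_def)
    have "N ?y \<le> 4 * s" unfolding N_le_iff h using r x Ks by (auto simp: upper_def abs_le_iff mult_ac)
    moreover have "\<not> N ?y \<le> s" unfolding N_le_iff h using x Ks by (auto simp: upper_def)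
    ultimately show "?y \<in> shell s \<or> cgrad u ?y = 0" by (intro shell_or) auto
  qed measurable
  \<comment> \<open>u(x) is compared with u(x + w): the increment is controlled by the gradient, and
    the integral of the shifted values is at most the one over \<open>side\<close>.\<close>
  have "I upper \<le> (\<integral>\<^sup>+x. ennreal (2 powr p) * (ennreal (norm (u (x + ?w) - u x) powr p) * indicator upper x +
      ennreal (norm (u (x + ?w)) powr p) * indicator side (x + ?w)) \<partial>lborel)"
    unfolding I_def
  proof (rule nn_integral_mono)
    fix x
    show "ennreal (norm (u x) powr p) * indicator upper x \<le> ennreal (2 powr p) *
        (ennreal (norm (u (x + ?w) - u x) powr p) * indicator upper x + ennreal (norm (u (x + ?w)) powr p) * indicator side (x + ?w))"
    proof (cases "x \<in> upper")
      case True
      have "norm (u x) powr p \<le> 2 powr p * (norm (u (x + ?w) - u x) powr p + norm (u (x + ?w)) powr p)"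
        using norm_diff_powr_le[OF p_nonneg(1), of "u (x + ?w)" "u (x + ?w) - u x"] by (simp add: add.commute)
      then have "ennreal (norm (u x) powr p) \<le> ennreal (2 powr p * (norm (u (x + ?w) - u x) powr p + norm (u (x + ?w)) powr p))"
        by (rule ennreal_leI)
      then show ?thesis using True upper1[OF True] by (simp add: ennreal_mult ennreal_plus)
    qed simp
  qed
  also have "\<dots> = ennreal (2 powr p) * ((\<integral>\<^sup>+x. ennreal (norm (u (x + ?w) - u x) powr p) * indicator upper x \<partial>lborel) +
      (\<integral>\<^sup>+x. ennreal (norm (u (x + ?w)) powr p) * indicator side (x + ?w) \<partial>lborel))"
    by (subst nn_integral_cmult, measurable, subst nn_integral_add) measurable
  also have "(\<integral>\<^sup>+x. ennreal (norm (u (x + ?w)) powr p) * indicator side (x + ?w) \<partial>lborel) = I side"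
    unfolding I_def by (rule nn_integral_lborel_translate[of "\<lambda>x. ennreal (norm (u x) powr p) * indicator side x"]) measurable
  finally have "I upper \<le> ennreal (2 powr p) * ((\<integral>\<^sup>+x. ennreal (norm (u (x + ?w) - u x) powr p) * indicator upper x \<partial>lborel) + I side)" .
  also have "\<dots> \<le> ennreal (2 powr p) * (ennreal (3 powr p * s powr p) * G + ennreal ((8 * K) powr p * s powr p) * G)"
    using w I_side e s by (intro mult_left_mono add_mono) (auto simp: powr_mult)
  finally have I_upper: "I upper \<le> ennreal (2 powr p) * (ennreal (3 powr p * s powr p) * G + ennreal ((8 * K) powr p * s powr p) * G)" .
  have "I (shell s) \<le> (\<integral>\<^sup>+x. ennreal (norm (u x) powr p) * indicator side x + ennreal (norm (u x) powr p) * indicator upper x \<partial>lborel)"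
    unfolding I_def
  proof (rule nn_integral_mono)
    fix x
    have "x \<in> side \<or> x \<in> upper" if x: "x \<in> shell s"
    proof (cases "s < radius x")
      case True
      then show ?thesis using x by (auto simp: shell_def side_def N_le_iff mult_ac)
    next
      case False
      then have "K * s < \<bar>height x\<bar>" using x N_le_iff[of x s] by (auto simp: shell_def)
      \<comment> \<open>With radius at most s, a height below -Ks means lying under the lower cone,
        hence off \<Omega>.\<close>
      moreover have "\<not> height x < - (K * s)"
      proof
        assume "height x < - (K * s)"
        moreover have "K * radius x \<le> K * s" using False K by (intro mult_left_mono) auto
        ultimately have "height x \<le> - (K * radius x)" by simp
        moreover have "N x < R" using x s by (auto simp: shell_def)
        ultimately show False using outside x by (auto simp: shell_def)
      qed
      ultimately have "K * s < height x" by linarith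
      then show ?thesis using False x by (auto simp: shell_def upper_def N_le_iff mult_ac)
    qed
    then show "ennreal (norm (u x) powr p) * indicator (shell s) x \<le>
        ennreal (norm (u x) powr p) * indicator side x + ennreal (norm (u x) powr p) * indicator upper x"
      by (auto simp: indicator_def)
  qed
  also have "\<dots> = I side + I upper" unfolding I_def by (rule nn_integral_add) measurable
  also have "\<dots> \<le> ennreal ((8 * K) powr p * s powr p) * G +
      ennreal (2 powr p) * (ennreal (3 powr p * s powr p) * G + ennreal ((8 * K) powr p * s powr p) * G)"
    by (intro add_mono I_side I_upper)
  also have "\<dots> = ennreal (((1 + 2 powr p) * (8 * K) powr p + 2 powr p * 3 powr p) * s powr p) * G"
  proof -
    have *: "((1 + 2 powr p) * (8 * K) powr p + 2 powr p * 3 powr p) * s powr p =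
        (8 * K) powr p * s powr p + 2 powr p * (3 powr p * s powr p + (8 * K) powr p * s powr p)"
      by (simp add: algebra_simps)
    show ?thesis unfolding * by (simp add: ennreal_plus ennreal_mult' distrib_right mult.assoc)
  qed
  finally show ?thesis unfolding I_def G_def .
qed

end

context bounded_domain
begin

lemma integrable_indicator_mult:
  fixes h :: "real ^ 'n \<Rightarrow> real"
  assumes "A \<in> sets borel" "integrable M h"
  shows "integrable M (\<lambda>x. indicator A x * h x)"
proof (rule Bochner_Integration.integrable_bound[OF assms(2)])
  have "indicator A \<in> borel_measurable lebesgue" using assms(1) by (intro borel_measurable_indicator) auto
  then have "(indicator A :: real ^ 'n \<Rightarrow> real) \<in> borel_measurable M" by (rule measurable_restrict_space1)
  then show "(\<lambda>x. indicator A x * h x) \<in> borel_measurable M"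
    by (rule borel_measurable_times) (rule borel_measurable_integrable[OF assms(2)])
qed (auto simp: indicator_def)

end

context cone_point
begin

text \<open>Every competitor equals 1 on a piece \<open>A\<close> of the complement near the point
  and 0 at the upper ends of vertical segments of length \<open>D\<close>, so each segment carries
  an increment of 1. The translation estimate bounds the measure of \<open>A\<close> by D^p times
  the gradient integral, whatever \<phi> is.\<close>

lemma energy_support_positive:
  assumes f: "smooth f" and \<sigma>: "0 < \<sigma>" "4 * \<sigma> < R"
    and one: "\<And>x. N x \<le> \<sigma> \<Longrightarrow> f x = 1 \<and> cgrad f x = 0"
    and zero: "\<And>x. 4 * \<sigma> \<le> N x \<Longrightarrow> f x = 0 \<and> cgrad f x = 0"
  obtains \<delta> where "0 < \<delta>" "\<And>\<phi>. \<phi> \<in> test_functions \<Omega> \<Longrightarrow>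
    \<delta> \<le> (LINT x|M. norm (cgrad (\<lambda>x. f x + \<phi> x) x) powr p)"
proof -
  have K\<sigma>: "0 < K * \<sigma>" using K \<sigma> by simp
  \<comment> \<open>Under the lower cone and within the inner cylinder: here K radius < K \<sigma> /
    2 < - height, so \<phi> vanishes and f is 1.\<close>
  define A where "A = {x. radius x < \<sigma> / 2 \<and> - (K * \<sigma>) < height x \<and> height x < - (K * \<sigma>) / 2}"
  have "open A" unfolding A_def
    by (intro open_Collect_conj open_Collect_less continuous_height continuous_radius continuous_on_const)
  moreover have "A \<noteq> {}"
  proof -
    let ?x = "x0 + (- (3 / 4 * (K * \<sigma>))) *\<^sub>R \<nu>"
    have "radius x0 = 0" "height x0 = 0" by (simp_all add: radius_def height_def radial_part_def)
    then have "radius ?x = 0" "height ?x = - (3 / 4 * (K * \<sigma>))"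
      unfolding radius_add_\<nu> height_add_\<nu> by simp_all
    then have "?x \<in> A" using \<sigma> K\<sigma> unfolding A_def by simp
    then show ?thesis by blast
  qed
  ultimately have "\<not> negligible A" by (rule open_not_negligible)
  then have "A \<notin> null_sets lebesgue" by (simp add: negligible_iff_null_sets)
  then have A0: "emeasure lborel A \<noteq> 0" using \<open>open A\<close> by (simp add: null_sets_def)
  have [measurable]: "A \<in> sets borel" using \<open>open A\<close> by simp
  \<comment> \<open>Capping at 1 guards the conversion to a real number, since
    \<open>enn2real\<close> would send an infinite measure to 0.\<close>
  define \<alpha> where "\<alpha> = enn2real (min (emeasure lborel A) 1)"
  have \<alpha>e: "ennreal \<alpha> = min (emeasure lborel A) 1"
    unfolding \<alpha>_def by (intro ennreal_enn2real) (simp add: min_less_iff_disj)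
  have \<alpha>: "0 < \<alpha>"
  proof -
    have "min (emeasure lborel A) 1 \<noteq> 0" using A0 by (simp add: min_def)
    then show ?thesis using \<alpha>e by (metis ennreal_0 enn2real_nonneg \<alpha>_def less_eq_real_def)
  qed
  obtain R1 where R1: "\<And>x. x \<in> \<Omega> \<Longrightarrow> norm (x - x0) \<le> R1" "0 < R1"
  proof -
    have "bounded ((\<lambda>x. x - x0) ` \<Omega>)"
      using bounded_translation[OF \<Omega>_bounded, of "- x0"] by simp
    then show ?thesis using that unfolding bounded_pos by auto
  qed
  \<comment> \<open>From heights above -K \<sigma> this climbs past R1 + 5 K \<sigma>: above every
    point of \<Omega> and above the support of f, which ends at 4 K \<sigma>.\<close>
  define D where "D = R1 + 6 * (K * \<sigma>)"
  have D: "0 < D" using R1(2) K\<sigma> by (simp add: D_def)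
  show ?thesis
  proof (rule that[of "\<alpha> / D powr p"])
    show "0 < \<alpha> / D powr p" using \<alpha> D by simp
    fix \<phi> assume \<phi>: "\<phi> \<in> test_functions \<Omega>"
    let ?u = "\<lambda>x. f x + \<phi> x"
    note sm\<phi> = test_functions_smooth[OF \<phi>]
    have sm: "smooth ?u" by (intro smooth_add f sm\<phi>)
    obtain L where L: "L \<subseteq> \<Omega>" "\<And>x. x \<notin> L \<Longrightarrow> \<phi> x = 0" "\<And>x. x \<notin> L \<Longrightarrow> cgrad \<phi> x = 0"
      by (rule test_functionsE[OF \<phi>]) blast
    have \<phi>0: "\<phi> x = 0" "cgrad \<phi> x = 0" if "x \<notin> \<Omega>" for x using L that by auto
    have start: "?u x = 1" if x: "x \<in> A" for x
    proof -
      have "N x \<le> \<sigma>" unfolding N_le_iff using x \<sigma> K\<sigma> by (auto simp: A_def abs_le_iff)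
      moreover have "x \<notin> \<Omega>"
      proof (rule outside)
        show "N x < R" using \<open>N x \<le> \<sigma>\<close> \<sigma> by simp
        have "K * radius x \<le> K * (\<sigma> / 2)" using x K by (intro mult_left_mono) (auto simp: A_def)
        then show "height x \<le> - (K * radius x)" using x by (simp add: A_def)
      qed
      ultimately show ?thesis using one \<phi>0 by simp
    qed
    have end0: "?u (x + D *\<^sub>R \<nu>) = 0" if x: "x \<in> A" for x
    proof -
      let ?y = "x + D *\<^sub>R \<nu>"
      have h: "height ?y > R1 + 5 * (K * \<sigma>)" unfolding height_add_\<nu> using x by (simp add: A_def D_def)
      have "height ?y \<le> norm (?y - x0)"
        unfolding height_def using norm_cauchy_schwarz[of \<nu> "?y - x0"] \<nu> by simp
      then have "?y \<notin> \<Omega>" using h K\<sigma> R1(1)[of ?y] by auto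
      moreover have "\<not> N ?y < 4 * \<sigma>" unfolding N_less_iff using h R1(2) K\<sigma> by (auto simp: mult_ac)
      ultimately show ?thesis using zero[of ?y] \<phi>0 by simp
    qed
    have "(\<integral>\<^sup>+x. ennreal (norm (?u (x + D *\<^sub>R \<nu>) - ?u x) powr p) * indicator A x \<partial>lborel)
      \<le> ennreal (norm (D *\<^sub>R \<nu>) powr p) * (\<integral>\<^sup>+x. ennreal (norm (cgrad ?u x) powr p) * indicator \<Omega> x \<partial>lborel)"
    proof (rule translation_estimate[OF sm p_gt_1])
      fix x and t :: real assume x: "x \<in> A" and t: "0 \<le> t" "t \<le> 1"
      let ?y = "x + t *\<^sub>R D *\<^sub>R \<nu>"
      have y: "?y = x + (t * D) *\<^sub>R \<nu>" by simp
      have tD: "0 \<le> t * D" using t D by simp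
      have r: "radius ?y = radius x" and h: "height ?y = height x + t * D"
        unfolding y radius_add_\<nu> height_add_\<nu> by simp_all
      show "?y \<in> \<Omega> \<or> cgrad ?u ?y = 0"
      proof (cases "?y \<in> \<Omega>")
        case False
        \<comment> \<open>Off \<Omega> the gradient of f has to vanish on the segment. Where f
          varies, the small radius forces a height above K \<sigma>, because the segment starts
          above -K \<sigma> and goes up; this puts the point into the upper cone and so into
          \<Omega>.\<close>
        have "N ?y \<le> \<sigma> \<or> 4 * \<sigma> \<le> N ?y"
        proof (rule ccontr)
          assume "\<not> (N ?y \<le> \<sigma> \<or> 4 * \<sigma> \<le> N ?y)"
          then have n: "\<not> N ?y \<le> \<sigma>" "N ?y < 4 * \<sigma>" by auto
          have "K * \<sigma> < \<bar>height ?y\<bar>" using n(1) r x \<sigma> unfolding N_le_iff by (auto simp: A_def)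
          moreover have "- (K * \<sigma>) < height ?y" using h tD x by (simp add: A_def)
          ultimately have "K * \<sigma> < height ?y" by linarith
          moreover have "K * radius ?y \<le> K * \<sigma>" using r x \<sigma> K by (intro mult_left_mono) (auto simp: A_def)
          ultimately have "?y \<in> \<Omega>" using n(2) \<sigma> by (intro inside) auto
          with False show False by blast
        qed
        then have "cgrad f ?y = 0" using one zero by blast
        then show ?thesis using \<phi>0(2)[OF False] cgrad_add[OF f sm\<phi>] by simp
      qed simp
    qed simp_all
    also have "(\<integral>\<^sup>+x. ennreal (norm (?u (x + D *\<^sub>R \<nu>) - ?u x) powr p) * indicator A x \<partial>lborel) = emeasure lborel A"
    proof -
      have "(\<integral>\<^sup>+x. ennreal (norm (?u (x + D *\<^sub>R \<nu>) - ?u x) powr p) * indicator A x \<partial>lborel) = (\<integral>\<^sup>+x. indicator A x \<partial>lborel)"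
      proof (rule nn_integral_cong)
        fix x
        show "ennreal (norm (?u (x + D *\<^sub>R \<nu>) - ?u x) powr p) * indicator A x = indicator A x"
        proof (cases "x \<in> A")
          case True
          have "norm (?u (x + D *\<^sub>R \<nu>) - ?u x) powr p = 1"
            unfolding start[OF True] end0[OF True] by simp
          then show ?thesis by simp
        qed simp
      qed
      then show ?thesis by simp
    qed
    also have "(\<integral>\<^sup>+x. ennreal (norm (cgrad ?u x) powr p) * indicator \<Omega> x \<partial>lborel) = ennreal (LINT x|M. indicator \<Omega> x * norm (cgrad ?u x) powr p)"
      by (intro nn_integral_eq_M smooth_norm_powr_measurable sm LpD(2)[OF smooth_Lp(2)[OF sm]]) auto
    also have "(LINT x|M. indicator \<Omega> x * norm (cgrad ?u x) powr p) = (LINT x|M. norm (cgrad ?u x) powr p)"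
      by (intro Bochner_Integration.integral_cong) auto
    finally have "emeasure lborel A \<le> ennreal (norm (D *\<^sub>R \<nu>) powr p * (LINT x|M. norm (cgrad ?u x) powr p))"
      by (simp add: ennreal_mult')
    then have "ennreal \<alpha> \<le> ennreal (D powr p * (LINT x|M. norm (cgrad ?u x) powr p))"
      using \<alpha>e D \<nu> by (simp add: min.coboundedI1)
    moreover have "0 \<le> (LINT x|M. norm (cgrad ?u x) powr p)" by (intro Bochner_Integration.integral_nonneg) auto
    ultimately have "\<alpha> \<le> D powr p * (LINT x|M. norm (cgrad ?u x) powr p)" by simp
    then show "\<alpha> / D powr p \<le> (LINT x|M. norm (cgrad ?u x) powr p)" using D by (simp add: field_simps)
  qed
qed

end

lemmas (in cone_point) cutoffs = cutoff_family[OF \<nu> K, of x0, folded N_def]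

section \<open>Hole filling and decay over scales\<close>

locale weighted_cone = weighted_domain \<Omega> p \<gamma> + cone_point \<Omega> p x0 \<nu> e K R
  for \<Omega> :: "(real ^ 'n) set" and p \<gamma> x0 \<nu> e K R
begin

definition far_energy :: "(real ^ 'n \<Rightarrow> complex) \<Rightarrow> real \<Rightarrow> real" where
  "far_energy u s = (LINT x|M. indicator {x. s < N x} x * (\<gamma> x * norm (cgrad u x) powr p))"

lemma far_set_measurable [measurable]: "{x. s < N x} \<in> sets borel"
  by measurable

lemma far_energy_le:
  assumes "smooth u" shows "far_energy u s \<le> energy (cgrad u)"
  unfolding far_energy_def energy_def
  by (intro integral_mono integrable_indicator_mult energy_integrable smooth_Lp assms far_set_measurable)
     (auto simp: indicator_def \<gamma>_nonneg)

text \<open>Widman's hole filling: comparing with the truncation \<open>\<zeta>\<^sub>s u\<close> bounds the energy outside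
  by a multiple of the energy in the shell.\<close>

lemma hole_filling:
  obtains D where "1 \<le> D" "\<And>f \<phi> Q \<epsilon> \<rho> s. smooth f \<Longrightarrow> \<phi> \<in> test_functions \<Omega> \<Longrightarrow>
     (\<And>\<psi>. \<psi> \<in> test_functions \<Omega> \<Longrightarrow> Q \<le> energy (cgrad (\<lambda>x. f x + \<psi> x))) \<Longrightarrow>
     energy (cgrad (\<lambda>x. f x + \<phi> x)) \<le> Q + \<epsilon> \<Longrightarrow> 0 \<le> \<epsilon> \<Longrightarrow> 0 < \<rho> \<Longrightarrow> \<rho> \<le> s \<Longrightarrow> 12 * s < R \<Longrightarrow>
     (\<And>x. \<rho> \<le> N x \<Longrightarrow> f x = 0 \<and> cgrad f x = 0) \<Longrightarrow>
     far_energy (\<lambda>x. f x + \<phi> x) (4 * s) \<le> (1 - 1 / D) * far_energy (\<lambda>x. f x + \<phi> x) s + \<epsilon>"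
proof -
  obtain c C where C: "0 < c" "0 < C" "\<And>x. x \<in> closure \<Omega> \<Longrightarrow> c \<le> \<gamma> x \<and> \<gamma> x \<le> C" by (rule \<gamma>_bounds) blast
  have \<gamma>: "c \<le> \<gamma> x" "\<gamma> x \<le> C" "0 \<le> \<gamma> x" if "x \<in> \<Omega>" for x
    using C(3)[of x] that closure_subset[of \<Omega>] \<gamma>_nonneg by auto
  obtain \<zeta> B where B: "0 \<le> B" and \<zeta>: "\<And>s. 0 < s \<Longrightarrow> smooth (\<lambda>x. complex_of_real (\<zeta> s x))"
    "\<And>s x. 0 < s \<Longrightarrow> \<bar>\<zeta> s x\<bar> \<le> 1"
    "\<And>s x. 0 < s \<Longrightarrow> N x \<le> s \<Longrightarrow> \<zeta> s x = 1 \<and> cgrad (\<lambda>x. complex_of_real (\<zeta> s x)) x = 0"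
    "\<And>s x. 0 < s \<Longrightarrow> 4 * s \<le> N x \<Longrightarrow> \<zeta> s x = 0 \<and> cgrad (\<lambda>x. complex_of_real (\<zeta> s x)) x = 0"
    "\<And>s x. 0 < s \<Longrightarrow> norm (cgrad (\<lambda>x. complex_of_real (\<zeta> s x)) x) \<le> B / s"
    by (rule cutoffs, rule that)
  define P where "P = (1 + 2 powr p) * (8 * K) powr p + 2 powr p * 3 powr p"
  have P: "0 \<le> P" by (simp add: P_def)
  \<comment> \<open>2^p comes from splitting the gradient of the truncation, B^p from the cutoff, P
    from the shell inequality, and C / c from passing between weighted and unweighted integrals. The
    powers of s cancel, so one D serves all scales.\<close>
  define D where "D = 2 powr p * (1 + B powr p * (C * (P / c)))"
  have D1: "1 \<le> D"
  proof -
    have "1 \<le> 2 powr p" using p_gt_1 by (simp add: ge_one_powr_ge_zero)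
    moreover have "0 \<le> B powr p * (C * (P / c))" using C P by simp
    ultimately show ?thesis unfolding D_def using mult_mono[of 1 "2 powr p" 1 "1 + B powr p * (C * (P / c))"] by simp
  qed
  show ?thesis
  proof (rule that[OF D1])
    fix f \<phi> :: "real ^ 'n \<Rightarrow> complex" and Q \<epsilon> \<rho> s
    assume f: "smooth f" and \<phi>: "\<phi> \<in> test_functions \<Omega>"
      and Q: "\<And>\<psi>. \<psi> \<in> test_functions \<Omega> \<Longrightarrow> Q \<le> energy (cgrad (\<lambda>x. f x + \<psi> x))"
      and near: "energy (cgrad (\<lambda>x. f x + \<phi> x)) \<le> Q + \<epsilon>" and \<epsilon>: "0 \<le> \<epsilon>"
      and \<rho>: "0 < \<rho>" "\<rho> \<le> s" and sR: "12 * s < R"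
      and f0: "\<And>x. \<rho> \<le> N x \<Longrightarrow> f x = 0 \<and> cgrad f x = 0"
    have s: "0 < s" using \<rho> by simp
    define u where "u x = f x + \<phi> x" for x
    let ?z = "\<lambda>x. complex_of_real (\<zeta> s x)"
    define w where "w x = ?z x * u x" for x
    note sm\<phi> = test_functions_smooth[OF \<phi>]
    have u: "smooth u" unfolding u_def by (intro smooth_add f sm\<phi>)
    have w: "smooth w" unfolding w_def by (intro smooth_mult \<zeta>(1) s u)
    obtain L where L: "L \<subseteq> \<Omega>" "\<And>x. x \<notin> L \<Longrightarrow> \<phi> x = 0" "\<And>x. x \<notin> L \<Longrightarrow> cgrad \<phi> x = 0"
      by (rule test_functionsE[OF \<phi>]) blast
    \<comment> \<open>Beyond \<rho> the data vanish, and off \<Omega> so does \<phi>: the boundary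
      condition for the shell inequality.\<close>
    have u0: "u x = 0 \<and> cgrad u x = 0" if "x \<notin> \<Omega>" "s < N x" for x
    proof -
      have "\<phi> x = 0" "cgrad \<phi> x = 0" using L that by auto
      moreover have "f x = 0" "cgrad f x = 0" using f0[of x] that \<rho> by auto
      ultimately show ?thesis unfolding u_def by (simp add: cgrad_add[OF f sm\<phi>])
    qed
    \<comment> \<open>The data live where the cutoff is 1, so w differs from f by a test function
      and competes with u.\<close>
    have "?z x * f x = f x" for x
      using \<zeta>(3)[OF s, of x] f0[of x] \<rho> by (cases "N x \<le> s") auto
    then have "w = (\<lambda>x. f x + ?z x * \<phi> x)" by (auto simp: w_def u_def distrib_left)
    then have Qw: "Q \<le> energy (cgrad w)" using Q[OF test_functions_mult[OF \<zeta>(1)[OF s] \<phi>]] by simp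
    let ?sh = "indicator (shell s) :: real ^ 'n \<Rightarrow> real"
    let ?g = "\<lambda>x. \<gamma> x * norm (cgrad u x) powr p"
    define E where "E = (LINT x|M. ?sh x * ?g x)"
    define U where "U = (LINT x|M. ?sh x * norm (u x) powr p)"
    note Ig = energy_integrable[OF smooth_Lp(2)[OF u]]
    note Iu = LpD(2)[OF smooth_Lp(1)[OF u]]
    note Icu = LpD(2)[OF smooth_Lp(2)[OF u]]
    have IE: "integrable M (\<lambda>x. ?sh x * ?g x)" by (rule integrable_indicator_mult[OF shell_measurable Ig])
    have IU: "integrable M (\<lambda>x. ?sh x * norm (u x) powr p)" by (rule integrable_indicator_mult[OF shell_measurable Iu])
    have Ifar: "integrable M (\<lambda>x. indicator {x. t < N x} x * ?g x)" for t by (rule integrable_indicator_mult[OF far_set_measurable Ig])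
    have E_eq: "E = far_energy u s - far_energy u (4 * s)"
    proof -
      have "far_energy u s - far_energy u (4 * s) = (LINT x|M. indicator {x. s < N x} x * ?g x - indicator {x. 4 * s < N x} x * ?g x)"
        unfolding far_energy_def using Ifar by simp
      also have "\<dots> = E" unfolding E_def
        using s by (intro Bochner_Integration.integral_cong) (auto simp: indicator_def shell_def)
      finally show ?thesis by simp
    qed
    have E0: "0 \<le> E" unfolding E_def using \<gamma>(3) by (intro Bochner_Integration.integral_nonneg) auto
    have U_le: "U \<le> P / c * s powr p * E"
    proof -
      let ?cu = "LINT x|M. ?sh x * norm (cgrad u x) powr p"
      have cu0: "0 \<le> ?cu" by (intro Bochner_Integration.integral_nonneg) auto
      have "ennreal U \<le> ennreal (P * s powr p) * ennreal ?cu"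
      proof -
        have sub: "shell s \<subseteq> \<Omega>" by (auto simp: shell_def)
        have 1: "(\<integral>\<^sup>+x. ennreal (norm (u x) powr p) * indicator (shell s) x \<partial>lborel) = ennreal U"
          unfolding U_def by (intro nn_integral_eq_M smooth_norm_powr_measurable u Iu sub shell_measurable) auto
        have 2: "(\<integral>\<^sup>+x. ennreal (norm (cgrad u x) powr p) * indicator (shell s) x \<partial>lborel) = ennreal ?cu"
          by (intro nn_integral_eq_M smooth_norm_powr_measurable u Icu sub shell_measurable) auto
        show ?thesis using shell_Poincare[OF u s sR u0] unfolding 1 2 P_def by simp
      qed
      then have "U \<le> P * s powr p * ?cu" using cu0 P by (simp add: ennreal_mult'[symmetric])
      also have "?cu \<le> E / c"
      proof -
        have "c * ?cu = (LINT x|M. c * (?sh x * norm (cgrad u x) powr p))" by simp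
        also have "\<dots> \<le> E" unfolding E_def
        proof (rule integral_mono)
          show "integrable M (\<lambda>x. c * (?sh x * norm (cgrad u x) powr p))"
            by (intro integrable_mult_right integrable_indicator_mult shell_measurable Icu)
          fix x assume "x \<in> space M"
          then have "c * norm (cgrad u x) powr p \<le> ?g x" using \<gamma>(1) by (intro mult_right_mono) auto
          then show "c * (?sh x * norm (cgrad u x) powr p) \<le> ?sh x * ?g x" by (simp add: indicator_def)
        qed (rule IE)
        finally show ?thesis using C(1) by (simp add: field_simps)
      qed
      then have "P * s powr p * ?cu \<le> P * s powr p * (E / c)" using P by (intro mult_left_mono) auto
      finally show ?thesis by (simp add: mult_ac)
    qed
    \<comment> \<open>Three regions: w keeps the gradient of u inside, has gradient 0 outside, and
      obeys the product rule in between. The indicators collect the cases in one integrable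
      bound.\<close>
    have w_le: "\<gamma> x * norm (cgrad w x) powr p \<le> ?g x - indicator {x. s < N x} x * ?g x +
        2 powr p * (?sh x * ?g x + (B / s) powr p * (C * (?sh x * norm (u x) powr p)))" if x: "x \<in> \<Omega>" for x
    proof -
      have cw: "cgrad w x = ?z x *s cgrad u x + u x *s cgrad ?z x"
        unfolding w_def by (rule cgrad_mult[OF \<zeta>(1)[OF s] u])
      consider "N x \<le> s" | "s < N x" "N x \<le> 4 * s" | "4 * s < N x" by linarith
      then show ?thesis
      proof cases
        case 1
        then have "cgrad w x = cgrad u x" using \<zeta>(3)[OF s 1] unfolding cw by (simp add: vec_eq_iff)
        then show ?thesis using 1 by (simp add: shell_def)
      next
        case 2
        have "norm (?z x *s cgrad u x) \<le> norm (cgrad u x)"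
          unfolding norm_vector_smult using \<zeta>(2)[OF s, of x] by (simp add: mult_left_le_one_le)
        then have a: "norm (?z x *s cgrad u x) powr p \<le> norm (cgrad u x) powr p" using p_nonneg by (intro powr_mono2) auto
        have "norm (u x *s cgrad ?z x) \<le> norm (u x) * (B / s)"
          unfolding norm_vector_smult using \<zeta>(5)[OF s, of x] by (intro mult_left_mono) auto
        then have "norm (u x *s cgrad ?z x) powr p \<le> (norm (u x) * (B / s)) powr p" using p_nonneg by (intro powr_mono2) auto
        also have "\<dots> = (B / s) powr p * norm (u x) powr p" using B s by (subst powr_mult) auto
        finally have b: "norm (u x *s cgrad ?z x) powr p \<le> (B / s) powr p * norm (u x) powr p" .
        have "norm (cgrad w x) powr p \<le> 2 powr p * (norm (?z x *s cgrad u x) powr p + norm (u x *s cgrad ?z x) powr p)"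
          unfolding cw by (rule norm_add_powr_le[OF p_nonneg(1)])
        also have "\<dots> \<le> 2 powr p * (norm (cgrad u x) powr p + (B / s) powr p * norm (u x) powr p)"
          using a b by (intro mult_left_mono add_mono) auto
        finally have "\<gamma> x * norm (cgrad w x) powr p \<le> \<gamma> x * (2 powr p * (norm (cgrad u x) powr p + (B / s) powr p * norm (u x) powr p))"
          using \<gamma>(3)[OF x] by (rule mult_left_mono)
        also have "\<dots> = 2 powr p * (?g x + (B / s) powr p * (\<gamma> x * norm (u x) powr p))" by (simp add: algebra_simps)
        also have "\<dots> \<le> 2 powr p * (?g x + (B / s) powr p * (C * norm (u x) powr p))"
          using \<gamma>(2)[OF x] by (intro mult_left_mono add_left_mono mult_right_mono) auto
        finally show ?thesis using 2 x by (simp add: shell_def)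
      next
        case 3
        then have "cgrad w x = 0" using \<zeta>(4)[OF s, of x] unfolding cw by (simp add: vec_eq_iff)
        then show ?thesis using 3 s x p_gt_1 by (simp add: shell_def)
      qed
    qed
    have "energy (cgrad w) \<le> (LINT x|M. ?g x - indicator {x. s < N x} x * ?g x +
        2 powr p * (?sh x * ?g x + (B / s) powr p * (C * (?sh x * norm (u x) powr p))))"
      unfolding energy_def
    proof (rule integral_mono)
      show "integrable M (\<lambda>x. \<gamma> x * norm (cgrad w x) powr p)" by (rule energy_integrable[OF smooth_Lp(2)[OF w]])
      show "integrable M (\<lambda>x. ?g x - indicator {x. s < N x} x * ?g x +
        2 powr p * (?sh x * ?g x + (B / s) powr p * (C * (?sh x * norm (u x) powr p))))"
        by (intro Bochner_Integration.integrable_add Bochner_Integration.integrable_diff integrable_mult_right Ig Ifar IE IU)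
    qed (use w_le in simp)
    also have "\<dots> = energy (cgrad u) - far_energy u s + 2 powr p * (E + (B / s) powr p * (C * U))"
      unfolding energy_def far_energy_def E_def U_def
      using Ig Ifar[of s] IE IU by simp
    finally have "far_energy u s \<le> 2 powr p * (E + (B / s) powr p * (C * U)) + \<epsilon>"
      using Qw near unfolding u_def[symmetric] u_def[abs_def, symmetric] by simp
    also have "2 powr p * (E + (B / s) powr p * (C * U)) \<le> 2 powr p * (E + (B / s) powr p * (C * (P / c * s powr p * E)))"
      using U_le C by (intro mult_left_mono add_left_mono) auto
    also have "\<dots> = D * E"
    proof -
      have "(B / s) powr p * s powr p = B powr p" using B s by (simp add: powr_divide)
      then have "(B / s) powr p * (C * (P / c * s powr p * E)) = B powr p * (C * (P / c)) * E"
        by (metis (no_types, opaque_lifting) mult.assoc mult.commute)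
      then show ?thesis by (simp add: D_def algebra_simps)
    qed
    \<comment> \<open>The shell energy is a difference of two far energies. Moving the term at 4s to
      the left fills the hole and leaves the factor (D - 1) / D; the error is enlarged to D
      \<epsilon> before dividing by D.\<close>
    finally have "far_energy u s \<le> D * (far_energy u s - far_energy u (4 * s)) + \<epsilon>" unfolding E_eq by simp
    then have "D * far_energy u (4 * s) \<le> (D - 1) * far_energy u s + \<epsilon>" by (simp add: algebra_simps)
    also have "\<dots> \<le> (D - 1) * far_energy u s + D * \<epsilon>" using mult_right_mono[OF D1 \<epsilon>] by simp
    also have "\<dots> = D * ((1 - 1 / D) * far_energy u s + \<epsilon>)" using D1 by (simp add: field_simps)
    finally have "far_energy u (4 * s) \<le> (1 - 1 / D) * far_energy u s + \<epsilon>" using D1 by simp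
    then show "far_energy (\<lambda>x. f x + \<phi> x) (4 * s) \<le> (1 - 1 / D) * far_energy (\<lambda>x. f x + \<phi> x) s + \<epsilon>"
      unfolding u_def[abs_def] .
  qed
qed

text \<open>The data are cutoffs supported within \<rho>, and n hole fillings of ratio 4 lead from
  \<rho> to T, each multiplying the far energy by \<theta>. The errors at most add up, as \<theta> <
  1, and n is determined by \<eta> and \<theta> alone, before \<epsilon> is given.\<close>

lemma concentrated_data:
  assumes T: "0 < T" "12 * T < R" and \<eta>: "0 < \<eta>"
  obtains f \<delta> n where "smooth f" "0 < \<delta>"
    "\<And>\<phi>. \<phi> \<in> test_functions \<Omega> \<Longrightarrow> \<delta> \<le> (LINT x|M. norm (cgrad (\<lambda>x. f x + \<phi> x) x) powr p)"
    "\<And>\<phi> Q \<epsilon>. \<phi> \<in> test_functions \<Omega> \<Longrightarrow>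
     \<forall>\<psi>\<in>test_functions \<Omega>. Q \<le> energy (cgrad (\<lambda>x. f x + \<psi> x)) \<Longrightarrow>
     energy (cgrad (\<lambda>x. f x + \<phi> x)) \<le> Q + \<epsilon> \<Longrightarrow> 0 \<le> \<epsilon> \<Longrightarrow>
     far_energy (\<lambda>x. f x + \<phi> x) T \<le> \<eta> * energy (cgrad (\<lambda>x. f x + \<phi> x)) + real n * \<epsilon>"
proof -
  obtain D where D: "1 \<le> D" and hole: "\<And>f \<phi> Q \<epsilon> \<rho> s. smooth f \<Longrightarrow> \<phi> \<in> test_functions \<Omega> \<Longrightarrow>
     (\<And>\<psi>. \<psi> \<in> test_functions \<Omega> \<Longrightarrow> Q \<le> energy (cgrad (\<lambda>x. f x + \<psi> x))) \<Longrightarrow>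
     energy (cgrad (\<lambda>x. f x + \<phi> x)) \<le> Q + \<epsilon> \<Longrightarrow> 0 \<le> \<epsilon> \<Longrightarrow> 0 < \<rho> \<Longrightarrow> \<rho> \<le> s \<Longrightarrow> 12 * s < R \<Longrightarrow>
     (\<And>x. \<rho> \<le> N x \<Longrightarrow> f x = 0 \<and> cgrad f x = 0) \<Longrightarrow>
     far_energy (\<lambda>x. f x + \<phi> x) (4 * s) \<le> (1 - 1 / D) * far_energy (\<lambda>x. f x + \<phi> x) s + \<epsilon>"
    by (rule hole_filling) blast
  define \<theta> where "\<theta> = 1 - 1 / D"
  have \<theta>: "0 \<le> \<theta>" "\<theta> < 1" using D by (simp_all add: \<theta>_def)
  obtain n where n: "\<theta> ^ n < \<eta>" using real_arch_pow_inv[OF \<eta> \<theta>(2)] by blast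
  define \<rho> where "\<rho> = T / 4 ^ n"
  have \<rho>: "0 < \<rho>" using T by (simp add: \<rho>_def)
  have \<rho>T: "4 ^ n * \<rho> = T" by (simp add: \<rho>_def)
  obtain \<zeta> B where B: "0 \<le> B" and \<zeta>: "\<And>s. 0 < s \<Longrightarrow> smooth (\<lambda>x. complex_of_real (\<zeta> s x))"
    "\<And>s x. 0 < s \<Longrightarrow> \<bar>\<zeta> s x\<bar> \<le> 1"
    "\<And>s x. 0 < s \<Longrightarrow> N x \<le> s \<Longrightarrow> \<zeta> s x = 1 \<and> cgrad (\<lambda>x. complex_of_real (\<zeta> s x)) x = 0"
    "\<And>s x. 0 < s \<Longrightarrow> 4 * s \<le> N x \<Longrightarrow> \<zeta> s x = 0 \<and> cgrad (\<lambda>x. complex_of_real (\<zeta> s x)) x = 0"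
    "\<And>s x. 0 < s \<Longrightarrow> norm (cgrad (\<lambda>x. complex_of_real (\<zeta> s x)) x) \<le> B / s"
    by (rule cutoffs, rule that)
  define \<sigma> where "\<sigma> = \<rho> / 4"
  have \<sigma>: "0 < \<sigma>" "4 * \<sigma> = \<rho>" using \<rho> by (simp_all add: \<sigma>_def)
  have "\<rho> \<le> T" using T by (simp add: \<rho>_def field_simps)
  then have \<sigma>R: "4 * \<sigma> < R" using \<sigma> T by simp
  define f where "f x = complex_of_real (\<zeta> \<sigma> x)" for x
  have f: "smooth f" unfolding f_def by (rule \<zeta>(1)[OF \<sigma>(1)])
  have f1: "f x = 1 \<and> cgrad f x = 0" if "N x \<le> \<sigma>" for x using \<zeta>(3)[OF \<sigma>(1) that] by (simp add: f_def[abs_def])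
  have f0: "f x = 0 \<and> cgrad f x = 0" if "\<rho> \<le> N x" for x using \<zeta>(4)[OF \<sigma>(1), of x] that \<sigma>(2) by (simp add: f_def[abs_def])
  obtain \<delta> where \<delta>: "0 < \<delta>" "\<And>\<phi>. \<phi> \<in> test_functions \<Omega> \<Longrightarrow> \<delta> \<le> (LINT x|M. norm (cgrad (\<lambda>x. f x + \<phi> x) x) powr p)"
    by (rule energy_support_positive[OF f \<sigma>(1) \<sigma>R f1 f0[folded \<sigma>(2)]]) blast+
  show ?thesis
  proof (rule that[OF f \<delta>])
    fix \<phi> Q \<epsilon> assume \<phi>: "\<phi> \<in> test_functions \<Omega>"
      and Q: "\<forall>\<psi>\<in>test_functions \<Omega>. Q \<le> energy (cgrad (\<lambda>x. f x + \<psi> x))"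
      and near: "energy (cgrad (\<lambda>x. f x + \<phi> x)) \<le> Q + \<epsilon>" and \<epsilon>: "0 \<le> \<epsilon>"
    let ?u = "\<lambda>x. f x + \<phi> x"
    have u: "smooth ?u" by (intro smooth_add f test_functions_smooth[OF \<phi>])
    have "far_energy ?u (4 ^ j * \<rho>) \<le> \<theta> ^ j * energy (cgrad ?u) + real j * \<epsilon>" if "j \<le> n" for j
      using that
    proof (induction j)
      case 0 then show ?case using far_energy_le[OF u] by simp
    next
      case (Suc j)
      let ?s = "4 ^ j * \<rho>"
      have "4 ^ j * \<rho> \<le> 4 ^ n * \<rho>" using Suc \<rho> by (intro mult_right_mono power_increasing) auto
      then have s: "12 * ?s < R" using T unfolding \<rho>T by simp
      have "\<rho> \<le> ?s" using \<rho> by simp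
      from hole[OF f \<phi> Q[rule_format] near \<epsilon> \<rho> this s f0]
      have "far_energy ?u (4 ^ Suc j * \<rho>) \<le> \<theta> * far_energy ?u ?s + \<epsilon>" by (simp add: \<theta>_def mult.assoc)
      also have "\<theta> * far_energy ?u ?s \<le> \<theta> * (\<theta> ^ j * energy (cgrad ?u) + real j * \<epsilon>)"
        using Suc \<theta> by (intro mult_left_mono) auto
      also have "\<dots> = \<theta> ^ Suc j * energy (cgrad ?u) + \<theta> * (real j * \<epsilon>)" by (simp add: algebra_simps)
      also have "\<theta> * (real j * \<epsilon>) \<le> real j * \<epsilon>" using \<theta> \<epsilon> by (intro mult_left_le_one_le) auto
      finally show ?case by (simp add: algebra_simps)
    qed
    from this[of n] have "far_energy ?u T \<le> \<theta> ^ n * energy (cgrad ?u) + real n * \<epsilon>" unfolding \<rho>T by simp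
    also have "\<theta> ^ n * energy (cgrad ?u) \<le> \<eta> * energy (cgrad ?u)" using n energy_nonneg by (intro mult_right_mono) auto
    finally show "far_energy ?u T \<le> \<eta> * energy (cgrad ?u) + real n * \<epsilon>" by simp
  qed
qed

end

section \<open>Boundary determination\<close>

text \<open>The graph passes through \<open>x0\<close>, and its differentiability there keeps it
  between two cones of slope \<open>K\<close> nearby. The same \<open>K\<close> shapes the cylinder
  in which this is claimed.\<close>

lemma C1_boundary_cone:
  fixes \<Omega> :: "(real ^ 'n) set"
  assumes "C1_boundary \<Omega>" "open \<Omega>" and x0: "x0 \<in> frontier \<Omega>"
  obtains \<nu> K R where "norm \<nu> = 1" "0 < K" "0 < R"
    "\<And>x. cyl_norm \<nu> K (x - x0) < R \<Longrightarrow> K * norm (radial_part \<nu> (x - x0)) < \<nu> \<bullet> (x - x0) \<Longrightarrow> x \<in> \<Omega>"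
    "\<And>x. cyl_norm \<nu> K (x - x0) < R \<Longrightarrow> \<nu> \<bullet> (x - x0) \<le> - K * norm (radial_part \<nu> (x - x0)) \<Longrightarrow> x \<notin> \<Omega>"
proof -
  obtain r \<nu> h where r: "0 < r" and \<nu>: "norm \<nu> = 1" and h: "C1_function h"
    and graph: "\<Omega> \<inter> ball x0 r = {x \<in> ball x0 r. \<nu> \<bullet> x > h (x - (\<nu> \<bullet> x) *\<^sub>R \<nu>)}"
    using assms(1) x0 unfolding C1_boundary_def by blast
  obtain g where g: "\<And>x. (h has_derivative (\<lambda>v. g x \<bullet> v)) (at x)" using h unfolding C1_function_def by blast
  have mem: "x \<in> \<Omega> \<longleftrightarrow> h (radial_part \<nu> x) < \<nu> \<bullet> x" if "x \<in> ball x0 r" for x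
    using graph that unfolding radial_part_def by blast
  let ?y = "radial_part \<nu> x0"
  have conth: "continuous_on UNIV h" using g by (intro has_derivative_continuous_on) (auto intro: has_derivative_at_withinI)
  have "x0 \<notin> \<Omega>" using x0 assms(2) by (simp add: frontier_def interior_open)
  then have "\<nu> \<bullet> x0 \<le> h ?y" using mem[of x0] r by auto
  \<comment> \<open>Strictly below the graph, \<open>x0\<close> would have a neighbourhood free of
    \<Omega>, although it lies in the closure.\<close>
  moreover have "\<not> \<nu> \<bullet> x0 < h ?y"
  proof
    assume lt: "\<nu> \<bullet> x0 < h ?y"
    let ?S = "{x. \<nu> \<bullet> x < h (radial_part \<nu> x)} \<inter> ball x0 r"
    have "open ?S"
      by (intro open_Int open_ball open_Collect_less continuous_intros continuous_on_compose2[OF conth continuous_on_radial_part]) auto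
    moreover have "?S \<inter> \<Omega> = {}" using mem by auto
    ultimately have "?S \<inter> closure \<Omega> = {}" using open_Int_closure_eq_empty by blast
    moreover have "x0 \<in> ?S" using lt r by simp
    ultimately show False using x0 by (auto simp: frontier_def)
  qed
  ultimately have h0: "h ?y = \<nu> \<bullet> x0" by simp
  obtain d where d: "0 < d" "\<And>y. norm (y - ?y) < d \<Longrightarrow> norm (h y - h ?y - g ?y \<bullet> (y - ?y)) \<le> 1 * norm (y - ?y)"
    using g[of ?y] unfolding has_derivative_at_alt by (metis zero_less_one)
  \<comment> \<open>The summand 1 absorbs the first-order error, taken with tolerance 1 in the
    definition of the derivative.\<close>
  define K where "K = 1 + norm (g ?y)"
  have K: "0 < K" by (simp add: K_def add_pos_nonneg)
  \<comment> \<open>The first bound keeps the radial part within d, the second keeps the cylinder in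
    the ball, since the norm is at most 1 + K times the gauge.\<close>
  define R where "R = min d (r / (1 + K))"
  have R: "0 < R" using d r K by (simp add: R_def)
  have est: "\<bar>h (radial_part \<nu> x) - \<nu> \<bullet> x0\<bar> \<le> K * norm (radial_part \<nu> (x - x0)) \<and> x \<in> ball x0 r"
    if x: "cyl_norm \<nu> K (x - x0) < R" for x
  proof -
    have eq: "radial_part \<nu> x - ?y = radial_part \<nu> (x - x0)" by (simp add: radial_part_def inner_diff_right algebra_simps)
    have "norm (radial_part \<nu> (x - x0)) < d" using x by (simp add: cyl_norm_def R_def)
    then have "norm (h (radial_part \<nu> x) - h ?y - g ?y \<bullet> radial_part \<nu> (x - x0)) \<le> norm (radial_part \<nu> (x - x0))"
      using d(2)[of "radial_part \<nu> x"] unfolding eq by simp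
    moreover have "\<bar>g ?y \<bullet> radial_part \<nu> (x - x0)\<bar> \<le> norm (g ?y) * norm (radial_part \<nu> (x - x0))" by (rule Cauchy_Schwarz_ineq2)
    ultimately have "\<bar>h (radial_part \<nu> x) - h ?y\<bar> \<le> K * norm (radial_part \<nu> (x - x0))"
      unfolding K_def distrib_right real_norm_def by linarith
    moreover have "norm (x - x0) < r"
    proof -
      have "norm (x - x0) \<le> (1 + K) * cyl_norm \<nu> K (x - x0)" by (rule norm_le_cyl_norm[OF \<nu> K])
      also have "\<dots> < (1 + K) * (r / (1 + K))" using x K by (intro mult_strict_left_mono) (auto simp: R_def)
      also have "\<dots> = r" using K by simp
      finally show ?thesis .
    qed
    ultimately show ?thesis using h0 by (simp add: dist_norm norm_minus_commute)
  qed
  show ?thesis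
  proof (rule that[OF \<nu> K R])
    fix x assume x: "cyl_norm \<nu> K (x - x0) < R"
    show "x \<in> \<Omega>" if "K * norm (radial_part \<nu> (x - x0)) < \<nu> \<bullet> (x - x0)"
      using est[OF x] that mem[of x] by (simp add: inner_diff_right abs_le_iff)
    show "x \<notin> \<Omega>" if "\<nu> \<bullet> (x - x0) \<le> - K * norm (radial_part \<nu> (x - x0))"
      using est[OF x] that mem[of x] by (simp add: inner_diff_right abs_le_iff)
  qed
qed

text \<open>The hypotheses are symmetric in the two weights, so one inequality settles the
  theorem.\<close>

lemma DN_map_determines_boundary_le:
  fixes \<Omega> :: "(real ^ 'n) set" and p :: real and \<gamma>\<^sub>1 \<gamma>\<^sub>2 :: "real ^ 'n \<Rightarrow> real"
  assumes p: "1 < p" and n2: "CARD('n) \<ge> 2"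
    and \<Omega>: "open \<Omega>" "bounded \<Omega>" "C1_boundary \<Omega>"
    and \<gamma>1: "continuous_on (closure \<Omega>) \<gamma>\<^sub>1" "\<forall>x \<in> closure \<Omega>. \<gamma>\<^sub>1 x > 0"
    and \<gamma>2: "continuous_on (closure \<Omega>) \<gamma>\<^sub>2" "\<forall>x \<in> closure \<Omega>. \<gamma>\<^sub>2 x > 0"
    and DN: "DN_map \<Omega> p \<gamma>\<^sub>1 = DN_map \<Omega> p \<gamma>\<^sub>2"
    and x0: "x0 \<in> frontier \<Omega>"
  shows "\<gamma>\<^sub>2 x0 \<le> \<gamma>\<^sub>1 x0"
proof (rule ccontr)
  assume "\<not> \<gamma>\<^sub>2 x0 \<le> \<gamma>\<^sub>1 x0"
  then have lt: "\<gamma>\<^sub>1 x0 < \<gamma>\<^sub>2 x0" by simp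
  have x0c: "x0 \<in> closure \<Omega>" using x0 by (simp add: frontier_def)
  obtain \<nu> K R where \<nu>: "norm \<nu> = 1" and K: "0 < K" and R: "0 < R" and cone:
    "\<And>x. cyl_norm \<nu> K (x - x0) < R \<Longrightarrow> K * norm (radial_part \<nu> (x - x0)) < \<nu> \<bullet> (x - x0) \<Longrightarrow> x \<in> \<Omega>"
    "\<And>x. cyl_norm \<nu> K (x - x0) < R \<Longrightarrow> \<nu> \<bullet> (x - x0) \<le> - K * norm (radial_part \<nu> (x - x0)) \<Longrightarrow> x \<notin> \<Omega>"
    by (rule C1_boundary_cone[OF \<Omega>(3) \<Omega>(1) x0]) blast
  have "2 \<le> DIM(real ^ 'n)" using n2 by simp
  then obtain e' where e': "e' \<noteq> 0" "orthogonal \<nu> e'" by (rule orthogonal_to_vector_exists)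
  define e where "e = e' /\<^sub>R norm e'"
  have e: "norm e = 1" "\<nu> \<bullet> e = 0" using e' by (simp_all add: e_def orthogonal_def)
  interpret A: weighted_domain \<Omega> p \<gamma>\<^sub>1 by unfold_locales (use \<Omega> p \<gamma>1 in auto)
  interpret B: weighted_cone \<Omega> p \<gamma>\<^sub>2 x0 \<nu> e K R
    by unfold_locales (use \<gamma>2 \<nu> e K R cone in auto)
  \<comment> \<open>Halfway between the ratio of the weights at \<open>x0\<close> and 1: the
    comparison at \<open>x0\<close> is then strict and survives in a neighbourhood, with a factor
    still below 1.\<close>
  define \<kappa> where "\<kappa> = (\<gamma>\<^sub>1 x0 / \<gamma>\<^sub>2 x0 + 1) / 2"
  have g0: "0 < \<gamma>\<^sub>1 x0" "0 < \<gamma>\<^sub>2 x0" using \<gamma>1 \<gamma>2 x0c by auto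
  have ratio: "\<gamma>\<^sub>1 x0 / \<gamma>\<^sub>2 x0 < 1" using lt g0 by simp
  have \<kappa>: "0 < \<kappa>" "\<kappa> < 1" "\<gamma>\<^sub>1 x0 < \<kappa> * \<gamma>\<^sub>2 x0"
  proof -
    show "0 < \<kappa>" using g0 by (simp add: \<kappa>_def add_pos_pos)
    show "\<kappa> < 1" using ratio by (simp add: \<kappa>_def)
    have "\<gamma>\<^sub>1 x0 / \<gamma>\<^sub>2 x0 < \<kappa>"
    proof -
      have "q < (q + 1) / 2" if "q < 1" for q :: real using that by simp
      from this[OF ratio] show ?thesis unfolding \<kappa>_def .
    qed
    then show "\<gamma>\<^sub>1 x0 < \<kappa> * \<gamma>\<^sub>2 x0" using g0 by (simp add: field_simps)
  qed
  have "continuous_on (closure \<Omega>) (\<lambda>x. \<gamma>\<^sub>1 x - \<kappa> * \<gamma>\<^sub>2 x)" by (intro continuous_intros \<gamma>1 \<gamma>2)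
  then obtain d where d: "0 < d" "\<And>x. x \<in> closure \<Omega> \<Longrightarrow> dist x x0 < d \<Longrightarrow>
      dist (\<gamma>\<^sub>1 x - \<kappa> * \<gamma>\<^sub>2 x) (\<gamma>\<^sub>1 x0 - \<kappa> * \<gamma>\<^sub>2 x0) < \<kappa> * \<gamma>\<^sub>2 x0 - \<gamma>\<^sub>1 x0"
    unfolding continuous_on_iff using x0c \<kappa>(3) by (metis diff_gt_0_iff_gt)
  have near: "\<gamma>\<^sub>1 x \<le> \<kappa> * \<gamma>\<^sub>2 x" if "x \<in> closure \<Omega>" "norm (x - x0) < d" for x
    using d(2)[of x] that by (auto simp: dist_norm abs_less_iff)
  obtain c1 C1 where C1: "0 < c1" "0 < C1" "\<And>x. x \<in> closure \<Omega> \<Longrightarrow> c1 \<le> \<gamma>\<^sub>1 x \<and> \<gamma>\<^sub>1 x \<le> C1" by (rule A.\<gamma>_bounds) blast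
  obtain c2 C2 where C2: "0 < c2" "0 < C2" "\<And>x. x \<in> closure \<Omega> \<Longrightarrow> c2 \<le> \<gamma>\<^sub>2 x \<and> \<gamma>\<^sub>2 x \<le> C2" by (rule B.\<gamma>_bounds) blast
  \<comment> \<open>Away from \<open>x0\<close> only this global bound on the ratio of the weights
    is available, so the energy there has to be made small.\<close>
  define H where "H = C1 / c2"
  have H: "0 < H" using C1 C2 by (simp add: H_def)
  have global: "\<gamma>\<^sub>1 x \<le> H * \<gamma>\<^sub>2 x" if "x \<in> closure \<Omega>" for x
  proof -
    have "C1 = H * c2" using C2 by (simp add: H_def)
    also have "\<dots> \<le> H * \<gamma>\<^sub>2 x" using C2(3)[OF that] H by (intro mult_left_mono) auto
    finally show ?thesis using C1(3)[OF that] by simp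
  qed
  \<comment> \<open>Points of gauge at most T lie within d of \<open>x0\<close>, and 12 T <= R / 2
    leaves room for the shells.\<close>
  define T where "T = min (d / (2 * (1 + K))) (R / 24)"
  have T: "0 < T" "12 * T < R" using d R K by (auto simp: T_def)
  have Td: "(1 + K) * T < d"
  proof -
    have "(1 + K) * T \<le> (1 + K) * (d / (2 * (1 + K)))" using K by (intro mult_left_mono) (auto simp: T_def)
    also have "\<dots> = d / 2" using K by (simp add: field_simps)
    finally show ?thesis using d by simp
  qed
  \<comment> \<open>Makes the total factor \<kappa> + H \<eta> equal to (1 + \<kappa>) / 2, which is
    still below 1.\<close>
  define \<eta> where "\<eta> = (1 - \<kappa>) / (2 * H)"
  have \<eta>: "0 < \<eta>" using \<kappa> H by (simp add: \<eta>_def)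
  have mu: "\<kappa> + H * \<eta> = (1 + \<kappa>) / 2" using H by (simp add: \<eta>_def field_simps)
  obtain f \<delta> n where f: "smooth f" and \<delta>: "0 < \<delta>"
    "\<And>\<phi>. \<phi> \<in> test_functions \<Omega> \<Longrightarrow> \<delta> \<le> (LINT x|lebesgue_on \<Omega>. norm (cgrad (\<lambda>x. f x + \<phi> x) x) powr p)"
    and far: "\<And>\<phi> Q \<epsilon>. \<phi> \<in> test_functions \<Omega> \<Longrightarrow>
     \<forall>\<psi>\<in>test_functions \<Omega>. Q \<le> B.energy (cgrad (\<lambda>x. f x + \<psi> x)) \<Longrightarrow>
     B.energy (cgrad (\<lambda>x. f x + \<phi> x)) \<le> Q + \<epsilon> \<Longrightarrow> 0 \<le> \<epsilon> \<Longrightarrow>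
     B.far_energy (\<lambda>x. f x + \<phi> x) T \<le> \<eta> * B.energy (cgrad (\<lambda>x. f x + \<phi> x)) + real n * \<epsilon>"
    by (rule B.concentrated_data[OF T \<eta>], rule that)
  obtain Q1 where Q1: "DN_map \<Omega> p \<gamma>\<^sub>1 (A.trace_class f) (A.trace_class f) = complex_of_real Q1"
    "\<And>\<phi>. \<phi> \<in> test_functions \<Omega> \<Longrightarrow> Q1 \<le> A.energy (cgrad (\<lambda>x. f x + \<phi> x))"
    by (rule A.DN_map_diagonal[OF f]) blast
  obtain Q where Q: "DN_map \<Omega> p \<gamma>\<^sub>2 (A.trace_class f) (A.trace_class f) = complex_of_real Q"
    "\<And>\<phi>. \<phi> \<in> test_functions \<Omega> \<Longrightarrow> Q \<le> B.energy (cgrad (\<lambda>x. f x + \<phi> x))"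
    "\<And>\<epsilon>. 0 < \<epsilon> \<Longrightarrow> \<exists>\<phi>\<in>test_functions \<Omega>. B.energy (cgrad (\<lambda>x. f x + \<phi> x)) < Q + \<epsilon>"
    by (rule B.DN_map_diagonal[OF f]) blast
  have Q_eq: "Q1 = Q" using Q1(1) Q(1) DN by simp
  have in_cl: "x \<in> closure \<Omega>" if "x \<in> \<Omega>" for x using that closure_subset by blast
  have energy_ge: "c2 * \<delta> \<le> B.energy (cgrad (\<lambda>x. f x + \<phi> x))" if \<phi>: "\<phi> \<in> test_functions \<Omega>" for \<phi>
  proof -
    have sm: "smooth (\<lambda>x. f x + \<phi> x)" by (intro smooth_add f test_functions_smooth[OF \<phi>])
    have "c2 * \<delta> \<le> c2 * (LINT x|lebesgue_on \<Omega>. norm (cgrad (\<lambda>x. f x + \<phi> x) x) powr p)"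
      using \<delta>(2)[OF \<phi>] C2 by (intro mult_left_mono) auto
    also have "\<dots> = (LINT x|lebesgue_on \<Omega>. c2 * norm (cgrad (\<lambda>x. f x + \<phi> x) x) powr p)" by simp
    also have "\<dots> \<le> B.energy (cgrad (\<lambda>x. f x + \<phi> x))"
      unfolding B.energy_def
      using C2(3) in_cl
      by (intro integral_mono integrable_mult_right LpD(2)[OF A.smooth_Lp(2)[OF sm]] B.energy_integrable A.smooth_Lp sm mult_right_mono) auto
    finally show ?thesis .
  qed
  \<comment> \<open>Positivity of the minimum is what will turn Q <= (1 + \<kappa>) / 2 Q into a
    contradiction.\<close>
  have "c2 * \<delta> \<le> Q"
  proof (rule field_le_epsilon)
    fix \<epsilon> :: real assume "0 < \<epsilon>"
    then obtain \<phi> where "\<phi> \<in> test_functions \<Omega>" "B.energy (cgrad (\<lambda>x. f x + \<phi> x)) < Q + \<epsilon>" using Q(3) by blast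
    then show "c2 * \<delta> \<le> Q + \<epsilon>" using energy_ge by fastforce
  qed
  moreover have "0 < c2 * \<delta>" using C2 \<delta> by simp
  ultimately have Qpos: "0 < Q" by linarith
  \<comment> \<open>Up to gauge T the weights compare with \<kappa>, beyond it only with H. Charging
    \<kappa> everywhere and H beyond T in addition gives an upper bound.\<close>
  have key: "A.energy (cgrad u) \<le> \<kappa> * B.energy (cgrad u) + H * B.far_energy u T" if u: "smooth u" for u
  proof -
    note I = A.energy_integrable[OF A.smooth_Lp(2)[OF u]] B.energy_integrable[OF A.smooth_Lp(2)[OF u]]
    note J = A.integrable_indicator_mult[OF B.far_set_measurable I(2), of T]
    have "A.energy (cgrad u) \<le> (LINT x|lebesgue_on \<Omega>. \<kappa> * (\<gamma>\<^sub>2 x * norm (cgrad u x) powr p) +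
        H * (indicator {x. T < B.N x} x * (\<gamma>\<^sub>2 x * norm (cgrad u x) powr p)))"
      unfolding A.energy_def
    proof (rule integral_mono)
      show "integrable (lebesgue_on \<Omega>) (\<lambda>x. \<kappa> * (\<gamma>\<^sub>2 x * norm (cgrad u x) powr p) +
        H * (indicator {x. T < B.N x} x * (\<gamma>\<^sub>2 x * norm (cgrad u x) powr p)))"
        by (intro Bochner_Integration.integrable_add integrable_mult_right I J)
      fix x assume "x \<in> space (lebesgue_on \<Omega>)"
      then have x: "x \<in> closure \<Omega>" using in_cl by simp
      have g2: "0 \<le> \<gamma>\<^sub>2 x" using \<gamma>2 x by (auto intro: less_imp_le)
      show "\<gamma>\<^sub>1 x * norm (cgrad u x) powr p \<le> \<kappa> * (\<gamma>\<^sub>2 x * norm (cgrad u x) powr p) +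
        H * (indicator {x. T < B.N x} x * (\<gamma>\<^sub>2 x * norm (cgrad u x) powr p))"
      proof (cases "T < B.N x")
        case True
        have "\<gamma>\<^sub>1 x * norm (cgrad u x) powr p \<le> H * \<gamma>\<^sub>2 x * norm (cgrad u x) powr p"
          using global[OF x] by (intro mult_right_mono) auto
        moreover have "0 \<le> \<kappa> * (\<gamma>\<^sub>2 x * norm (cgrad u x) powr p)" using \<kappa> g2 by simp
        ultimately show ?thesis using True by (simp add: mult.assoc)
      next
        case False
        have "norm (x - x0) \<le> (1 + K) * B.N x" unfolding B.N_def by (rule norm_le_cyl_norm[OF \<nu> K])
        also have "\<dots> \<le> (1 + K) * T" using False K by (intro mult_left_mono) auto
        finally have "norm (x - x0) < d" using Td by simp
        then have "\<gamma>\<^sub>1 x * norm (cgrad u x) powr p \<le> \<kappa> * \<gamma>\<^sub>2 x * norm (cgrad u x) powr p"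
          using near[OF x] by (intro mult_right_mono) auto
        then show ?thesis using False by (simp add: mult.assoc)
      qed
    qed (rule I)
    also have "\<dots> = \<kappa> * B.energy (cgrad u) + H * B.far_energy u T"
      unfolding B.energy_def B.far_energy_def using I(2) J by simp
    finally show ?thesis .
  qed
  have "Q \<le> (1 + \<kappa>) / 2 * Q"
  proof (rule field_le_epsilon)
    fix \<epsilon> :: real assume \<epsilon>: "0 < \<epsilon>"
    \<comment> \<open>H and n are already fixed, so the accumulated error (1 + H n) \<epsilon>' can
      be made equal to \<epsilon>.\<close>
    define \<epsilon>' where "\<epsilon>' = \<epsilon> / (1 + H * real n)"
    have pos: "0 < 1 + H * real n" using H by (simp add: add_pos_nonneg)
    have \<epsilon>': "0 < \<epsilon>'" using \<epsilon> pos by (simp add: \<epsilon>'_def)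
    obtain \<phi> where \<phi>: "\<phi> \<in> test_functions \<Omega>" "B.energy (cgrad (\<lambda>x. f x + \<phi> x)) < Q + \<epsilon>'" using Q(3)[OF \<epsilon>'] by blast
    let ?u = "\<lambda>x. f x + \<phi> x"
    have sm: "smooth ?u" by (intro smooth_add f test_functions_smooth[OF \<phi>(1)])
    have "Q \<le> A.energy (cgrad ?u)" using Q1(2)[OF \<phi>(1)] Q_eq by simp
    also have "\<dots> \<le> \<kappa> * B.energy (cgrad ?u) + H * B.far_energy ?u T" by (rule key[OF sm])
    also have "\<dots> \<le> \<kappa> * B.energy (cgrad ?u) + H * (\<eta> * B.energy (cgrad ?u) + real n * \<epsilon>')"
      using far[OF \<phi>(1) ballI[OF Q(2)] less_imp_le[OF \<phi>(2)] less_imp_le[OF \<epsilon>']] H by (intro add_left_mono mult_left_mono) auto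
    also have "\<dots> = (\<kappa> + H * \<eta>) * B.energy (cgrad ?u) + H * real n * \<epsilon>'" by (simp add: algebra_simps)
    also have "\<dots> \<le> (1 + \<kappa>) / 2 * (Q + \<epsilon>') + H * real n * \<epsilon>'"
      unfolding mu using \<phi>(2) \<kappa> by (intro add_right_mono mult_left_mono) auto
    also have "\<dots> \<le> (1 + \<kappa>) / 2 * Q + (1 + H * real n) * \<epsilon>'"
    proof -
      have "(1 + \<kappa>) / 2 * \<epsilon>' \<le> 1 * \<epsilon>'" using \<kappa> \<epsilon>' by (intro mult_right_mono) auto
      then show ?thesis
        using distrib_left[of "(1 + \<kappa>) / 2" Q \<epsilon>'] distrib_right[of 1 "H * real n" \<epsilon>'] by argo
    qed
    also have "(1 + H * real n) * \<epsilon>' = \<epsilon>" using pos by (simp add: \<epsilon>'_def)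
    finally show "Q \<le> (1 + \<kappa>) / 2 * Q + \<epsilon>" .
  qed
  moreover have "(1 + \<kappa>) / 2 * Q < 1 * Q" using \<kappa> Qpos by (intro mult_strict_right_mono) auto
  ultimately show False by simp
qed

theorem theorem1p2:
  fixes \<Omega> :: "(real ^ 'n) set" and p :: real and \<gamma>\<^sub>1 \<gamma>\<^sub>2 :: "real ^ 'n \<Rightarrow> real"
  assumes "1 < p"
    and "CARD('n) \<ge> 2"
    and "open \<Omega>" and "bounded \<Omega>" and "C1_boundary \<Omega>"
    and "continuous_on (closure \<Omega>) \<gamma>\<^sub>1" and "\<forall>x \<in> closure \<Omega>. \<gamma>\<^sub>1 x > 0"
    and "continuous_on (closure \<Omega>) \<gamma>\<^sub>2" and "\<forall>x \<in> closure \<Omega>. \<gamma>\<^sub>2 x > 0"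
    and "DN_map \<Omega> p \<gamma>\<^sub>1 = DN_map \<Omega> p \<gamma>\<^sub>2"
  shows "\<forall>x \<in> frontier \<Omega>. \<gamma>\<^sub>1 x = \<gamma>\<^sub>2 x"
proof
  fix x assume x: "x \<in> frontier \<Omega>"
  show "\<gamma>\<^sub>1 x = \<gamma>\<^sub>2 x"
  proof (rule antisym)
    show "\<gamma>\<^sub>2 x \<le> \<gamma>\<^sub>1 x"
      by (rule DN_map_determines_boundary_le[OF assms x])
    show "\<gamma>\<^sub>1 x \<le> \<gamma>\<^sub>2 x"
      by (rule DN_map_determines_boundary_le[OF assms(1-5) assms(8,9) assms(6,7) assms(10)[symmetric] x])
  qed
qed

end
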